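(* Let $n\geq 1$, $k\geq1$ and $j\in\{0,\dots,k\}$, and consider the set $\mathcal P^n_{k,j}$ of matrix polynomials $$P(\lambda)=-\lambda^jJ+\sum_{i=0}^k\lambda^iA_i$$ with $J,A_0,\dots,A_k\in\mathbb R^{n,n}$, $J^\top=-J$ and $A_i^\top=A_i\geq0$ for $i=0,\dots,k$. (i) If $P(\lambda)\in\mathcal P^n_{k,j}$, then the following statements are equivalent: (a) $P(\lambda)$ is singular, i.e., $\det P(\lambda)\equiv0$; (b) the matrix $P(1)$ is singular; (c) the kernels of the matrices $J,A_0,\dots,A_k$ have a nontrivial intersection. (ii) If $P(\lambda)\in\mathcal P^n_{k,j}$, then its distance to the set of singular matrix polynomials in $\mathcal P^n_{k,j}$ equals the distance to the common kernel of $J,A_0,\dots,A_k$, i.e., $$d_{\mathrm{sing}}^{\mathcal P}(P(\lambda))=d_{\mathrm{ck}}^{\mathcal S}(J,A_0,\dots,A_k).$$ (iii) If $\max\{n,k\}>1$, then the closure in $\mathcal P^n_{k,j}$ of the set $$\mathcal I_{\mathrm{hi}}:=\{P(\lambda)\in\mathcal P^n_{k,j}\mid P(\lambda)\text{ is regular and has index greater than one}\}$$ is equal to $$\Big\{-\lambda^jJ+\sum_{i=0}^k\lambda^iA_i\in\mathcal P^n_{k,j}\ \Big|\ \ker A_k\cap\ker A_{k-1}\neq\{0\}\Big\}\quad\text{if } j<k,$$ or to $$\Big\{-\lambda^kJ+\sum_{i=0}^k\lambda^iA_i\in\mathcal P^n_{k,k}\ \Big|\ \ker J\cap\ker A_k\cap\ker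 A_{k-1}\neq\{0\}\Big\}\quad\text{if } j=k>1.$$ If $\max\{n,k\}=1$ or $j=k=1$, then $\mathcal I_{\mathrm{hi}}$ is empty. (iv) Let $P(\lambda)\in\mathcal P^n_{k,j}$. If $\max\{n,k\}>1$, then the distance of $P(\lambda)$ to the set of higher index polynomials in $\mathcal P^n_{k,j}$ equals the distance to the respective common kernel: $$d_{\mathrm{hi}}^{\mathcal P}(P(\lambda))=\begin{cases}d_{\mathrm{ck}}^{\mathcal S}(0,A_k,A_{k-1})&\text{if } j<k,\\ d_{\mathrm{ck}}^{\mathcal S}(J,A_k,A_{k-1})&\text{if } j=k>1.\end{cases}$$ If $\max\{n,k\}=1$ or $j=k=1$, then $d_{\mathrm{hi}}^{\mathcal P}(P(\lambda))=\infty$.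
   Context: $X\geq0$ means that the symmetric matrix $X$ is positive semidefinite. For a matrix polynomial, $\|\sum_{i=0}^k\lambda^iY_i\|_F:=\|[Y_0,\dots,Y_k]\|_F$ (Frobenius norm). Closures are taken in the topology of coefficientwise convergence. A square matrix polynomial $P$ is singular if $\det P(\lambda)\equiv0$ and regular otherwise. The index of $P(\lambda)=\sum_{i=0}^k\lambda^iY_i$, viewed as an element of $\mathcal P^n_{k,j}$ (i.e., with grade $k$, leading coefficients being allowed to vanish), is defined as the index of its companion linearization, the $kn\times kn$ pencil $$\lambda\begin{bmatrix}Y_k&&&\\&I&&\\&&\ddots&\\&&&I\end{bmatrix}+\begin{bmatrix}Y_{k-1}&\dots&Y_1&Y_0\\-I&0&&\\&\ddots&\ddots&\\&&-I&0\end{bmatrix}$$ (which is $\lambda Y_1+Y_0$ for $k=1$). The index of a pencil is the size of its largest Kronecker block associated with the eigenvalue $\infty$ in the Kronecker canonical form ($0$ if there is none). For $P\in\mathcal P^n_{k,j}$, with $\Delta_P$ ranging over real $n\times n$ matrix polynomials of degree at most $k$: $d_{\mathrm{sing}}^{\mathcal P}(P):=\inf\{\|\Delta_P(\lambda)\|_F : P(\lambda)+\Delta_P(\lambda)\in\mathcal P^n_{k,j}\text{ is singular}\}$; $d_{\mathrm{hi}}^{\mathcal P}(P):=\inf\{\|\Delta_P(\lambda)\|_F : P(\lambda)+\Delta_P(\lambda)\in\mathcal P^n_{k,j}\text{ is of index}\geq2\}$, with $\inf\emptyset=\infty$. For $\ell\geq0$, $\mathcal S^n_\ell$ is the set of tuples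 $(J,X_0,\dots,X_\ell)$ of real $n\times n$ matrices with $J^\top=-J$ and $X_i=X_i^\top\geq0$, $i=0,\dots,\ell$; and $d_{\mathrm{ck}}^{\mathcal S}(J,X_0,\dots,X_\ell)$ is the infimum of $\|[\Delta_J,\Delta_{X_0},\dots,\Delta_{X_\ell}]\|_F$ over all real perturbations with $(J+\Delta_J,X_0+\Delta_{X_0},\dots,X_\ell+\Delta_{X_\ell})\in\mathcal S^n_\ell$ and $\ker(J+\Delta_J)\cap\bigcap_{i=0}^\ell\ker(X_i+\Delta_{X_i})\neq\{0\}$. *)

theory Defs
  imports
    "Jordan_Normal_Form.Jordan_Normal_Form"
    "Jordan_Normal_Form.Matrix_Kernel"
    "Jordan_Normal_Form.Determinant"
    "HOL-Analysis.Function_Topology"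
    "HOL-Analysis.Abstract_Topology_2"
    "HOL-Library.Extended_Real"
begin

section \<open>Matrix polynomials\<close>

text \<open>A matrix polynomial is a matrix with polynomial entries. The grade \<open>k\<close> is a parameter of
  every notion that depends on it, since leading coefficients are allowed to vanish.\<close>

definition matpolys :: "nat \<Rightarrow> nat \<Rightarrow> real poly mat set" where
  "matpolys n k = {P \<in> carrier_mat n n. \<forall>r<n. \<forall>c<n. degree (P $$ (r, c)) \<le> k}"

definition mp_coeff :: "real poly mat \<Rightarrow> nat \<Rightarrow> real mat" where
  "mp_coeff P i = map_mat (\<lambda>p. coeff p i) P"

definition mp_eval :: "real poly mat \<Rightarrow> real \<Rightarrow> real mat" where
  "mp_eval P x = map_mat (\<lambda>p. poly p x) P"

definition singular_mp :: "real poly mat \<Rightarrow> bool" where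
  "singular_mp P \<longleftrightarrow> Determinant.det P = 0"

definition singular_matrix :: "real mat \<Rightarrow> bool" where
  "singular_matrix M \<longleftrightarrow> Determinant.det M = 0"

text \<open>Frobenius norm of the block row matrix \<open>[Y\<^sub>0, \<dots>, Y\<^sub>m]\<close>.\<close>

definition frob_norm :: "real mat list \<Rightarrow> real" where
  "frob_norm Ys = sqrt (\<Sum>Y\<leftarrow>Ys. \<Sum>r<dim_row Y. \<Sum>c<dim_col Y. (Y $$ (r, c))\<^sup>2)"

definition mp_norm :: "nat \<Rightarrow> real poly mat \<Rightarrow> real" where
  "mp_norm k P = frob_norm (map (mp_coeff P) [0..<Suc k])"

text \<open>The topology of coefficientwise convergence on the matrix polynomials of grade \<open>k\<close>.\<close>

definition coeff_topology :: "nat \<Rightarrow> nat \<Rightarrow> real poly mat topology" where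
  "coeff_topology n k =
     pullback_topology (matpolys n k)
       (\<lambda>P. \<lambda>(i, r, c) \<in> {..k} \<times> {..<n} \<times> {..<n}. coeff (P $$ (r, c)) i)
       (product_topology (\<lambda>_. euclideanreal) ({..k} \<times> {..<n} \<times> {..<n}))"


section \<open>Kronecker canonical form and index\<close>

text \<open>A pencil \<open>\<lambda>X + Y\<close> is given by the pair \<open>X\<close>, \<open>Y\<close>. The blocks of the Kronecker canonical form
  under strict equivalence over the complex numbers are, in this order, the \<open>\<epsilon> \<times> (\<epsilon> + 1)\<close>
  block \<open>\<lambda>[I 0] - [0 I]\<close>, the transpose of such a block, \<open>\<lambda>I - J\<^sub>\<rho>(\<mu>)\<close>, and
  \<open>\<lambda>J\<^sub>\<sigma>(0) - I\<close>, the block associated with the eigenvalue \<open>\<infinity>\<close>. The first two kinds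
  may have \<open>\<epsilon> = 0\<close>; they then contribute a zero column or a zero row.\<close>

datatype kron_block = Row_Block nat | Col_Block nat | Fin_Block nat complex | Inf_Block nat

fun block_lead :: "kron_block \<Rightarrow> complex mat" where
  "block_lead (Row_Block e) = mat e (Suc e) (\<lambda>(r, c). if c = r then 1 else 0)"
| "block_lead (Col_Block e) = mat (Suc e) e (\<lambda>(r, c). if r = c then 1 else 0)"
| "block_lead (Fin_Block p \<mu>) = 1\<^sub>m p"
| "block_lead (Inf_Block s) = jordan_block s 0"

fun block_const :: "kron_block \<Rightarrow> complex mat" where
  "block_const (Row_Block e) = mat e (Suc e) (\<lambda>(r, c). if c = Suc r then - 1 else 0)"
| "block_const (Col_Block e) = mat (Suc e) e (\<lambda>(r, c). if r = Suc c then - 1 else 0)"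
| "block_const (Fin_Block p \<mu>) = - jordan_block p \<mu>"
| "block_const (Inf_Block s) = - 1\<^sub>m s"

fun proper_block :: "kron_block \<Rightarrow> bool" where
  "proper_block (Row_Block e) = True"
| "proper_block (Col_Block e) = True"
| "proper_block (Fin_Block p \<mu>) = (p \<ge> 1)"
| "proper_block (Inf_Block s) = (s \<ge> 1)"

definition kronecker_form :: "complex mat \<Rightarrow> complex mat \<Rightarrow> kron_block list \<Rightarrow> bool" where
  "kronecker_form X Y bs \<longleftrightarrow>
     (\<forall>b\<in>set bs. proper_block b) \<and>
     (\<exists>S T. S \<in> carrier_mat (dim_row X) (dim_row X) \<and> invertible_mat S \<and>
            T \<in> carrier_mat (dim_col X) (dim_col X) \<and> invertible_mat T \<and>
            S * X * T = diag_block_mat (map block_lead bs) \<and>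
            S * Y * T = diag_block_mat (map block_const bs))"

text \<open>The Kronecker canonical form is unique up to the order of the blocks, so that it does not
  matter that the maximum runs over the blocks of all Kronecker forms of the pencil.\<close>

definition pencil_index :: "real mat \<Rightarrow> real mat \<Rightarrow> nat" where
  "pencil_index X Y = Max (insert 0
     {s. \<exists>bs. kronecker_form (map_mat complex_of_real X) (map_mat complex_of_real Y) bs \<and>
              Inf_Block s \<in> set bs})"

text \<open>Leading and constant coefficient of the companion linearization of
  \<open>\<lambda>\<^sup>kY\<^sub>k + \<dots> + Y\<^sub>0\<close>; entry \<open>(a, b)\<close> lies in block row \<open>a div n\<close> and block column
  \<open>b div n\<close>.\<close>

definition companion_lead :: "nat \<Rightarrow> nat \<Rightarrow> (nat \<Rightarrow> real mat) \<Rightarrow> real mat" where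
  "companion_lead n k Y = mat (k * n) (k * n) (\<lambda>(a, b).
     if a div n = 0 \<and> b div n = 0 then Y k $$ (a mod n, b mod n)
     else if a = b then 1 else 0)"

definition companion_const :: "nat \<Rightarrow> nat \<Rightarrow> (nat \<Rightarrow> real mat) \<Rightarrow> real mat" where
  "companion_const n k Y = mat (k * n) (k * n) (\<lambda>(a, b).
     if a div n = 0 then Y (k - 1 - b div n) $$ (a mod n, b mod n)
     else if a div n = Suc (b div n) \<and> a mod n = b mod n then - 1 else 0)"

definition mp_index :: "nat \<Rightarrow> real poly mat \<Rightarrow> nat" where
  "mp_index k P = pencil_index (companion_lead (dim_row P) k (mp_coeff P))
                               (companion_const (dim_row P) k (mp_coeff P))"


section \<open>Structured matrix polynomials\<close>

definition psd :: "nat \<Rightarrow> real mat \<Rightarrow> bool" where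
  "psd n X \<longleftrightarrow> X \<in> carrier_mat n n \<and> transpose_mat X = X \<and>
     (\<forall>v\<in>carrier_vec n. v \<bullet> (X *\<^sub>v v) \<ge> 0)"

definition str_tuples :: "nat \<Rightarrow> nat \<Rightarrow> (real mat \<times> real mat list) set" where
  "str_tuples n l = {(J, Xs). J \<in> carrier_mat n n \<and> transpose_mat J = - J \<and>
     length Xs = Suc l \<and> (\<forall>X\<in>set Xs. psd n X)}"

definition str_poly :: "nat \<Rightarrow> nat \<Rightarrow> nat \<Rightarrow> real mat \<Rightarrow> real mat list \<Rightarrow> real poly mat" where
  "str_poly n k j J As = mat n n (\<lambda>(r, c).
     - monom (J $$ (r, c)) j + (\<Sum>i\<le>k. monom ((As ! i) $$ (r, c)) i))"

definition str_polys :: "nat \<Rightarrow> nat \<Rightarrow> nat \<Rightarrow> real poly mat set" where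
  "str_polys n k j = {str_poly n k j J As | J As. (J, As) \<in> str_tuples n k}"

definition common_kernel :: "real mat list \<Rightarrow> real vec set" where
  "common_kernel Xs = (\<Inter>X\<in>set Xs. mat_kernel X)"

definition higher_index_polys :: "nat \<Rightarrow> nat \<Rightarrow> nat \<Rightarrow> real poly mat set" where
  "higher_index_polys n k j = {P \<in> str_polys n k j. \<not> singular_mp P \<and> mp_index k P > 1}"

definition str_closure ::
    "nat \<Rightarrow> nat \<Rightarrow> nat \<Rightarrow> real poly mat set \<Rightarrow> real poly mat set" where
  "str_closure n k j S =
     Abstract_Topology.closure_of (subtopology (coeff_topology n k) (str_polys n k j)) S"


section \<open>Structured distances\<close>

text \<open>The distances are extended reals, for which \<open>Inf {} = \<infinity>\<close>.\<close>

definition d_sing :: "nat \<Rightarrow> nat \<Rightarrow> nat \<Rightarrow> real poly mat \<Rightarrow> ereal" where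
  "d_sing n k j P = Inf {ereal (mp_norm k D) | D.
     D \<in> matpolys n k \<and> P + D \<in> str_polys n k j \<and> singular_mp (P + D)}"

definition d_hi :: "nat \<Rightarrow> nat \<Rightarrow> nat \<Rightarrow> real poly mat \<Rightarrow> ereal" where
  "d_hi n k j P = Inf {ereal (mp_norm k D) | D.
     D \<in> matpolys n k \<and> P + D \<in> str_polys n k j \<and> mp_index k (P + D) \<ge> 2}"

definition d_ck :: "nat \<Rightarrow> real mat \<Rightarrow> real mat list \<Rightarrow> ereal" where
  "d_ck n J Xs = Inf {ereal (frob_norm (DJ # DXs)) | DJ DXs.
     DJ \<in> carrier_mat n n \<and> length DXs = length Xs \<and> set DXs \<subseteq> carrier_mat n n \<and>
     (J + DJ, map2 (+) Xs DXs) \<in> str_tuples n (length Xs - 1) \<and>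
     common_kernel ((J + DJ) # map2 (+) Xs DXs) \<noteq> {0\<^sub>v n}}"

end

theory Submission
  imports Defs
    "Jordan_Normal_Form.Jordan_Normal_Form_Existence"
    "HOL-Analysis.L2_Norm"
begin

text \<open>
  Everything rests on one observation. If \<open>J\<close> is skew-symmetric and the \<open>A\<^sub>i\<close> are positive
  semidefinite, then \<open>x\<^sup>T(\<Sum>A\<^sub>i - J)x = \<Sum>x\<^sup>TA\<^sub>ix\<close>, because the skew part contributes nothing to a
  quadratic form. So if \<open>x\<close> is in the kernel of \<open>\<Sum>A\<^sub>i - J\<close>, all the nonnegative terms \<open>x\<^sup>TA\<^sub>ix\<close>
  vanish, hence \<open>A\<^sub>ix = 0\<close> for each \<open>i\<close> and then \<open>Jx = 0\<close> (\<open>dissipative_mat_kernel\<close>): the kernel of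
  such a sum is the common kernel of its summands.

  Part (i). \<open>P(1)\<close> is such a sum. If \<open>P\<close> is singular, so is \<open>P(1)\<close>; if \<open>P(1)\<close> is singular, a
  kernel vector lies in the common kernel; and a common kernel vector is annihilated by every
  \<open>P(x)\<close>.

  Part (ii). Symmetric and skew-symmetric matrices are orthogonal for the Frobenius inner product.
  The coefficient \<open>A\<^sub>j - J\<close> of a perturbation therefore has the norm of the pair, and
  the norm of a structured perturbation is the norm of the tuple of its data
  (\<open>mp_norm_str_poly_diff\<close>). With (i), both distances are infima of the same numbers.

  Parts (iii) and (iv). Write \<open>Y\<^sub>i\<close> for the coefficients of \<open>P\<close>. A block of size at least two at
  infinity in a pencil \<open>\<lambda>X + Y\<close> amounts to a chain \<open>X z\<^sub>1 = 0\<close>, \<open>X z\<^sub>2 = Y z\<^sub>1 \<noteq> 0\<close>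
  (\<open>pencil_index_ge_2_chain\<close>), and for the companion linearization this says that some \<open>v \<noteq> 0\<close> has
  \<open>Y\<^sub>kv = 0\<close> and \<open>Y\<^sub>k\<^sub>-\<^sub>1v\<close> in the range of \<open>Y\<^sub>k\<close>, where moreover \<open>Y\<^sub>0v \<noteq> 0\<close> if \<open>k = 1\<close>. The structure gives
  \<open>v\<^sup>TY\<^sub>k = 0\<close> as well, hence \<open>v\<^sup>TY\<^sub>k\<^sub>-\<^sub>1v = 0\<close>, and positivity turns this into
  \<open>A\<^sub>kv = A\<^sub>k\<^sub>-\<^sub>1v = 0\<close>, with \<open>Jv = 0\<close> in addition if \<open>j = k\<close> (\<open>mp_index_ge_2D\<close>). This argument covers
  singular and regular polynomials alike. It also shows that the index is at most one in the
  exceptional cases, where \<open>k = 1\<close> and these equations force \<open>Y\<^sub>0v = 0\<close>.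

  Conversely, from such a \<open>v\<close> one moves \<open>P\<close> along a fixed ray of structured data such that
  at every positive parameter \<open>Y\<^sub>0\<close> becomes invertible while the chain survives
  (\<open>exists_higher_index_direction\<close>). For invertible \<open>Y\<close> the Kronecker form comes
  from the Jordan form of \<open>-Y\<inverse>X\<close>, whose nilpotent blocks are exactly the blocks at infinity
  (\<open>pencil_index_ge_2I\<close>). So polynomials with a common kernel of the leading data are limits of
  regular ones of index at least two. The set of the former is closed, because the common kernel
  condition is the vanishing of one determinant, which depends continuously on the coefficients.
  The distances follow by letting the parameter tend to zero.
\<close>

section \<open>Positive semidefinite and skew-symmetric matrices\<close>

lemma scalar_prod_mult_mat_commute:
  fixes A :: "real mat"
  assumes "A \<in> carrier_mat n n" "x \<in> carrier_vec n" "y \<in> carrier_vec n"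
  shows "x \<bullet> (A *\<^sub>v y) = (A\<^sup>T *\<^sub>v x) \<bullet> y"
  by (metis assms transpose_vec_mult_scalar)

lemma skew_quadratic_zero:
  fixes J :: "real mat"
  assumes J: "J \<in> carrier_mat n n" "J\<^sup>T = - J" and x: "x \<in> carrier_vec n"
  shows "x \<bullet> (J *\<^sub>v x) = 0"
proof -
  have "x \<bullet> (J *\<^sub>v x) = ((- J) *\<^sub>v x) \<bullet> x"
    using scalar_prod_mult_mat_commute[OF J(1) x x] J(2) by simp
  also have "\<dots> = - (x \<bullet> (J *\<^sub>v x))"
    using J x by (simp add: uminus_mult_mat_vec comm_scalar_prod[of _ n])
  finally show ?thesis by simp
qed

lemma real_scalar_prod_self_eq_0_iff:
  fixes x :: "real vec"
  assumes "x \<in> carrier_vec n"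
  shows "x \<bullet> x = 0 \<longleftrightarrow> x = 0\<^sub>v n"
proof
  assume "x \<bullet> x = 0"
  then have "\<forall>i\<in>{0..<n}. x $ i * x $ i = 0"
    using assms by (subst sum_nonneg_eq_0_iff[symmetric]) (auto simp: scalar_prod_def)
  then show "x = 0\<^sub>v n" using assms by (intro eq_vecI) auto
qed (use assms in auto)

lemma psd_carrier: "psd n A \<Longrightarrow> A \<in> carrier_mat n n"
  by (simp add: psd_def)

text \<open>The quadratic form \<open>x \<mapsto> x\<^sup>TAx\<close> is minimal at \<open>x\<close>, so its derivative in the direction
  \<open>w = Ax\<close>, which is \<open>2w\<^sup>Tw\<close>, has to vanish.\<close>

lemma psd_kernelI:
  assumes A: "psd n A" and x: "x \<in> carrier_vec n" and 0: "x \<bullet> (A *\<^sub>v x) = 0"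
  shows "A *\<^sub>v x = 0\<^sub>v n"
proof -
  have Ac: "A \<in> carrier_mat n n" and At: "A\<^sup>T = A"
    and pos: "\<And>v. v \<in> carrier_vec n \<Longrightarrow> v \<bullet> (A *\<^sub>v v) \<ge> 0"
    using A by (auto simp: psd_def)
  define w where "w = A *\<^sub>v x"
  have w: "w \<in> carrier_vec n" using Ac x by (simp add: w_def)
  define a where "a = w \<bullet> w"
  define b where "b = w \<bullet> (A *\<^sub>v w)"
  have Aw: "A *\<^sub>v w \<in> carrier_vec n" using Ac w by simp
  have b: "b \<ge> 0" using pos[OF w] by (simp add: b_def)
  have xAw: "x \<bullet> (A *\<^sub>v w) = a"
    using scalar_prod_mult_mat_commute[OF Ac x w] At by (simp add: a_def w_def)
  have wAx: "w \<bullet> (A *\<^sub>v x) = a"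
    by (simp add: a_def w_def)
  have ineq: "0 \<le> 2 * t * a + t\<^sup>2 * b" for t :: real
  proof -
    have tw: "t \<cdot>\<^sub>v w \<in> carrier_vec n" using w by simp
    have "0 \<le> (x + t \<cdot>\<^sub>v w) \<bullet> (A *\<^sub>v (x + t \<cdot>\<^sub>v w))"
      using pos x tw by simp
    also have "A *\<^sub>v (x + t \<cdot>\<^sub>v w) = A *\<^sub>v x + t \<cdot>\<^sub>v (A *\<^sub>v w)"
      using Ac x w tw by (simp add: mult_add_distrib_mat_vec mult_mat_vec)
    also have "(x + t \<cdot>\<^sub>v w) \<bullet> (A *\<^sub>v x + t \<cdot>\<^sub>v (A *\<^sub>v w)) = 2 * t * a + t\<^sup>2 * b"
      using Ac x w tw Aw 0 xAw wAx
      by (simp add: add_scalar_prod_distrib[of _ n] scalar_prod_add_distrib[of _ n] b_def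
          power2_eq_square algebra_simps)
    finally show ?thesis .
  qed
  have "a = 0"
  proof (rule ccontr)
    assume "a \<noteq> 0"
    have b1: "b + 1 \<noteq> 0" using b by simp
    \<comment> \<open>a step against the derivative, short enough for the linear term to dominate\<close>
    have "0 \<le> 2 * (- a / (b + 1)) * a + (- a / (b + 1))\<^sup>2 * b" by (rule ineq)
    also have "\<dots> = a\<^sup>2 * (- 2 * (b + 1) + b) / (b + 1)\<^sup>2"
      using b1 by (simp add: divide_simps) (simp add: algebra_simps power2_eq_square)
    also have "\<dots> < 0"
      using b \<open>a \<noteq> 0\<close> by (intro divide_neg_pos mult_pos_neg) auto
    finally show False by simp
  qed
  then show ?thesis
    using real_scalar_prod_self_eq_0_iff[OF w] by (simp add: a_def w_def)
qed

lemma psd_add: "psd n A \<Longrightarrow> psd n B \<Longrightarrow> psd n (A + B)"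
  by (auto simp: psd_def transpose_add[of _ n n] add_mult_distrib_mat_vec[of _ n n]
      scalar_prod_add_distrib[of _ n])

lemma smult_mat_mult_vec:
  "A \<in> carrier_mat m n \<Longrightarrow> x \<in> carrier_vec n \<Longrightarrow> (c \<cdot>\<^sub>m A) *\<^sub>v x = c \<cdot>\<^sub>v (A *\<^sub>v x)"
  for A :: "'a :: comm_semiring_0 mat"
  by (rule eq_vecI) auto

lemma psd_smult:
  assumes "psd n A" "c \<ge> 0"
  shows "psd n (c \<cdot>\<^sub>m A)"
proof -
  have "A \<in> carrier_mat n n" "A\<^sup>T = A" using assms by (auto simp: psd_def)
  moreover from this have "(c \<cdot>\<^sub>m A)\<^sup>T = c \<cdot>\<^sub>m A"
    by (intro eq_matI) (auto, metis carrier_matD index_transpose_mat(1))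
  ultimately show ?thesis
    using assms by (auto simp: psd_def smult_mat_mult_vec[of _ n n])
qed

lemma psd_one: "psd n (1\<^sub>m n)"
  by (auto simp: psd_def scalar_prod_def intro!: sum_nonneg)

lemma psd_zero: "psd n (0\<^sub>m n n)"
  by (auto simp: psd_def scalar_prod_def intro!: sum_nonneg)

text \<open>The Cauchy--Schwarz gap \<open>\<bar>v\<bar>\<^sup>2\<bar>x\<bar>\<^sup>2 - (v\<^sup>Tx)\<^sup>2\<close> as a quadratic form. For \<open>v \<noteq> 0\<close> it is a multiple of the
  orthogonal projection along \<open>v\<close>; adding it to a positive semidefinite matrix that kills \<open>v\<close>
  shrinks the kernel to the line of \<open>v\<close>.\<close>

definition gap_mat :: "real vec \<Rightarrow> real mat" where
  "gap_mat v = mat (dim_vec v) (dim_vec v)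
     (\<lambda>(r, c). (if r = c then v \<bullet> v else 0) - v $ r * v $ c)"

lemma gap_mat_mult_vec:
  assumes "v \<in> carrier_vec n" "x \<in> carrier_vec n"
  shows "gap_mat v *\<^sub>v x = (v \<bullet> v) \<cdot>\<^sub>v x - (v \<bullet> x) \<cdot>\<^sub>v v"
proof (rule eq_vecI)
  fix r assume "r < dim_vec ((v \<bullet> v) \<cdot>\<^sub>v x - (v \<bullet> x) \<cdot>\<^sub>v v)"
  then have r: "r < n" using assms by simp
  have "(gap_mat v *\<^sub>v x) $ r
      = (\<Sum>c\<in>{0..<n}. (if r = c then (v \<bullet> v) * x $ c else 0) - v $ r * v $ c * x $ c)"
    using assms r unfolding gap_mat_def
    by (auto simp: scalar_prod_def left_diff_distrib intro!: sum.cong)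
  also have "\<dots> = (v \<bullet> v) * x $ r - (\<Sum>c\<in>{0..<n}. v $ c * x $ c) * v $ r"
    using r by (simp add: sum_subtractf sum_distrib_left mult_ac)
  finally show "(gap_mat v *\<^sub>v x) $ r = ((v \<bullet> v) \<cdot>\<^sub>v x - (v \<bullet> x) \<cdot>\<^sub>v v) $ r"
    using assms r by (simp add: scalar_prod_def)
qed (use assms in \<open>auto simp: gap_mat_def\<close>)

lemma gap_mat_self: "v \<in> carrier_vec n \<Longrightarrow> gap_mat v *\<^sub>v v = 0\<^sub>v n"
  by (subst gap_mat_mult_vec[of _ n]) auto

lemma psd_gap_mat:
  assumes v: "v \<in> carrier_vec n"
  shows "psd n (gap_mat v)"
proof -
  have c: "gap_mat v \<in> carrier_mat n n" using v by (simp add: gap_mat_def)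
  have t: "(gap_mat v)\<^sup>T = gap_mat v" by (rule eq_matI) (auto simp: gap_mat_def)
  have "x \<bullet> (gap_mat v *\<^sub>v x) \<ge> 0" if x: "x \<in> carrier_vec n" for x
  proof -
    let ?S = "{0..<n}"
    have "\<bar>v \<bullet> x\<bar> \<le> (\<Sum>i\<in>?S. \<bar>v $ i\<bar> * \<bar>x $ i\<bar>)"
      using x sum_abs[of "\<lambda>i. v $ i * x $ i" ?S] by (simp add: scalar_prod_def abs_mult)
    also have "\<dots> \<le> L2_set (($) v) ?S * L2_set (($) x) ?S" by (rule L2_set_mult_ineq)
    also have "\<dots> = sqrt ((v \<bullet> v) * (x \<bullet> x))"
      using v x by (simp add: L2_set_def scalar_prod_def power2_eq_square real_sqrt_mult)
    finally have "(v \<bullet> x)\<^sup>2 \<le> (v \<bullet> v) * (x \<bullet> x)"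
      using sqrt_ge_absD by blast
    moreover have "x \<bullet> (gap_mat v *\<^sub>v x) = (v \<bullet> v) * (x \<bullet> x) - (v \<bullet> x)\<^sup>2"
      using v x by (simp add: gap_mat_mult_vec[of _ n] scalar_prod_minus_distrib[of _ n]
          power2_eq_square comm_scalar_prod[of x n v])
    ultimately show ?thesis by simp
  qed
  with c t show ?thesis by (auto simp: psd_def)
qed

text \<open>\<open>\<Sum>A\<^sub>i - J\<close>. The value \<open>P(1)\<close>, single coefficients of \<open>P\<close> and sums of its coefficients all have
  this shape, so that the kernel lemma below serves every part of the proof.\<close>

definition dissipative_mat ::
    "nat \<Rightarrow> real mat \<Rightarrow> nat set \<Rightarrow> (nat \<Rightarrow> real mat) \<Rightarrow> real mat" where
  "dissipative_mat n J I A = mat n n (\<lambda>(r, c). (\<Sum>i\<in>I. A i $$ (r, c)) - J $$ (r, c))"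

lemma dissipative_mat_carrier [simp]: "dissipative_mat n J I A \<in> carrier_mat n n"
  by (simp add: dissipative_mat_def)

lemma mult_mat_vec_index_sum:
  "A \<in> carrier_mat m n \<Longrightarrow> x \<in> carrier_vec n \<Longrightarrow> r < m \<Longrightarrow>
    (A *\<^sub>v x) $ r = (\<Sum>c<n. A $$ (r, c) * x $ c)"
  by (auto simp: scalar_prod_def atLeast0LessThan intro!: sum.cong)

lemma dissipative_mat_mult_vec_index:
  assumes "J \<in> carrier_mat n n" "\<And>i. i \<in> I \<Longrightarrow> A i \<in> carrier_mat n n"
    and "x \<in> carrier_vec n" "r < n"
  shows "(dissipative_mat n J I A *\<^sub>v x) $ r = (\<Sum>i\<in>I. (A i *\<^sub>v x) $ r) - (J *\<^sub>v x) $ r"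
proof -
  have "(dissipative_mat n J I A *\<^sub>v x) $ r
      = (\<Sum>c<n. ((\<Sum>i\<in>I. A i $$ (r, c)) - J $$ (r, c)) * x $ c)"
    using mult_mat_vec_index_sum[OF dissipative_mat_carrier assms(3,4), of J I A] assms(4)
    by (simp add: dissipative_mat_def)
  also have "\<dots> = (\<Sum>i\<in>I. \<Sum>c<n. A i $$ (r, c) * x $ c) - (\<Sum>c<n. J $$ (r, c) * x $ c)"
    by (simp add: left_diff_distrib sum_subtractf sum_distrib_right) (rule sum.swap)
  also have "(\<Sum>c<n. J $$ (r, c) * x $ c) = (J *\<^sub>v x) $ r"
    using mult_mat_vec_index_sum[OF assms(1,3,4)] ..
  also have "(\<Sum>i\<in>I. \<Sum>c<n. A i $$ (r, c) * x $ c) = (\<Sum>i\<in>I. (A i *\<^sub>v x) $ r)"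
    using assms by (intro sum.cong refl mult_mat_vec_index_sum[of _ n, symmetric]) auto
  finally show ?thesis .
qed

text \<open>In \<open>x\<^sup>T(\<Sum>A\<^sub>i - J)x\<close> the skew part cancels and the other terms are nonnegative, so a kernel
  vector makes each of them vanish.\<close>

lemma dissipative_mat_kernel:
  assumes J: "J \<in> carrier_mat n n" "J\<^sup>T = - J"
    and I: "finite I" and A: "\<And>i. i \<in> I \<Longrightarrow> psd n (A i)" and x: "x \<in> carrier_vec n"
  shows "dissipative_mat n J I A *\<^sub>v x = 0\<^sub>v n \<longleftrightarrow>
    J *\<^sub>v x = 0\<^sub>v n \<and> (\<forall>i\<in>I. A i *\<^sub>v x = 0\<^sub>v n)"
proof
  let ?M = "dissipative_mat n J I A"
  have Ac: "\<And>i. i \<in> I \<Longrightarrow> A i \<in> carrier_mat n n" using A psd_carrier by blast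
  have idx: "(?M *\<^sub>v x) $ r = (\<Sum>i\<in>I. (A i *\<^sub>v x) $ r) - (J *\<^sub>v x) $ r" if "r < n" for r
    using that J(1) Ac x by (intro dissipative_mat_mult_vec_index) auto
  have dims: "dim_vec (?M *\<^sub>v x) = n" "dim_vec (J *\<^sub>v x) = n"
    using J(1) by (auto simp: dissipative_mat_def)
  assume 0: "?M *\<^sub>v x = 0\<^sub>v n"
  have "0 = x \<bullet> (?M *\<^sub>v x)" using 0 x by simp
  also have "\<dots> = (\<Sum>r<n. x $ r * ((\<Sum>i\<in>I. (A i *\<^sub>v x) $ r) - (J *\<^sub>v x) $ r))"
    unfolding scalar_prod_def dims atLeast0LessThan
    by (rule sum.cong) (simp_all add: idx del: index_mult_mat_vec)
  also have "\<dots> = (\<Sum>i\<in>I. \<Sum>r<n. x $ r * (A i *\<^sub>v x) $ r) - (\<Sum>r<n. x $ r * (J *\<^sub>v x) $ r)"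
    by (simp add: right_diff_distrib sum_subtractf sum_distrib_left del: index_mult_mat_vec)
      (rule sum.swap)
  also have "(\<Sum>r<n. x $ r * (J *\<^sub>v x) $ r) = x \<bullet> (J *\<^sub>v x)"
    unfolding scalar_prod_def dims atLeast0LessThan ..
  also have "x \<bullet> (J *\<^sub>v x) = 0" by (rule skew_quadratic_zero[OF J x])
  also have "(\<Sum>i\<in>I. \<Sum>r<n. x $ r * (A i *\<^sub>v x) $ r) = (\<Sum>i\<in>I. x \<bullet> (A i *\<^sub>v x))"
  proof (rule sum.cong[OF refl])
    fix i assume "i \<in> I"
    then have "dim_vec (A i *\<^sub>v x) = n" using Ac[of i] by simp
    then show "(\<Sum>r<n. x $ r * (A i *\<^sub>v x) $ r) = x \<bullet> (A i *\<^sub>v x)"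
      unfolding scalar_prod_def atLeast0LessThan by simp
  qed
  finally have "(\<Sum>i\<in>I. x \<bullet> (A i *\<^sub>v x)) = 0" by simp
  then have "\<forall>i\<in>I. x \<bullet> (A i *\<^sub>v x) = 0"
    using I A x by (subst sum_nonneg_eq_0_iff[symmetric]) (auto simp: psd_def)
  then have Ax: "\<forall>i\<in>I. A i *\<^sub>v x = 0\<^sub>v n" using A x psd_kernelI by blast
  have "J *\<^sub>v x = 0\<^sub>v n"
  proof (rule eq_vecI)
    fix r assume "r < dim_vec (0\<^sub>v n)"
    then have r: "r < n" by simp
    then have "(\<Sum>i\<in>I. (A i *\<^sub>v x) $ r) = 0" using Ax by (intro sum.neutral) auto
    then show "(J *\<^sub>v x) $ r = 0\<^sub>v n $ r"
      using idx[OF r] 0 r by (simp del: index_mult_mat_vec)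
  qed (use J in auto)
  then show "J *\<^sub>v x = 0\<^sub>v n \<and> (\<forall>i\<in>I. A i *\<^sub>v x = 0\<^sub>v n)" using Ax by blast
next
  have Ac: "\<And>i. i \<in> I \<Longrightarrow> A i \<in> carrier_mat n n" using A psd_carrier by blast
  assume *: "J *\<^sub>v x = 0\<^sub>v n \<and> (\<forall>i\<in>I. A i *\<^sub>v x = 0\<^sub>v n)"
  show "dissipative_mat n J I A *\<^sub>v x = 0\<^sub>v n"
  proof (rule eq_vecI)
    fix r assume "r < dim_vec (0\<^sub>v n)"
    then show "(dissipative_mat n J I A *\<^sub>v x) $ r = 0\<^sub>v n $ r"
      using * J(1) Ac x by (subst dissipative_mat_mult_vec_index) auto
  qed (simp add: dissipative_mat_def)
qed

lemma det_dissipative_mat_eq_0_iff: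
  assumes "J \<in> carrier_mat n n" "J\<^sup>T = - J" "finite I" "\<And>i. i \<in> I \<Longrightarrow> psd n (A i)"
  shows "det (dissipative_mat n J I A) = 0 \<longleftrightarrow>
    (\<exists>x\<in>carrier_vec n. x \<noteq> 0\<^sub>v n \<and> J *\<^sub>v x = 0\<^sub>v n \<and> (\<forall>i\<in>I. A i *\<^sub>v x = 0\<^sub>v n))"
  using dissipative_mat_kernel[OF assms]
  by (auto simp: det_0_iff_vec_prod_zero[OF dissipative_mat_carrier])

text \<open>Symmetric and skew-symmetric matrices are orthogonal: exchanging \<open>r\<close> and \<open>c\<close> changes the sign of
  the mixed term.\<close>

lemma frobenius_symmetric_minus_skew:
  fixes S K :: "nat \<Rightarrow> nat \<Rightarrow> real"
  assumes S: "\<And>r c. r < n \<Longrightarrow> c < n \<Longrightarrow> S c r = S r c"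
    and K: "\<And>r c. r < n \<Longrightarrow> c < n \<Longrightarrow> K c r = - K r c"
  shows "(\<Sum>r<n. \<Sum>c<n. (S r c - K r c)\<^sup>2)
    = (\<Sum>r<n. \<Sum>c<n. (S r c)\<^sup>2) + (\<Sum>r<n. \<Sum>c<n. (K r c)\<^sup>2)"
proof -
  let ?X = "\<Sum>r<n. \<Sum>c<n. S r c * K r c"
  have "?X = (\<Sum>c<n. \<Sum>r<n. S r c * K r c)" by (rule sum.swap)
  also have "\<dots> = (\<Sum>c<n. \<Sum>r<n. - (S c r * K c r))"
  proof (intro sum.cong refl)
    fix c r assume "c \<in> {..<n}" "r \<in> {..<n}"
    then show "S r c * K r c = - (S c r * K c r)" using S[of r c] K[of r c] by simp
  qed
  also have "\<dots> = - ?X" by (simp add: sum_negf)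
  finally have X: "?X = 0" by simp
  have "(\<Sum>r<n. \<Sum>c<n. (S r c - K r c)\<^sup>2)
      = (\<Sum>r<n. \<Sum>c<n. (S r c)\<^sup>2 + (K r c)\<^sup>2 - 2 * (S r c * K r c))"
    by (simp add: power2_diff mult.assoc)
  also have "\<dots> = (\<Sum>r<n. \<Sum>c<n. (S r c)\<^sup>2) + (\<Sum>r<n. \<Sum>c<n. (K r c)\<^sup>2) - 2 * ?X"
    by (simp add: sum.distrib sum_subtractf sum_distrib_left)
  finally show ?thesis using X by simp
qed

section \<open>Blocks at infinity and chains of a pencil\<close>

lemma diag_block_mat_middle_index:
  fixes As Bs :: "'a :: zero mat list" and B :: "'a mat"
  defines "D \<equiv> diag_block_mat (As @ B # Bs)"
  defines "p \<equiv> sum_list (map dim_row As)" and "q \<equiv> sum_list (map dim_col As)"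
  assumes r: "r < dim_row D" and c: "c < dim_col B"
  shows "D $$ (r, q + c) = (if p \<le> r \<and> r < p + dim_row B then B $$ (r - p, c) else 0)"
  using r c unfolding D_def p_def q_def
  by (auto simp: diag_block_mat_append Let_def dim_diag_block_mat)

lemma map_vec_Re_Im_mult:
  assumes "X \<in> carrier_mat N N" "z \<in> carrier_vec N"
  shows "map_vec Re (map_mat complex_of_real X *\<^sub>v z) = X *\<^sub>v map_vec Re z"
    and "map_vec Im (map_mat complex_of_real X *\<^sub>v z) = X *\<^sub>v map_vec Im z"
  using assms by (auto simp: scalar_prod_def intro!: eq_vecI)

lemma kronecker_form_Inf_Block_le:
  assumes "kronecker_form X Y bs" "Inf_Block s \<in> set bs"
  shows "s \<le> dim_row X"
proof -
  from assms(1) obtain S T where S: "S \<in> carrier_mat (dim_row X) (dim_row X)"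
    and eq: "S * X * T = diag_block_mat (map block_lead bs)"
    unfolding kronecker_form_def by blast
  have "s \<in> set (map dim_row (map block_lead bs))"
    using assms(2) by (force simp: jordan_block_def)
  then have "s \<le> sum_list (map dim_row (map block_lead bs))"
    by (intro member_le_sum_list) auto
  also have "\<dots> = dim_row (S * X * T)" unfolding eq dim_diag_block_mat ..
  also have "\<dots> = dim_row X" using S by simp
  finally show ?thesis .
qed

text \<open>The size of a block is bounded by the size of the pencil. Hence the maximum in the definition of
  the index runs over a finite set and is attained.\<close>

lemma pencil_index_ge_2_iff:
  "pencil_index X Y \<ge> 2 \<longleftrightarrow>
    (\<exists>bs s. kronecker_form (map_mat complex_of_real X) (map_mat complex_of_real Y) bs \<and>
      Inf_Block s \<in> set bs \<and> s \<ge> 2)"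
proof -
  let ?A = "{s. \<exists>bs. kronecker_form (map_mat complex_of_real X) (map_mat complex_of_real Y) bs \<and>
              Inf_Block s \<in> set bs}"
  have "?A \<subseteq> {..dim_row X}" using kronecker_form_Inf_Block_le by fastforce
  then have "finite ?A" by (rule finite_subset) simp
  then show ?thesis unfolding pencil_index_def by (subst Max_ge_iff) auto
qed

lemma mult_mat_zero_vec [simp]:
  "A \<in> carrier_mat m n \<Longrightarrow> A *\<^sub>v 0\<^sub>v n = 0\<^sub>v m" for A :: "'a :: semiring_0 mat"
  by (rule eq_vecI) auto

lemma mult_mat_vec_uminus:
  "A \<in> carrier_mat m n \<Longrightarrow> x \<in> carrier_vec n \<Longrightarrow> A *\<^sub>v (- x) = - (A *\<^sub>v x)" for A :: "'a :: comm_ring mat"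
  by (rule eq_vecI) auto

lemma mat_mult_unit_vec:
  "A \<in> carrier_mat m n \<Longrightarrow> i < n \<Longrightarrow> A *\<^sub>v unit_vec n i = col A i" for A :: "'a :: semiring_1 mat"
  by (rule eq_vecI) auto

text \<open>The first two columns of a block \<open>\<lambda>J\<^sub>s(0) - I\<close> form a chain, and the transformation matrices carry
  it to the pencil.\<close>

lemma kronecker_form_chain:
  assumes X: "X \<in> carrier_mat N N" and Y: "Y \<in> carrier_mat N N"
    and kf: "kronecker_form X Y bs" and s: "Inf_Block s \<in> set bs" "s \<ge> 2"
  shows "\<exists>z1\<in>carrier_vec N. \<exists>z2\<in>carrier_vec N.
    X *\<^sub>v z1 = 0\<^sub>v N \<and> X *\<^sub>v z2 = Y *\<^sub>v z1 \<and> Y *\<^sub>v z1 \<noteq> 0\<^sub>v N"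
proof -
  from kf X obtain S T where S: "S \<in> carrier_mat N N" "invertible_mat S"
    and T: "T \<in> carrier_mat N N"
    and eqX: "S * X * T = diag_block_mat (map block_lead bs)"
    and eqY: "S * Y * T = diag_block_mat (map block_const bs)"
    unfolding kronecker_form_def by auto
  from S obtain S' where S': "S' * S = 1\<^sub>m N" "S' \<in> carrier_mat N N"
    unfolding invertible_mat_def inverts_mat_def
    by (metis carrier_matD carrier_matI index_mult_mat(2,3) index_one_mat(2,3))
  obtain bs1 bs2 where bs: "bs = bs1 @ Inf_Block s # bs2" using s(1) by (meson split_list)
  define p where "p = sum_list (map dim_row (map block_lead bs1))"
  define q where "q = sum_list (map dim_col (map block_lead bs1))"
  \<comment> \<open>row and column offset of the block differ in general, because blocks need not be square\<close>
  have dims: "dim_row (block_const b) = dim_row (block_lead b)"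
    "dim_col (block_const b) = dim_col (block_lead b)" for b
    by (cases b; simp add: jordan_block_def)+
  have p': "p = sum_list (map dim_row (map block_const bs1))"
    and q': "q = sum_list (map dim_col (map block_const bs1))"
    by (simp_all add: p_def q_def dims o_def)
  let ?DX = "S * X * T" and ?DY = "S * Y * T"
  have DX: "?DX \<in> carrier_mat N N" and DY: "?DY \<in> carrier_mat N N" using S X Y T by auto
  have "N = dim_row ?DX" "N = dim_col ?DX" using S T by simp_all
  then have N: "p + s \<le> N" "q + s \<le> N"
    unfolding eqX dim_diag_block_mat by (simp_all add: bs p_def q_def jordan_block_def)
  have DX_idx: "?DX $$ (r, q + c) = (if p \<le> r \<and> r < p + s then jordan_block s 0 $$ (r - p, c) else 0)"
    if "r < N" "c < s" for r c
    using diag_block_mat_middle_index[of r "map block_lead bs1" "block_lead (Inf_Block s)" "map block_lead bs2" c]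
      that DX unfolding eqX p_def q_def by (simp add: bs jordan_block_def)
  have DY_idx: "?DY $$ (r, q + c) = (if p \<le> r \<and> r < p + s then (- 1\<^sub>m s) $$ (r - p, c) else 0)"
    if "r < N" "c < s" for r c
    using diag_block_mat_middle_index[of r "map block_const bs1" "block_const (Inf_Block s)" "map block_const bs2" c]
      that DY unfolding eqY p' q' by (simp add: bs)
  have col_idx: "col D i $ r = D $$ (r, i)" "dim_vec (col D i) = N"
    if "D \<in> carrier_mat N N" "r < N" "i < N" for D :: "complex mat" and r i
    using that by auto
  have colX0: "col ?DX (q + 0) = 0\<^sub>v N"
  proof (rule eq_vecI)
    fix r assume "r < dim_vec (0\<^sub>v N :: complex vec)"
    then have r: "r < N" by simp
    show "col ?DX (q + 0) $ r = 0\<^sub>v N $ r"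
      using N s(2) r
      by (subst col_idx(1)[OF DX r], simp, subst DX_idx) (auto simp: jordan_block_def)
  qed (use S in simp)
  have colX1: "col ?DX (q + 1) = unit_vec N p"
  proof (rule eq_vecI)
    fix r assume "r < dim_vec (unit_vec N p :: complex vec)"
    then have r: "r < N" by simp
    show "col ?DX (q + 1) $ r = unit_vec N p $ r"
      using N s(2) r
      by (subst col_idx(1)[OF DX r], simp, subst DX_idx) (auto simp: jordan_block_def unit_vec_def)
  qed (use S in simp)
  have colY0: "col ?DY (q + 0) = - unit_vec N p"
  proof (rule eq_vecI)
    fix r assume "r < dim_vec (- unit_vec N p :: complex vec)"
    then have r: "r < N" by simp
    show "col ?DY (q + 0) $ r = (- unit_vec N p) $ r"
      using N s(2) r
      by (subst col_idx(1)[OF DY r], simp, subst DY_idx) (auto simp: unit_vec_def)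
  qed (use S in simp)
  define u0 where "u0 = T *\<^sub>v unit_vec N q"
  define u1 where "u1 = T *\<^sub>v unit_vec N (q + 1)"
  have u: "u0 \<in> carrier_vec N" "u1 \<in> carrier_vec N" using T by (simp_all add: u0_def u1_def)
  have qN: "q < N" "q + 1 < N" "p < N" using N s(2) by auto
  have colmult: "S *\<^sub>v (Z *\<^sub>v (T *\<^sub>v unit_vec N i)) = col (S * Z * T) i"
    if "Z \<in> carrier_mat N N" "i < N" for Z i
  proof -
    have "col (S * Z * T) i = (S * Z * T) *\<^sub>v unit_vec N i"
      using mat_mult_unit_vec[of "S * Z * T" N N i] S that T by simp
    also have "\<dots> = S *\<^sub>v (Z *\<^sub>v (T *\<^sub>v unit_vec N i))"
      using S that T by (simp add: assoc_mult_mat_vec[of _ N N _ N])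
    finally show ?thesis ..
  qed
  have S_inj: "x = S' *\<^sub>v (S *\<^sub>v x)" if "x \<in> carrier_vec N" for x
    using S S' that by (simp flip: assoc_mult_mat_vec[of _ N N _ N])
  have Xu0: "X *\<^sub>v u0 = 0\<^sub>v N"
    using S_inj[of "X *\<^sub>v u0"] colmult[OF X qN(1)] colX0 X u S'(2) by (simp add: u0_def)
  have SXu1: "S *\<^sub>v (X *\<^sub>v u1) = unit_vec N p"
    using colmult[OF X qN(2)] colX1 by (simp add: u1_def)
  have SYu0: "S *\<^sub>v (Y *\<^sub>v u0) = - unit_vec N p"
    using colmult[OF Y qN(1)] colY0 by (simp add: u0_def)
  have "S *\<^sub>v (X *\<^sub>v (- u1)) = S *\<^sub>v (Y *\<^sub>v u0)"
    using S X u SXu1 SYu0 by (simp add: mult_mat_vec_uminus[of _ N N])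
  then have "X *\<^sub>v (- u1) = Y *\<^sub>v u0"
    using S_inj[of "X *\<^sub>v (- u1)"] S_inj[of "Y *\<^sub>v u0"] X Y u by simp
  moreover have "Y *\<^sub>v u0 \<noteq> 0\<^sub>v N"
  proof
    assume "Y *\<^sub>v u0 = 0\<^sub>v N"
    then have "- unit_vec N p = (0\<^sub>v N :: complex vec)" using SYu0 S by simp
    then have "(- unit_vec N p) $ p = (0 :: complex)" using qN by simp
    then show False using qN by simp
  qed
  ultimately show ?thesis using Xu0 u by (intro bexI[of _ u0] bexI[of _ "- u1"]) auto
qed

text \<open>For a real pencil the real and the imaginary parts of a complex chain are both chains, except
  that \<open>Yz\<^sub>1\<close> may vanish for one of them, but not for both.\<close>

lemma pencil_index_ge_2_chain:
  assumes X: "X \<in> carrier_mat N N" and Y: "Y \<in> carrier_mat N N" and idx: "pencil_index X Y \<ge> 2"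
  shows "\<exists>z1\<in>carrier_vec N. \<exists>z2\<in>carrier_vec N.
    X *\<^sub>v z1 = 0\<^sub>v N \<and> X *\<^sub>v z2 = Y *\<^sub>v z1 \<and> Y *\<^sub>v z1 \<noteq> 0\<^sub>v N"
proof -
  let ?c = "map_mat complex_of_real"
  obtain z1 z2 where z: "z1 \<in> carrier_vec N" "z2 \<in> carrier_vec N"
    and 1: "?c X *\<^sub>v z1 = 0\<^sub>v N" and 2: "?c X *\<^sub>v z2 = ?c Y *\<^sub>v z1" and 3: "?c Y *\<^sub>v z1 \<noteq> 0\<^sub>v N"
    using idx X Y kronecker_form_chain[of "?c X" N "?c Y"]
    unfolding pencil_index_ge_2_iff by (metis map_carrier_mat)
  have part: "\<exists>z1\<in>carrier_vec N. \<exists>z2\<in>carrier_vec N.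
      X *\<^sub>v z1 = 0\<^sub>v N \<and> X *\<^sub>v z2 = Y *\<^sub>v z1 \<and> Y *\<^sub>v z1 \<noteq> 0\<^sub>v N"
    if f: "\<And>Z z. Z \<in> carrier_mat N N \<Longrightarrow> z \<in> carrier_vec N \<Longrightarrow> map_vec f (?c Z *\<^sub>v z) = Z *\<^sub>v map_vec f z"
      and f0: "f 0 = 0" and nz: "map_vec f (?c Y *\<^sub>v z1) \<noteq> 0\<^sub>v N" for f
  proof (intro bexI conjI)
    show "X *\<^sub>v map_vec f z1 = 0\<^sub>v N"
    proof -
      have "map_vec f (0\<^sub>v N) = 0\<^sub>v N" using f0 by (intro eq_vecI) auto
      then show ?thesis using f[OF X z(1)] 1 by simp
    qed
    show "X *\<^sub>v map_vec f z2 = Y *\<^sub>v map_vec f z1"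
      using f[OF X z(2)] f[OF Y z(1)] 2 by simp
    show "Y *\<^sub>v map_vec f z1 \<noteq> 0\<^sub>v N" using nz f[OF Y z(1)] by simp
  qed (use z in auto)
  have "map_vec Re (?c Y *\<^sub>v z1) \<noteq> 0\<^sub>v N \<or> map_vec Im (?c Y *\<^sub>v z1) \<noteq> 0\<^sub>v N"
  proof (rule ccontr)
    assume *: "\<not> ?thesis"
    have "?c Y *\<^sub>v z1 = 0\<^sub>v N"
    proof (rule eq_vecI)
      fix i assume "i < dim_vec (0\<^sub>v N :: complex vec)"
      then have i: "i < N" by simp
      with * Y have "Re ((?c Y *\<^sub>v z1) $ i) = 0" "Im ((?c Y *\<^sub>v z1) $ i) = 0"
        by (metis carrier_matD(1) dim_mult_mat_vec index_map_mat(2) index_map_vec(1) index_zero_vec(1))+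
      then show "(?c Y *\<^sub>v z1) $ i = 0\<^sub>v N $ i" using i by (simp add: complex_eq_iff)
    qed (use Y in simp)
    with 3 show False by simp
  qed
  then show ?thesis
    using part[of Re] part[of Im] map_vec_Re_Im_mult by auto
qed

text \<open>Strict equivalence of square pencils. The inverses of the transformation matrices are part of the
  data, which makes transitivity and direct sums matrix identities.\<close>

definition pencil_equiv ::
    "nat \<Rightarrow> complex mat \<Rightarrow> complex mat \<Rightarrow> complex mat \<Rightarrow> complex mat \<Rightarrow> bool" where
  "pencil_equiv n X Y X' Y' \<longleftrightarrow> X \<in> carrier_mat n n \<and> Y \<in> carrier_mat n n \<and>
     (\<exists>S S' T T'. S \<in> carrier_mat n n \<and> S' \<in> carrier_mat n n \<and> T \<in> carrier_mat n n \<and> T' \<in> carrier_mat n n \<and>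
        S * S' = 1\<^sub>m n \<and> S' * S = 1\<^sub>m n \<and> T * T' = 1\<^sub>m n \<and> T' * T = 1\<^sub>m n \<and>
        S * X * T = X' \<and> S * Y * T = Y')"

lemma pencil_equivI:
  assumes "X \<in> carrier_mat n n" "Y \<in> carrier_mat n n"
    and "S \<in> carrier_mat n n" "S' \<in> carrier_mat n n" "T \<in> carrier_mat n n" "T' \<in> carrier_mat n n"
    and "S * S' = 1\<^sub>m n" "S' * S = 1\<^sub>m n" "T * T' = 1\<^sub>m n" "T' * T = 1\<^sub>m n"
    and "S * X * T = X'" "S * Y * T = Y'"
  shows "pencil_equiv n X Y X' Y'"
  using assms unfolding pencil_equiv_def by blast

lemma pencil_equiv_refl: "X \<in> carrier_mat n n \<Longrightarrow> Y \<in> carrier_mat n n \<Longrightarrow> pencil_equiv n X Y X Y"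
  by (rule pencil_equivI[of _ _ _ "1\<^sub>m n" "1\<^sub>m n" "1\<^sub>m n" "1\<^sub>m n"]) auto

lemma mult_inverse_pair:
  fixes A B :: "'a :: semiring_1 mat"
  assumes "A \<in> carrier_mat n n" "A' \<in> carrier_mat n n" "B \<in> carrier_mat n n" "B' \<in> carrier_mat n n"
    and "A * A' = 1\<^sub>m n" "B * B' = 1\<^sub>m n"
  shows "(A * B) * (B' * A') = 1\<^sub>m n"
proof -
  have "(A * B) * (B' * A') = A * ((B * B') * A')"
    using assms(1-4) by (simp add: assoc_mult_mat[of _ n n _ n _ n])
  then show ?thesis using assms by simp
qed

lemma pencil_equiv_trans:
  assumes 1: "pencil_equiv n X Y X' Y'" and 2: "pencil_equiv n X' Y' X'' Y''"
  shows "pencil_equiv n X Y X'' Y''"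
proof -
  obtain S S' T T' where ST: "S \<in> carrier_mat n n" "S' \<in> carrier_mat n n" "T \<in> carrier_mat n n" "T' \<in> carrier_mat n n"
      "S * S' = 1\<^sub>m n" "S' * S = 1\<^sub>m n" "T * T' = 1\<^sub>m n" "T' * T = 1\<^sub>m n"
      and eq: "S * X * T = X'" "S * Y * T = Y'"
    using 1 unfolding pencil_equiv_def by blast
  obtain U U' V V' where UV: "U \<in> carrier_mat n n" "U' \<in> carrier_mat n n" "V \<in> carrier_mat n n" "V' \<in> carrier_mat n n"
      "U * U' = 1\<^sub>m n" "U' * U = 1\<^sub>m n" "V * V' = 1\<^sub>m n" "V' * V = 1\<^sub>m n"
      and eq': "U * X' * V = X''" "U * Y' * V = Y''"
    using 2 unfolding pencil_equiv_def by blast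
  have XY: "X \<in> carrier_mat n n" "Y \<in> carrier_mat n n" using 1 by (auto simp: pencil_equiv_def)
  have assoc: "(U * S) * Z * (T * V) = U * (S * Z * T) * V" if "Z \<in> carrier_mat n n" for Z
    using ST(1-4) UV(1-4) that by (simp add: assoc_mult_mat[of _ n n _ n _ n])
  show ?thesis
  proof (rule pencil_equivI[of _ _ _ "U * S" "S' * U'" "T * V" "V' * T'"])
    show "(U * S) * X * (T * V) = X''" "(U * S) * Y * (T * V) = Y''"
      using XY by (simp_all only: assoc eq eq')
    show "U * S * (S' * U') = 1\<^sub>m n" "S' * U' * (U * S) = 1\<^sub>m n"
      "T * V * (V' * T') = 1\<^sub>m n" "V' * T' * (T * V) = 1\<^sub>m n"
      using ST UV by (auto intro!: mult_inverse_pair)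
  qed (use ST UV XY in auto)
qed

abbreviation dsum :: "'a :: zero mat \<Rightarrow> 'a mat \<Rightarrow> 'a mat" where
  "dsum A B \<equiv> four_block_mat A (0\<^sub>m (dim_row A) (dim_col B)) (0\<^sub>m (dim_row B) (dim_col A)) B"

lemma dsum_mult:
  fixes A B :: "'a :: semiring_0 mat"
  assumes "A \<in> carrier_mat n n" "A' \<in> carrier_mat n n" "B \<in> carrier_mat m m" "B' \<in> carrier_mat m m"
  shows "dsum A B * dsum A' B' = dsum (A * A') (B * B')"
  using assms by (subst mult_four_block_mat[of _ n n _ m _ m _ _ n _ m]) auto

lemma dsum_one: "dsum (1\<^sub>m n) (1\<^sub>m m) = 1\<^sub>m (n + m)"
  by (rule eq_matI) auto

lemma dsum_uminus: "- dsum A B = dsum (- A) (- B)"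
  for A B :: "'a :: ring mat"
  by (rule eq_matI) auto

lemma pencil_equiv_dsum:
  assumes 1: "pencil_equiv n X Y X' Y'" and 2: "pencil_equiv m Z W Z' W'"
  shows "pencil_equiv (n + m) (dsum X Z) (dsum Y W) (dsum X' Z') (dsum Y' W')"
proof -
  obtain S S' T T' where ST: "S \<in> carrier_mat n n" "S' \<in> carrier_mat n n" "T \<in> carrier_mat n n" "T' \<in> carrier_mat n n"
      "S * S' = 1\<^sub>m n" "S' * S = 1\<^sub>m n" "T * T' = 1\<^sub>m n" "T' * T = 1\<^sub>m n"
      and eq: "S * X * T = X'" "S * Y * T = Y'"
    using 1 unfolding pencil_equiv_def by blast
  obtain U U' V V' where UV: "U \<in> carrier_mat m m" "U' \<in> carrier_mat m m" "V \<in> carrier_mat m m" "V' \<in> carrier_mat m m"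
      "U * U' = 1\<^sub>m m" "U' * U = 1\<^sub>m m" "V * V' = 1\<^sub>m m" "V' * V = 1\<^sub>m m"
      and eq': "U * Z * V = Z'" "U * W * V = W'"
    using 2 unfolding pencil_equiv_def by blast
  have c: "X \<in> carrier_mat n n" "Y \<in> carrier_mat n n" "Z \<in> carrier_mat m m" "W \<in> carrier_mat m m"
    using 1 2 by (auto simp: pencil_equiv_def)
  show ?thesis
  proof (rule pencil_equivI[of _ _ _ "dsum S U" "dsum S' U'" "dsum T V" "dsum T' V'"])
    show "dsum S U * dsum X Z * dsum T V = dsum X' Z'"
      using ST(1-4) UV(1-4) c eq eq'
      by (simp only: dsum_mult[of _ n _ _ m] mult_carrier_mat[of _ n n _ n] mult_carrier_mat[of _ m m _ m])
    show "dsum S U * dsum Y W * dsum T V = dsum Y' W'"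
      using ST(1-4) UV(1-4) c eq eq'
      by (simp only: dsum_mult[of _ n _ _ m] mult_carrier_mat[of _ n n _ n] mult_carrier_mat[of _ m m _ m])
    show "dsum S U * dsum S' U' = 1\<^sub>m (n + m)" "dsum S' U' * dsum S U = 1\<^sub>m (n + m)"
      "dsum T V * dsum T' V' = 1\<^sub>m (n + m)" "dsum T' V' * dsum T V = 1\<^sub>m (n + m)"
      using ST UV by (simp_all only: dsum_mult[of _ n _ _ m] dsum_one)
  qed (use ST UV c in auto)
qed

lemma pencil_equiv_append:
  assumes "pencil_equiv n X Y (diag_block_mat As) (diag_block_mat Bs)"
    and "pencil_equiv m Z W (diag_block_mat As') (diag_block_mat Bs')"
  shows "pencil_equiv (n + m) (dsum X Z) (dsum Y W)
    (diag_block_mat (As @ As')) (diag_block_mat (Bs @ Bs'))"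
  using pencil_equiv_dsum[OF assms] by (simp add: diag_block_mat_append Let_def)

lemma kronecker_formI:
  assumes "pencil_equiv n X Y (diag_block_mat (map block_lead bs)) (diag_block_mat (map block_const bs))"
    and "\<forall>b\<in>set bs. proper_block b"
  shows "kronecker_form X Y bs"
proof -
  obtain S S' T T' where ST: "S \<in> carrier_mat n n" "S' \<in> carrier_mat n n" "T \<in> carrier_mat n n" "T' \<in> carrier_mat n n"
      "S * S' = 1\<^sub>m n" "S' * S = 1\<^sub>m n" "T * T' = 1\<^sub>m n" "T' * T = 1\<^sub>m n"
      and eq: "S * X * T = diag_block_mat (map block_lead bs)" "S * Y * T = diag_block_mat (map block_const bs)"
      and XY: "X \<in> carrier_mat n n" "Y \<in> carrier_mat n n"
    using assms(1) unfolding pencil_equiv_def by blast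
  have "invertible_mat S"
    using ST unfolding invertible_mat_def inverts_mat_def by (intro conjI exI[of _ S']) auto
  moreover have "invertible_mat T"
    using ST unfolding invertible_mat_def inverts_mat_def by (intro conjI exI[of _ T']) auto
  ultimately show ?thesis
    unfolding kronecker_form_def using assms(2) ST eq XY
    by (intro conjI exI[of _ S] exI[of _ T]) auto
qed

text \<open>A similarity of \<open>M\<close> leaves the identity in the other coefficient alone. The first form serves the
  blocks at infinity, the second one the finite blocks.\<close>

lemma pencil_equiv_similar:
  fixes M :: "complex mat"
  assumes "M \<in> carrier_mat n n" "similar_mat_wit M N P Q"
  shows "pencil_equiv n M (- 1\<^sub>m n) N (- 1\<^sub>m n)" "pencil_equiv n (1\<^sub>m n) (- M) (1\<^sub>m n) (- N)"
proof -
  note w = similar_mat_witD2[OF assms]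
  have "Q * M * P = (Q * P) * N * (Q * P)"
    unfolding w(3) using w(4-) by (simp add: assoc_mult_mat[of _ n n _ n _ n])
  then have QMP: "Q * M * P = N" using w by simp
  have neg: "Q * (- Z) * P = - (Q * Z * P)" if "Z \<in> carrier_mat n n" for Z
    using w(6,7) that by simp
  show "pencil_equiv n M (- 1\<^sub>m n) N (- 1\<^sub>m n)" "pencil_equiv n (1\<^sub>m n) (- M) (1\<^sub>m n) (- N)"
    using w QMP neg[OF w(4)] neg[OF one_carrier_mat]
    by (auto intro!: pencil_equivI[of _ _ _ Q P P Q])
qed

lemma jordan_nf_complex_exists:
  fixes M :: "complex mat"
  assumes "M \<in> carrier_mat n n"
  obtains ms where "jordan_nf M ms"
  using char_poly_factorized[OF assms] jordan_nf_exists[OF assms] by blast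

lemma jordan_matrix_Fin_Blocks:
  fixes ms :: "(nat \<times> complex) list"
  shows "diag_block_mat (map block_lead (map (\<lambda>(p, \<mu>). Fin_Block p \<mu>) ms)) = 1\<^sub>m (sum_list (map fst ms))"
    and "diag_block_mat (map block_const (map (\<lambda>(p, \<mu>). Fin_Block p \<mu>) ms)) = - jordan_matrix ms"
proof -
  show "diag_block_mat (map block_lead (map (\<lambda>(p, \<mu>). Fin_Block p \<mu>) ms)) = 1\<^sub>m (sum_list (map fst ms))"
    by (induct ms) (auto simp: dsum_one[simplified])
  show "diag_block_mat (map block_const (map (\<lambda>(p, \<mu>). Fin_Block p \<mu>) ms)) = - jordan_matrix ms"
  proof (induct ms)
    case Nil
    have "- (0\<^sub>m 0 0) = (0\<^sub>m 0 0 :: complex mat)" by (rule eq_matI) auto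
    then show ?case by (simp add: jordan_matrix_def)
  next
    case (Cons m ms)
    then show ?case
      using dsum_uminus[of "jordan_block (fst m) (snd m)" "jordan_matrix ms"]
      by (cases m) (simp add: jordan_matrix_Cons)
  qed
qed

text \<open>Multiplication by \<open>K\<inverse>\<close> turns \<open>\<lambda>K - I\<close> into \<open>\<lambda>I - K\<inverse>\<close>, and the Jordan form of \<open>K\<inverse>\<close> provides the
  finite blocks.\<close>

lemma invertible_pencil_kronecker:
  assumes K: "K \<in> carrier_mat n n" "K' \<in> carrier_mat n n" "K * K' = 1\<^sub>m n" "K' * K = 1\<^sub>m n"
  shows "\<exists>bs. (\<forall>b\<in>set bs. proper_block b) \<and>
    pencil_equiv n K (- 1\<^sub>m n) (diag_block_mat (map block_lead bs)) (diag_block_mat (map block_const bs))"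
proof -
  obtain ms where jnf: "jordan_nf K' ms" using jordan_nf_complex_exists[OF K(2)] .
  have 0: "0 \<notin> fst ` set ms" using jnf by (simp add: jordan_nf_def)
  obtain P Q where w: "similar_mat_wit K' (jordan_matrix ms) P Q"
    using jnf by (auto simp: jordan_nf_def similar_mat_def)
  have n: "sum_list (map fst ms) = n"
    using carrier_matD(1)[OF similar_mat_witD2(5)[OF K(2) w]] jordan_matrix_dim(1)[of ms] by argo
  have "K' * (- 1\<^sub>m n) * 1\<^sub>m n = - K'" using K(2) by simp
  then have "pencil_equiv n K (- 1\<^sub>m n) (1\<^sub>m n) (- K')"
    using K by (intro pencil_equivI[of _ _ _ K' K "1\<^sub>m n" "1\<^sub>m n"]) simp_all
  from pencil_equiv_trans[OF this pencil_equiv_similar(2)[OF K(2) w]]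
  have *: "pencil_equiv n K (- 1\<^sub>m n)
      (diag_block_mat (map block_lead (map (\<lambda>(p, \<mu>). Fin_Block p \<mu>) ms)))
      (diag_block_mat (map block_const (map (\<lambda>(p, \<mu>). Fin_Block p \<mu>) ms)))"
    unfolding jordan_matrix_Fin_Blocks n .
  show ?thesis
  proof (rule exI, rule conjI[OF _ *], rule ballI)
    fix b assume "b \<in> set (map (\<lambda>(p, \<mu>). Fin_Block p \<mu>) ms)"
    then obtain p \<mu> where "b = Fin_Block p \<mu>" "(p, \<mu>) \<in> set ms" by auto
    moreover from this have "p \<noteq> 0" using 0 by (metis fst_conv image_eqI)
    ultimately show "proper_block b" by simp
  qed
qed

lemma jordan_block_invertible:
  fixes a :: complex
  assumes "a \<noteq> 0"
  shows "\<exists>K'\<in>carrier_mat s s. jordan_block s a * K' = 1\<^sub>m s \<and> K' * jordan_block s a = 1\<^sub>m s"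
proof -
  have "diag_mat (jordan_block s a) = replicate s a"
    by (rule nth_equalityI) (auto simp: diag_mat_def jordan_block_def)
  moreover have "upper_triangular (jordan_block s a)"
    by (auto simp: jordan_block_def)
  ultimately have "det (jordan_block s a) = prod_list (replicate s a)"
    using det_upper_triangular[OF _ jordan_block_carrier] by metis
  then have "det (jordan_block s a) \<noteq> 0"
    using assms by (simp add: prod_list_zero_iff)
  from det_non_zero_imp_unit[OF jordan_block_carrier this, of "()"]
  show ?thesis by (auto simp: Units_def ring_mat_simps)
qed

text \<open>In \<open>\<lambda>M - I\<close> with \<open>M\<close> in Jordan form, a nilpotent block is literally a block at infinity of the same
  size; every other Jordan block is invertible and splits into finite blocks.\<close>

lemma jordan_pencil_kronecker:
  fixes ms :: "(nat \<times> complex) list"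
  assumes "0 \<notin> fst ` set ms"
  defines "N \<equiv> sum_list (map fst ms)"
  shows "\<exists>bs. (\<forall>b\<in>set bs. proper_block b) \<and> (\<forall>s. (s, 0) \<in> set ms \<longrightarrow> Inf_Block s \<in> set bs) \<and>
    pencil_equiv N (jordan_matrix ms) (- 1\<^sub>m N)
      (diag_block_mat (map block_lead bs)) (diag_block_mat (map block_const bs))"
  using assms(1) unfolding N_def
proof (induct ms)
  case Nil
  show ?case
  proof (intro exI[of _ "[]"] conjI)
    have "- 1\<^sub>m 0 = (0\<^sub>m 0 0 :: complex mat)" by (rule eq_matI) auto
    then show "pencil_equiv (sum_list (map fst [])) (jordan_matrix ([] :: (nat \<times> complex) list))
      (- 1\<^sub>m (sum_list (map fst []))) (diag_block_mat (map block_lead []))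
      (diag_block_mat (map block_const []))"
      by (simp add: jordan_matrix_def pencil_equiv_refl)
  qed auto
next
  case (Cons m ms)
  obtain s a where m: "m = (s, a)" by (cases m)
  with Cons.prems have s: "s \<noteq> 0" by force
  let ?N = "sum_list (map fst ms)"
  let ?L = "\<lambda>bs. diag_block_mat (map block_lead bs)" and ?C = "\<lambda>bs. diag_block_mat (map block_const bs)"
  obtain bs where bs: "\<forall>b\<in>set bs. proper_block b" "\<forall>s. (s, 0) \<in> set ms \<longrightarrow> Inf_Block s \<in> set bs"
    and eq: "pencil_equiv ?N (jordan_matrix ms) (- 1\<^sub>m ?N) (?L bs) (?C bs)"
    using Cons by auto
  have "\<exists>cs. (\<forall>b\<in>set cs. proper_block b) \<and> (a = 0 \<longrightarrow> Inf_Block s \<in> set cs) \<and>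
    pencil_equiv s (jordan_block s a) (- 1\<^sub>m s) (?L cs) (?C cs)"
  proof (cases "a = 0")
    case True
    then show ?thesis
      using s by (intro exI[of _ "[Inf_Block s]"]) (simp add: pencil_equiv_refl del: diag_block_mat.simps)
  next
    case False
    then show ?thesis
      using jordan_block_invertible[OF False, of s] invertible_pencil_kronecker[OF jordan_block_carrier] by blast
  qed
  then obtain cs where cs: "\<forall>b\<in>set cs. proper_block b" "a = 0 \<longrightarrow> Inf_Block s \<in> set cs"
    and eq': "pencil_equiv s (jordan_block s a) (- 1\<^sub>m s) (?L cs) (?C cs)" by blast
  have "dsum (- 1\<^sub>m s) (- 1\<^sub>m ?N) = (- 1\<^sub>m (s + ?N) :: complex mat)" by (rule eq_matI) auto
  then have "pencil_equiv (s + ?N) (jordan_matrix (m # ms)) (- 1\<^sub>m (s + ?N)) (?L (cs @ bs)) (?C (cs @ bs))"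
    using pencil_equiv_append[OF eq' eq] by (simp add: m jordan_matrix_Cons)
  then show ?case
    using cs bs by (intro exI[of _ "cs @ bs"]) (auto simp: m)
qed

lemma dsum_mult_append:
  fixes A B :: "'a :: semiring_0 mat"
  assumes "A \<in> carrier_mat n n" "B \<in> carrier_mat m m" "x \<in> carrier_vec n" "y \<in> carrier_vec m"
  shows "dsum A B *\<^sub>v (x @\<^sub>v y) = A *\<^sub>v x @\<^sub>v B *\<^sub>v y"
  using assms by (auto simp: four_block_mat_mult_vec[of _ n n _ m _ m])

text \<open>Blocks \<open>(s, 0)\<close> with \<open>s \<le> 1\<close> are zero and the others are invertible, so the kernel of the square is
  no larger than the kernel.\<close>

lemma jordan_matrix_no_chain:
  fixes ms :: "(nat \<times> complex) list"
  assumes "\<And>s. (s, 0) \<in> set ms \<Longrightarrow> s \<le> 1"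
    and "z \<in> carrier_vec (sum_list (map fst ms))"
    and "jordan_matrix ms *\<^sub>v (jordan_matrix ms *\<^sub>v z) = 0\<^sub>v (sum_list (map fst ms))"
  shows "jordan_matrix ms *\<^sub>v z = 0\<^sub>v (sum_list (map fst ms))"
  using assms
proof (induct ms arbitrary: z)
  case Nil
  then show ?case by (auto simp: jordan_matrix_def)
next
  case (Cons m ms)
  obtain s a where m: "m = (s, a)" by (cases m)
  let ?N = "sum_list (map fst ms)"
  let ?B = "jordan_block s a" and ?J = "jordan_matrix ms"
  obtain x y where z: "z = x @\<^sub>v y" and x: "x \<in> carrier_vec s" and y: "y \<in> carrier_vec ?N"
    using Cons.prems(2) vec_first_last_append[of z s ?N] by (metis list.map(2) m fst_conv sum_list.Cons vec_first_carrier vec_last_carrier)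
  have D: "jordan_matrix (m # ms) = dsum ?B ?J" by (simp add: m jordan_matrix_Cons)
  have mult: "dsum ?B ?J *\<^sub>v (u @\<^sub>v w) = ?B *\<^sub>v u @\<^sub>v ?J *\<^sub>v w"
    if "u \<in> carrier_vec s" "w \<in> carrier_vec ?N" for u w
    using that by (intro dsum_mult_append) auto
  have zero: "0\<^sub>v (s + ?N) = 0\<^sub>v s @\<^sub>v (0\<^sub>v ?N :: complex vec)" by (rule eq_vecI) auto
  have Bx: "?B *\<^sub>v x \<in> carrier_vec s" and Jy: "?J *\<^sub>v y \<in> carrier_vec ?N"
    by (auto intro!: mult_mat_vec_carrier x y)
  have "?B *\<^sub>v (?B *\<^sub>v x) @\<^sub>v ?J *\<^sub>v (?J *\<^sub>v y) = 0\<^sub>v s @\<^sub>v 0\<^sub>v ?N"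
    using Cons.prems(3) unfolding D z mult[OF x y] mult[OF Bx Jy] by (simp add: m zero)
  moreover have "?B *\<^sub>v (?B *\<^sub>v x) \<in> carrier_vec s"
    by (rule mult_mat_vec_carrier[OF _ Bx]) simp
  ultimately have B2: "?B *\<^sub>v (?B *\<^sub>v x) = 0\<^sub>v s" and J2: "?J *\<^sub>v (?J *\<^sub>v y) = 0\<^sub>v ?N"
    by (simp_all add: append_vec_eq[of _ s])
  have "?J *\<^sub>v y = 0\<^sub>v ?N" using Cons.hyps[OF _ y J2] Cons.prems(1) by simp
  moreover have "?B *\<^sub>v x = 0\<^sub>v s"
  proof (cases "a = 0")
    case True
    with Cons.prems(1)[of s] m have "s \<le> 1" by simp
    with True x show ?thesis
      by (intro eq_vecI) (auto simp: jordan_block_def scalar_prod_def)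
  next
    case False
    obtain K where K: "K \<in> carrier_mat s s" "K * ?B = 1\<^sub>m s" using jordan_block_invertible[OF False, of s] by blast
    have "?B *\<^sub>v x = K *\<^sub>v (?B *\<^sub>v (?B *\<^sub>v x))"
      using K Bx by (simp flip: assoc_mult_mat_vec[of _ s s _ s])
    also have "\<dots> = 0\<^sub>v s" unfolding B2 using K by simp
    finally show ?thesis .
  qed
  ultimately show ?case unfolding D z mult[OF x y] by (simp add: m zero)
qed

text \<open>With \<open>M = -Y\<inverse>X\<close> the pencil is equivalent to \<open>\<lambda>M - I\<close>, and the chain gives \<open>Mz\<^sub>2 = -z\<^sub>1 \<noteq> 0\<close> and
  \<open>M\<^sup>2z\<^sub>2 = 0\<close>. So the Jordan form of \<open>M\<close> has a nilpotent block of size at least two.\<close>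

lemma pencil_index_ge_2I:
  assumes X: "X \<in> carrier_mat N N" and Y: "Y \<in> carrier_mat N N" and Y0: "det Y \<noteq> 0"
    and z: "z1 \<in> carrier_vec N" "z2 \<in> carrier_vec N" "z1 \<noteq> 0\<^sub>v N"
    and ch: "X *\<^sub>v z1 = 0\<^sub>v N" "X *\<^sub>v z2 = Y *\<^sub>v z1"
  shows "pencil_index X Y \<ge> 2"
proof -
  from det_non_zero_imp_unit[OF Y Y0, of "()"] obtain Y' where
    Y': "Y' \<in> carrier_mat N N" "Y' * Y = 1\<^sub>m N" "Y * Y' = 1\<^sub>m N"
    by (auto simp: Units_def ring_mat_simps)
  define R where "R = - (Y' * X)"
  have R: "R \<in> carrier_mat N N" using X Y' by (simp add: R_def)
  have Rz2: "R *\<^sub>v z2 = - z1"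
  proof -
    have "(Y' * X) *\<^sub>v z2 = Y' *\<^sub>v (Y *\<^sub>v z1)"
      using assoc_mult_mat_vec[OF Y'(1) X z(2)] ch(2) by simp
    also have "\<dots> = z1"
      using assoc_mult_mat_vec[OF Y'(1) Y z(1)] Y'(2) z(1) by simp
    finally show ?thesis using X Y' z by (simp add: R_def uminus_mult_mat_vec)
  qed
  have Rz1: "R *\<^sub>v z1 = 0\<^sub>v N"
    using X Y' z ch by (simp add: R_def uminus_mult_mat_vec assoc_mult_mat_vec[of _ N N _ N])
  let ?c = "map_mat complex_of_real"
  let ?M = "?c R" and ?z = "map_vec complex_of_real z2"
  have M: "?M \<in> carrier_mat N N" and zc: "?z \<in> carrier_vec N" using R z by auto
  have Mz: "?M *\<^sub>v ?z = map_vec complex_of_real (- z1)"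
    by (simp only: of_real_hom.mult_mat_vec_hom[OF R z(2), symmetric] Rz2)
  have "?M *\<^sub>v map_vec complex_of_real (- z1) = map_vec complex_of_real (R *\<^sub>v (- z1))"
    by (rule of_real_hom.mult_mat_vec_hom[OF R, symmetric]) (use z in simp)
  also have "R *\<^sub>v (- z1) = 0\<^sub>v N" using R z Rz1 by (simp add: mult_mat_vec_uminus[of _ N N])
  finally have MMz: "?M *\<^sub>v (?M *\<^sub>v ?z) = 0\<^sub>v N" unfolding Mz by (auto intro!: eq_vecI)
  have Mz0: "?M *\<^sub>v ?z \<noteq> 0\<^sub>v N"
  proof
    assume *: "?M *\<^sub>v ?z = 0\<^sub>v N"
    have "z1 = 0\<^sub>v N"
    proof (rule eq_vecI)
      fix i assume "i < dim_vec (0\<^sub>v N :: real vec)"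
      then have i: "i < N" by simp
      have "map_vec complex_of_real (- z1) $ i = 0" using * i unfolding Mz by simp
      then show "z1 $ i = 0\<^sub>v N $ i" using i z by simp
    qed (use z in simp)
    with z(3) show False ..
  qed
  obtain ms where "jordan_nf ?M ms" using jordan_nf_complex_exists[OF M] .
  then obtain P Q where 0: "0 \<notin> fst ` set ms" and w: "similar_mat_wit ?M (jordan_matrix ms) P Q"
    unfolding jordan_nf_def similar_mat_def by blast
  let ?J = "jordan_matrix ms"
  note wD = similar_mat_witD2[OF M w]
  have N: "sum_list (map fst ms) = N" using carrier_matD(1)[OF wD(5)] jordan_matrix_dim(1)[of ms] by argo
  obtain s where s: "(s, 0) \<in> set ms" "s \<ge> 2"
  proof (rule ccontr)
    assume "\<not> thesis"
    then have small: "\<And>s. (s, 0) \<in> set ms \<Longrightarrow> s \<le> 1" using that by force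
    let ?y = "Q *\<^sub>v ?z"
    have y: "?y \<in> carrier_vec N" using wD zc by simp
    have QM: "Q *\<^sub>v (?M *\<^sub>v u) = ?J *\<^sub>v (Q *\<^sub>v u)" if u: "u \<in> carrier_vec N" for u
    proof -
      have "Q * ?M = (Q * P) * ?J * Q"
        unfolding wD(3) using wD(4-) by (simp add: assoc_mult_mat[of _ N N _ N _ N])
      then have "Q * ?M = ?J * Q" unfolding wD(2) left_mult_one_mat[OF wD(5)] .
      then show ?thesis
        using assoc_mult_mat_vec[OF wD(7,4) u] assoc_mult_mat_vec[OF wD(5,7) u] by simp
    qed
    have "?M *\<^sub>v ?z \<in> carrier_vec N" using M zc by (rule mult_mat_vec_carrier)
    then have "?J *\<^sub>v (?J *\<^sub>v ?y) = Q *\<^sub>v 0\<^sub>v N"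
      using QM[OF zc] QM[of "?M *\<^sub>v ?z"] MMz by metis
    also have "\<dots> = 0\<^sub>v N" using wD(7) by (rule mult_mat_zero_vec)
    finally have "?J *\<^sub>v ?y = 0\<^sub>v N"
      using jordan_matrix_no_chain[of ms ?y, OF small] y unfolding N by blast
    then have "Q *\<^sub>v (?M *\<^sub>v ?z) = 0\<^sub>v N" using QM[OF zc] by metis
    moreover have "P *\<^sub>v (Q *\<^sub>v (?M *\<^sub>v ?z)) = ?M *\<^sub>v ?z"
      using assoc_mult_mat_vec[OF wD(6,7), of "?M *\<^sub>v ?z"] wD(1) M zc by simp
    moreover have "P *\<^sub>v 0\<^sub>v N = 0\<^sub>v N" using wD(6) by (rule mult_mat_zero_vec)
    ultimately show False using Mz0 by metis
  qed
  obtain bs where bs: "\<forall>b\<in>set bs. proper_block b" "Inf_Block s \<in> set bs"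
    and eq: "pencil_equiv N ?J (- 1\<^sub>m N) (diag_block_mat (map block_lead bs)) (diag_block_mat (map block_const bs))"
    using jordan_pencil_kronecker[OF 0] s(1) unfolding N by blast
  have "pencil_equiv N (?c X) (?c Y) ?M (- 1\<^sub>m N)"
  proof (rule pencil_equivI[where T' = "1\<^sub>m N"])
    have cneg: "?c (- Z) = - ?c Z" for Z by (rule eq_matI) auto
    have cone: "?c (1\<^sub>m N) = 1\<^sub>m N" by (rule eq_matI) auto
    have cY: "?c Y' \<in> carrier_mat N N" "?c Y \<in> carrier_mat N N" using Y Y' by auto
    have mult: "- ?c Y' * ?c Z * 1\<^sub>m N = - ?c (Y' * Z)" if Z: "Z \<in> carrier_mat N N" for Z
    proof -
      have "?c Z \<in> carrier_mat N N" using Z by simp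
      then have "- ?c Y' * ?c Z * 1\<^sub>m N = - (?c Y' * ?c Z)" using cY(1) by simp
      then show ?thesis by (simp only: of_real_hom.mat_hom_mult[OF Y'(1) Z])
    qed
    show "- ?c Y' * ?c X * 1\<^sub>m N = ?M" unfolding mult[OF X] R_def cneg ..
    show "- ?c Y' * ?c Y * 1\<^sub>m N = - 1\<^sub>m N" unfolding mult[OF Y] Y'(2) cone ..
    have "- ?c Y' * - ?c Y = ?c (Y' * Y)" "- ?c Y * - ?c Y' = ?c (Y * Y')"
      using cY by (simp_all add: of_real_hom.mat_hom_mult[OF Y'(1) Y] of_real_hom.mat_hom_mult[OF Y Y'(1)])
    then show "- ?c Y' * - ?c Y = 1\<^sub>m N" "- ?c Y * - ?c Y' = 1\<^sub>m N"
      unfolding Y'(2,3) cone .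
  qed (use X Y Y' in simp_all)
  from pencil_equiv_trans[OF this pencil_equiv_trans[OF pencil_equiv_similar(1)[OF M w] eq]]
  have "kronecker_form (?c X) (?c Y) bs" by (rule kronecker_formI) (rule bs(1))
  then show ?thesis unfolding pencil_index_ge_2_iff using bs s by blast
qed

section \<open>Chains of the companion linearization\<close>

lemma sum_blocks: "(\<Sum>a<k * n. f a) = (\<Sum>b<k. \<Sum>c<n. f (b * n + c))"
  for f :: "nat \<Rightarrow> 'a :: comm_monoid_add"
proof -
  have "(\<Sum>a<k * n. f a) = (\<Sum>b<k. sum f {0 + b * n..<n + b * n})"
    by (simp add: sum.nat_group[symmetric] add.commute)
  then show ?thesis
    by (simp only: sum.shift_bounds_nat_ivl) (simp add: atLeast0LessThan add.commute)
qed

lemma block_index_less: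
  fixes b c k n :: nat
  assumes "b < k" "c < n" shows "b * n + c < k * n"
proof -
  have "b * n + c < Suc b * n" using assms by simp
  also have "\<dots> \<le> k * n" using assms by (intro mult_le_mono1) simp
  finally show ?thesis .
qed

lemma vec_eq_blocksI:
  assumes "x \<in> carrier_vec (k * n)" "y \<in> carrier_vec (k * n)"
    and eq: "\<And>b c. b < k \<Longrightarrow> c < n \<Longrightarrow> x $ (b * n + c) = y $ (b * n + c)"
  shows "x = y"
proof (rule eq_vecI)
  fix a assume "a < dim_vec y"
  then have a: "a < k * n" using assms by simp
  then have "0 < n" by (cases n) auto
  with a have "a div n < k" "a mod n < n" by (simp_all add: less_mult_imp_div_less)
  then show "x $ a = y $ a" using eq[of "a div n" "a mod n"] by simp
qed (use assms in simp)

definition block_vec :: "nat \<Rightarrow> 'a vec \<Rightarrow> nat \<Rightarrow> 'a vec" where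
  "block_vec n z b = vec n (\<lambda>c. z $ (b * n + c))"

lemma block_vec_carrier [simp]: "block_vec n z b \<in> carrier_vec n"
  by (simp add: block_vec_def)

lemma companion_carrier [simp]:
  "companion_lead n k Y \<in> carrier_mat (k * n) (k * n)"
  "companion_const n k Y \<in> carrier_mat (k * n) (k * n)"
  by (simp_all add: companion_lead_def companion_const_def)

lemma companion_lead_mult:
  assumes z: "z \<in> carrier_vec (k * n)" and Y: "Y k \<in> carrier_mat n n" and b: "b < k" and r: "r < n"
  shows "(companion_lead n k Y *\<^sub>v z) $ (b * n + r) =
    (if b = 0 then (Y k *\<^sub>v block_vec n z 0) $ r else z $ (b * n + r))"
proof -
  note br = block_index_less[OF b r]
  have "(companion_lead n k Y *\<^sub>v z) $ (b * n + r)
      = (\<Sum>b'<k. \<Sum>c<n. companion_lead n k Y $$ (b * n + r, b' * n + c) * z $ (b' * n + c))"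
    unfolding mult_mat_vec_index_sum[OF companion_carrier(1) z br] by (rule sum_blocks)
  also have "\<dots> = (\<Sum>b'<k. \<Sum>c<n. (if b = 0 \<and> b' = 0 then Y k $$ (r, c)
      else if b = b' \<and> r = c then 1 else 0) * z $ (b' * n + c))"
  proof (intro sum.cong refl)
    fix b' c assume "b' \<in> {..<k}" "c \<in> {..<n}"
    then have b': "b' < k" and c: "c < n" by auto
    have "b * n + r = b' * n + c \<longleftrightarrow> b = b' \<and> r = c"
      using r c by (metis add.commute div_mult_self1_is_m div_mult_self3 mod_mult_self3 mod_less div_less add_0 less_nat_zero_code neq0_conv)
    then show "companion_lead n k Y $$ (b * n + r, b' * n + c) * z $ (b' * n + c)
      = (if b = 0 \<and> b' = 0 then Y k $$ (r, c) else if b = b' \<and> r = c then 1 else 0) * z $ (b' * n + c)"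
      using r c br block_index_less[OF b' c] by (simp add: companion_lead_def)
  qed
  also have "\<dots> = (if b = 0 then (Y k *\<^sub>v block_vec n z 0) $ r else z $ (b * n + r))"
  proof (cases "b = 0")
    case True
    have "(\<Sum>b'<k. \<Sum>c<n. (if b = 0 \<and> b' = 0 then Y k $$ (r, c)
        else if b = b' \<and> r = c then 1 else 0) * z $ (b' * n + c))
        = (\<Sum>b'<k. if b' = 0 then \<Sum>c<n. Y k $$ (r, c) * z $ c else 0)"
      using True by (intro sum.cong refl) auto
    also have "\<dots> = (\<Sum>c<n. Y k $$ (r, c) * z $ c)" using b by simp
    also have "\<dots> = (Y k *\<^sub>v block_vec n z 0) $ r"
      unfolding mult_mat_vec_index_sum[OF Y block_vec_carrier r] by (simp add: block_vec_def)
    finally show ?thesis using True by simp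
  next
    case False
    have "(\<Sum>b'<k. \<Sum>c<n. (if b = 0 \<and> b' = 0 then Y k $$ (r, c)
        else if b = b' \<and> r = c then 1 else 0) * z $ (b' * n + c))
        = (\<Sum>b'<k. \<Sum>c<n. if b' = b \<and> c = r then z $ (b * n + r) else 0)"
      using False by (intro sum.cong refl) auto
    also have "\<dots> = (\<Sum>b'<k. if b' = b then \<Sum>c<n. if c = r then z $ (b * n + r) else 0 else 0)"
      by (intro sum.cong refl) auto
    also have "\<dots> = z $ (b * n + r)" using b r by simp
    finally show ?thesis using False by simp
  qed
  finally show ?thesis .
qed

lemma companion_const_mult:
  assumes z: "z \<in> carrier_vec (k * n)" and Y: "\<And>i. i < k \<Longrightarrow> Y i \<in> carrier_mat n n"
    and b: "b < k" and r: "r < n"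
  shows "(companion_const n k Y *\<^sub>v z) $ (b * n + r) =
    (if b = 0 then \<Sum>b'<k. (Y (k - 1 - b') *\<^sub>v block_vec n z b') $ r else - z $ ((b - 1) * n + r))"
proof -
  note br = block_index_less[OF b r]
  have "(companion_const n k Y *\<^sub>v z) $ (b * n + r)
      = (\<Sum>b'<k. \<Sum>c<n. companion_const n k Y $$ (b * n + r, b' * n + c) * z $ (b' * n + c))"
    unfolding mult_mat_vec_index_sum[OF companion_carrier(2) z br] by (rule sum_blocks)
  also have "\<dots> = (\<Sum>b'<k. \<Sum>c<n. (if b = 0 then Y (k - 1 - b') $$ (r, c)
      else if b = Suc b' \<and> r = c then - 1 else 0) * z $ (b' * n + c))"
    using r br by (intro sum.cong refl) (auto simp: companion_const_def block_index_less)
  also have "\<dots> = (if b = 0 then \<Sum>b'<k. (Y (k - 1 - b') *\<^sub>v block_vec n z b') $ r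
      else - z $ ((b - 1) * n + r))"
  proof (cases "b = 0")
    case True
    have "(Y (k - 1 - b') *\<^sub>v block_vec n z b') $ r = (\<Sum>c<n. Y (k - 1 - b') $$ (r, c) * z $ (b' * n + c))"
      if "b' < k" for b'
    proof -
      have "Y (k - 1 - b') \<in> carrier_mat n n" using that by (intro Y) simp
      from mult_mat_vec_index_sum[OF this block_vec_carrier r] show ?thesis
        by (simp add: block_vec_def)
    qed
    with True show ?thesis by (simp del: index_mult_mat_vec)
  next
    case False
    have "(\<Sum>b'<k. \<Sum>c<n. (if b = 0 then Y (k - 1 - b') $$ (r, c)
      else if b = Suc b' \<and> r = c then - 1 else 0) * z $ (b' * n + c))
        = (\<Sum>b'<k. \<Sum>c<n. if b' = b - 1 \<and> c = r then - z $ ((b - 1) * n + r) else 0)"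
      using False by (intro sum.cong refl) auto
    also have "\<dots> = (\<Sum>b'<k. if b' = b - 1 then \<Sum>c<n. if c = r then - z $ ((b - 1) * n + r) else 0 else 0)"
      by (intro sum.cong refl) auto
    also have "\<dots> = - z $ ((b - 1) * n + r)" using b r by simp
    finally show ?thesis using False by simp
  qed
  finally show ?thesis .
qed

text \<open>In block form, \<open>Xz\<^sub>1 = 0\<close> says that \<open>z\<^sub>1 = (v, 0, \<dots>, 0)\<close> with \<open>Y\<^sub>kv = 0\<close>, and then
  \<open>Yz\<^sub>1 = (Y\<^sub>k\<^sub>-\<^sub>1v, -v, 0, \<dots>, 0)\<close> (just \<open>Y\<^sub>0v\<close> if \<open>k = 1\<close>); the first block of \<open>Xz\<^sub>2 = Yz\<^sub>1\<close> is the range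
  condition.\<close>

lemma companion_chainD:
  assumes k: "k \<ge> 1" and Y: "\<And>i. i \<le> k \<Longrightarrow> Y i \<in> carrier_mat n n"
    and z: "z1 \<in> carrier_vec (k * n)" "z2 \<in> carrier_vec (k * n)"
    and 1: "companion_lead n k Y *\<^sub>v z1 = 0\<^sub>v (k * n)"
    and 2: "companion_lead n k Y *\<^sub>v z2 = companion_const n k Y *\<^sub>v z1"
    and 3: "companion_const n k Y *\<^sub>v z1 \<noteq> 0\<^sub>v (k * n)"
  shows "\<exists>v\<in>carrier_vec n. \<exists>w\<in>carrier_vec n. v \<noteq> 0\<^sub>v n \<and> Y k *\<^sub>v v = 0\<^sub>v n \<and>
    Y k *\<^sub>v w = Y (k - 1) *\<^sub>v v \<and> (k = 1 \<longrightarrow> Y 0 *\<^sub>v v \<noteq> 0\<^sub>v n)"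
proof -
  let ?v = "block_vec n z1 0" and ?w = "block_vec n z2 0"
  have Y': "\<And>i. i < k \<Longrightarrow> Y i \<in> carrier_mat n n" using Y by simp
  have Yk: "Y k \<in> carrier_mat n n" and Yk1: "Y (k - 1) \<in> carrier_mat n n" using Y by auto
  note lead = companion_lead_mult[where Y = Y and k = k, OF _ Yk]
  have rest: "z1 $ (b * n + r) = 0" if "0 < b" "b < k" "r < n" for b r
    using lead[OF z(1) that(2,3)] that block_index_less[OF that(2,3)] unfolding 1 by simp
  then have blk0: "block_vec n z1 b = 0\<^sub>v n" if "0 < b" "b < k" for b
    using that by (intro eq_vecI) (auto simp: block_vec_def)
  have const0: "(companion_const n k Y *\<^sub>v z1) $ (0 * n + r) = (Y (k - 1) *\<^sub>v ?v) $ r" if r: "r < n" for r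
  proof -
    have "(companion_const n k Y *\<^sub>v z1) $ (0 * n + r)
        = (\<Sum>b<k. (Y (k - 1 - b) *\<^sub>v block_vec n z1 b) $ r)"
      using companion_const_mult[where Y = Y and k = k and b = 0, OF z(1) Y' _ r] k by simp
    also have "\<dots> = (\<Sum>b<k. if b = 0 then (Y (k - 1) *\<^sub>v ?v) $ r else 0)"
    proof (intro sum.cong refl)
      fix b assume "b \<in> {..<k}"
      then have "Y (k - 1 - b) \<in> carrier_mat n n" using k by (intro Y) simp
      with \<open>b \<in> {..<k}\<close> show "(Y (k - 1 - b) *\<^sub>v block_vec n z1 b) $ r
        = (if b = 0 then (Y (k - 1) *\<^sub>v ?v) $ r else 0)"
        using r by (auto simp: blk0 simp del: index_mult_mat_vec)
    qed
    also have "\<dots> = (Y (k - 1) *\<^sub>v ?v) $ r" using k by simp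
    finally show ?thesis .
  qed
  have "0 < k" using k by simp
  have v0: "?v \<noteq> 0\<^sub>v n"
  proof
    assume v: "?v = 0\<^sub>v n"
    have "z1 = 0\<^sub>v (k * n)"
    proof (rule vec_eq_blocksI)
      fix b c assume bc: "b < k" "c < n"
      have "z1 $ (b * n + c) = 0"
      proof (cases "b = 0")
        case True
        have "?v $ c = 0" using v bc by simp
        with True bc show ?thesis by (simp add: block_vec_def)
      qed (use rest bc in simp)
      then show "z1 $ (b * n + c) = 0\<^sub>v (k * n) $ (b * n + c)"
        using block_index_less[OF bc] by simp
    qed (use z in auto)
    with 3 show False using mult_mat_zero_vec[OF companion_carrier(2)] by metis
  qed
  have Ykv: "Y k *\<^sub>v ?v = 0\<^sub>v n"
  proof (rule eq_vecI)
    fix r assume "r < dim_vec (0\<^sub>v n :: real vec)"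
    then have r: "r < n" by simp
    show "(Y k *\<^sub>v ?v) $ r = 0\<^sub>v n $ r"
      using lead[OF z(1) \<open>0 < k\<close> r] block_index_less[OF \<open>0 < k\<close> r] r unfolding 1
      by (simp del: index_mult_mat_vec)
  qed (use Yk in simp)
  have "Y k *\<^sub>v ?w = Y (k - 1) *\<^sub>v ?v"
  proof (rule eq_vecI)
    fix r assume "r < dim_vec (Y (k - 1) *\<^sub>v ?v)"
    then have r: "r < n" using Yk1 by simp
    show "(Y k *\<^sub>v ?w) $ r = (Y (k - 1) *\<^sub>v ?v) $ r"
      using lead[OF z(2) \<open>0 < k\<close> r] const0[OF r] unfolding 2 by (simp del: index_mult_mat_vec)
  qed (use Yk Yk1 in simp)
  moreover have "Y 0 *\<^sub>v ?v \<noteq> 0\<^sub>v n" if "k = 1"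
  proof
    assume "Y 0 *\<^sub>v ?v = 0\<^sub>v n"
    with that have *: "Y (k - 1) *\<^sub>v ?v = 0\<^sub>v n" by simp
    have "companion_const n k Y *\<^sub>v z1 = 0\<^sub>v (k * n)"
    proof (rule vec_eq_blocksI)
      fix b c assume bc: "b < k" "c < n"
      with that have b: "b = 0" by simp
      show "(companion_const n k Y *\<^sub>v z1) $ (b * n + c) = 0\<^sub>v (k * n) $ (b * n + c)"
        unfolding b const0[OF bc(2)] * using bc block_index_less[OF bc] b by simp
    qed (auto intro!: mult_mat_vec_carrier z)
    with 3 show False ..
  qed
  ultimately show ?thesis using v0 Ykv by (intro bexI[of _ ?v] bexI[of _ ?w]) auto
qed

text \<open>The chain is \<open>z\<^sub>1 = (v, 0, \<dots>, 0)\<close> and \<open>z\<^sub>2 = (w, -v, 0, \<dots>, 0)\<close>, where the entry \<open>-v\<close> is absent if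
  \<open>k = 1\<close>.\<close>

lemma companion_chainI:
  assumes k: "k \<ge> 1" and Y: "\<And>i. i \<le> k \<Longrightarrow> Y i \<in> carrier_mat n n"
    and v: "v \<in> carrier_vec n" "v \<noteq> 0\<^sub>v n" and w: "w \<in> carrier_vec n"
    and 1: "Y k *\<^sub>v v = 0\<^sub>v n" and 2: "Y k *\<^sub>v w = Y (k - 1) *\<^sub>v v"
  shows "\<exists>z1\<in>carrier_vec (k * n). \<exists>z2\<in>carrier_vec (k * n). z1 \<noteq> 0\<^sub>v (k * n) \<and>
    companion_lead n k Y *\<^sub>v z1 = 0\<^sub>v (k * n) \<and>
    companion_lead n k Y *\<^sub>v z2 = companion_const n k Y *\<^sub>v z1"
proof -
  \<comment> \<open>the position \<open>a mod n\<close> within block \<open>0\<close> is \<open>a\<close> itself\<close>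
  define z1 where "z1 = vec (k * n) (\<lambda>a. if a div n = 0 then v $ a else 0)"
  define z2 where "z2 = vec (k * n) (\<lambda>a. if a div n = 0 then w $ a
    else if a div n = 1 then - v $ (a mod n) else 0)"
  have z: "z1 \<in> carrier_vec (k * n)" "z2 \<in> carrier_vec (k * n)" by (auto simp: z1_def z2_def)
  have Y': "\<And>i. i < k \<Longrightarrow> Y i \<in> carrier_mat n n" using Y by simp
  have Yk: "Y k \<in> carrier_mat n n" and Yk1: "Y (k - 1) \<in> carrier_mat n n" using Y by auto
  have "0 < k" using k by simp
  have z1_idx: "z1 $ (b * n + c) = (if b = 0 then v $ c else 0)" if "b < k" "c < n" for b c
    using block_index_less[OF that] that by (simp add: z1_def)
  have z2_idx: "z2 $ (b * n + c) = (if b = 0 then w $ c else if b = 1 then - v $ c else 0)"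
    if "b < k" "c < n" for b c
    using block_index_less[OF that] that by (simp add: z2_def)
  have blk_z1: "block_vec n z1 b = (if b = 0 then v else 0\<^sub>v n)" if "b < k" for b
    using that v z1_idx[of 0] by (intro eq_vecI) (auto simp: block_vec_def z1_idx)
  have blk_z2: "block_vec n z2 0 = w"
    using \<open>0 < k\<close> w z2_idx[of 0] by (intro eq_vecI) (auto simp: block_vec_def)
  note lead = companion_lead_mult[where Y = Y and k = k, OF _ Yk]
  have "companion_lead n k Y *\<^sub>v z1 = 0\<^sub>v (k * n)"
  proof (rule vec_eq_blocksI)
    fix b c assume bc: "b < k" "c < n"
    show "(companion_lead n k Y *\<^sub>v z1) $ (b * n + c) = 0\<^sub>v (k * n) $ (b * n + c)"
      unfolding lead[OF z(1) bc] using bc block_index_less[OF bc] \<open>0 < k\<close>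
      by (simp add: blk_z1 1 z1_idx del: index_mult_mat_vec)
  qed (auto intro!: mult_mat_vec_carrier z)
  moreover have "companion_lead n k Y *\<^sub>v z2 = companion_const n k Y *\<^sub>v z1"
  proof (rule vec_eq_blocksI)
    fix b c assume bc: "b < k" "c < n"
    have "(\<Sum>b'<k. (Y (k - 1 - b') *\<^sub>v block_vec n z1 b') $ c)
        = (\<Sum>b'<k. if b' = 0 then (Y (k - 1) *\<^sub>v v) $ c else 0)"
    proof (intro sum.cong refl)
      fix b' assume b': "b' \<in> {..<k}"
      then have "Y (k - 1 - b') \<in> carrier_mat n n" using k by (intro Y) simp
      with b' show "(Y (k - 1 - b') *\<^sub>v block_vec n z1 b') $ c
        = (if b' = 0 then (Y (k - 1) *\<^sub>v v) $ c else 0)"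
        using bc by (auto simp: blk_z1 simp del: index_mult_mat_vec)
    qed
    also have "\<dots> = (Y (k - 1) *\<^sub>v v) $ c" using \<open>0 < k\<close> by simp
    finally have sum: "(\<Sum>b'<k. (Y (k - 1 - b') *\<^sub>v block_vec n z1 b') $ c) = (Y (k - 1) *\<^sub>v v) $ c" .
    have const: "(companion_const n k Y *\<^sub>v z1) $ (b * n + c)
        = (if b = 0 then (Y (k - 1) *\<^sub>v v) $ c else - z1 $ ((b - 1) * n + c))"
      unfolding sum[symmetric] by (rule companion_const_mult[OF z(1) _ bc]) (rule Y')
    show "(companion_lead n k Y *\<^sub>v z2) $ (b * n + c) = (companion_const n k Y *\<^sub>v z1) $ (b * n + c)"
      unfolding lead[OF z(2) bc] const blk_z2
      using bc z1_idx[of "b - 1" c] z2_idx[OF bc] by (simp add: 2 del: index_mult_mat_vec)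
  qed (auto intro!: mult_mat_vec_carrier z)
  moreover have "z1 \<noteq> 0\<^sub>v (k * n)"
  proof
    assume *: "z1 = 0\<^sub>v (k * n)"
    have "v = 0\<^sub>v n"
    proof (rule eq_vecI)
      fix c assume "c < dim_vec (0\<^sub>v n :: real vec)"
      then have c: "c < n" by simp
      show "v $ c = 0\<^sub>v n $ c"
        using z1_idx[OF \<open>0 < k\<close> c] block_index_less[OF \<open>0 < k\<close> c] c unfolding * by simp
    qed (use v in simp)
    with v(2) show False ..
  qed
  ultimately show ?thesis using z by blast
qed

text \<open>The lower block rows force all blocks of a kernel vector except the last one to be zero, and the
  first block row then reads \<open>Y\<^sub>0z\<^sub>k = 0\<close>.\<close>

lemma det_companion_const_nonzero:
  assumes k: "k \<ge> 1" and Y: "\<And>i. i < k \<Longrightarrow> Y i \<in> carrier_mat n n" and Y0: "det (Y 0) \<noteq> 0"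
  shows "det (companion_const n k Y) \<noteq> 0"
proof
  assume "det (companion_const n k Y) = 0"
  then obtain z where z: "z \<in> carrier_vec (k * n)" "z \<noteq> 0\<^sub>v (k * n)"
    and 0: "companion_const n k Y *\<^sub>v z = 0\<^sub>v (k * n)"
    using det_0_iff_vec_prod_zero[OF companion_carrier(2)] by blast
  have "0 < k" using k by simp
  have low: "z $ (b * n + c) = 0" if "b < k - 1" "c < n" for b c
  proof -
    have "Suc b < k" using that by simp
    from companion_const_mult[where Y = Y and k = k, OF z(1) Y this that(2)] block_index_less[OF this that(2)]
    show ?thesis unfolding 0 by simp
  qed
  let ?v = "block_vec n z (k - 1)"
  have blk0: "block_vec n z b = 0\<^sub>v n" if "b < k - 1" for b
    using low that by (intro eq_vecI) (auto simp: block_vec_def)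
  have "Y 0 *\<^sub>v ?v = 0\<^sub>v n"
  proof (rule eq_vecI)
    fix r assume "r < dim_vec (0\<^sub>v n :: real vec)"
    then have r: "r < n" by simp
    have "0 = (\<Sum>b<k. (Y (k - 1 - b) *\<^sub>v block_vec n z b) $ r)"
      using companion_const_mult[where Y = Y and k = k, OF z(1) Y \<open>0 < k\<close> r] block_index_less[OF \<open>0 < k\<close> r]
      unfolding 0 by simp
    also have "\<dots> = (\<Sum>b<k. if b = k - 1 then (Y 0 *\<^sub>v ?v) $ r else 0)"
    proof (intro sum.cong refl)
      fix b assume b: "b \<in> {..<k}"
      then have "Y (k - 1 - b) \<in> carrier_mat n n" using k by (intro Y) simp
      with b show "(Y (k - 1 - b) *\<^sub>v block_vec n z b) $ r = (if b = k - 1 then (Y 0 *\<^sub>v ?v) $ r else 0)"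
        using r by (auto simp: blk0 simp del: index_mult_mat_vec)
    qed
    also have "\<dots> = (Y 0 *\<^sub>v ?v) $ r" using k by simp
    finally show "(Y 0 *\<^sub>v ?v) $ r = 0\<^sub>v n $ r" using r by (simp del: index_mult_mat_vec)
  qed (use Y[OF \<open>0 < k\<close>] in simp)
  then have v0: "?v = 0\<^sub>v n"
    using Y0 det_0_iff_vec_prod_zero[OF Y[OF \<open>0 < k\<close>]] block_vec_carrier by blast
  have "z = 0\<^sub>v (k * n)"
  proof (rule vec_eq_blocksI)
    fix b c assume bc: "b < k" "c < n"
    have "z $ (b * n + c) = 0"
    proof (cases "b < k - 1")
      case False
      with bc have b: "b = k - 1" by simp
      have "?v $ c = 0" using v0 bc by simp
      with b bc show ?thesis by (simp add: block_vec_def)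
    qed (use low bc in simp)
    then show "z $ (b * n + c) = 0\<^sub>v (k * n) $ (b * n + c)" using block_index_less[OF bc] by simp
  qed (use z in auto)
  with z(2) show False ..
qed

section \<open>Singular structured polynomials\<close>

lemma zero_mat_mult_vec [simp]:
  "x \<in> carrier_vec n \<Longrightarrow> 0\<^sub>m m n *\<^sub>v x = 0\<^sub>v m" for x :: "'a :: semiring_0 vec"
  by (rule eq_vecI) auto

lemma str_tuplesD:
  assumes "(J, As) \<in> str_tuples n l"
  shows "J \<in> carrier_mat n n" "J\<^sup>T = - J" "length As = Suc l" "\<And>i. i \<le> l \<Longrightarrow> psd n (As ! i)"
  using assms by (auto simp: str_tuples_def)

lemma str_tuplesI:
  assumes "J \<in> carrier_mat n n" "J\<^sup>T = - J" "length As = Suc l" "\<And>i. i \<le> l \<Longrightarrow> psd n (As ! i)"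
  shows "(J, As) \<in> str_tuples n l"
  using assms by (auto simp: str_tuples_def in_set_conv_nth)

lemma str_poly_carrier [simp]: "str_poly n k j J As \<in> carrier_mat n n"
  by (simp add: str_poly_def)

lemma dim_str_poly [simp]:
  "dim_row (str_poly n k j J As) = n" "dim_col (str_poly n k j J As) = n"
  by (simp_all add: str_poly_def)

lemma coeff_str_poly:
  assumes "r < n" "c < n"
  shows "coeff (str_poly n k j J As $$ (r, c)) i =
    (if i \<le> k then (As ! i) $$ (r, c) else 0) - (if i = j then J $$ (r, c) else 0)"
proof -
  have "(\<Sum>x\<le>k. if x = i then (As ! x) $$ (r, c) else 0) = (if i \<le> k then (As ! i) $$ (r, c) else 0)"
    by (subst sum.delta) auto
  then show ?thesis
    using assms by (simp add: str_poly_def coeff_sum)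
qed

lemma str_poly_in_matpolys: "j \<le> k \<Longrightarrow> str_poly n k j J As \<in> matpolys n k"
  by (auto simp: matpolys_def coeff_str_poly intro!: degree_le)

lemma mp_coeff_str_poly:
  assumes "(J, As) \<in> str_tuples n k" "i \<le> k"
  shows "mp_coeff (str_poly n k j J As) i = dissipative_mat n (if i = j then J else 0\<^sub>m n n) {i} ((!) As)"
  using assms str_tuplesD[OF assms(1)]
  by (intro eq_matI) (auto simp: mp_coeff_def dissipative_mat_def coeff_str_poly)

lemma mp_eval_str_poly_1:
  "mp_eval (str_poly n k j J As) 1 = dissipative_mat n J {..k} ((!) As)"
  by (rule eq_matI) (auto simp: mp_eval_def dissipative_mat_def str_poly_def poly_monom poly_sum)

lemma mp_eval_0: "mp_eval P 0 = mp_coeff P 0"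
  by (simp add: mp_eval_def mp_coeff_def poly_0_coeff_0)

lemma det_mp_eval: "det (mp_eval P x) = poly (det P) x"
proof -
  have "comm_ring_hom (\<lambda>p :: real poly. poly p x)" by unfold_locales auto
  then show ?thesis unfolding mp_eval_def by (rule comm_ring_hom.hom_det)
qed

lemma common_kernel_nontrivial_iff:
  assumes "set Xs \<subseteq> carrier_mat n n" "Xs \<noteq> []"
  shows "common_kernel Xs \<noteq> {0\<^sub>v n} \<longleftrightarrow>
    (\<exists>v\<in>carrier_vec n. v \<noteq> 0\<^sub>v n \<and> (\<forall>X\<in>set Xs. X *\<^sub>v v = 0\<^sub>v n))"
proof -
  have "common_kernel Xs = {v \<in> carrier_vec n. \<forall>X\<in>set Xs. X *\<^sub>v v = 0\<^sub>v n}"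
    using assms by (cases Xs) (auto simp: common_kernel_def mat_kernel_def)
  moreover have "0\<^sub>v n \<in> {v \<in> carrier_vec n. \<forall>X\<in>set Xs. X *\<^sub>v v = 0\<^sub>v n}"
    using assms by auto
  ultimately show ?thesis by auto
qed

lemma str_tuple_common_kernel_iff:
  assumes t: "(J, As) \<in> str_tuples n k"
  shows "common_kernel (J # As) \<noteq> {0\<^sub>v n} \<longleftrightarrow>
    (\<exists>v\<in>carrier_vec n. v \<noteq> 0\<^sub>v n \<and> J *\<^sub>v v = 0\<^sub>v n \<and> (\<forall>i\<le>k. (As ! i) *\<^sub>v v = 0\<^sub>v n))"
proof -
  note T = str_tuplesD[OF t]
  have all: "(\<forall>X\<in>set As. Q X) \<longleftrightarrow> (\<forall>i\<le>k. Q (As ! i))" for Q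
    using T(3) by (simp add: all_set_conv_all_nth less_Suc_eq_le)
  have "\<forall>X\<in>set As. X \<in> carrier_mat n n" unfolding all using T(4) psd_carrier by blast
  then have "set (J # As) \<subseteq> carrier_mat n n" using T(1) by auto
  then show ?thesis by (simp add: common_kernel_nontrivial_iff all)
qed

lemma singular_matrix_eval_iff:
  assumes t: "(J, As) \<in> str_tuples n k"
  shows "singular_matrix (mp_eval (str_poly n k j J As) 1) \<longleftrightarrow> common_kernel (J # As) \<noteq> {0\<^sub>v n}"
proof -
  note T = str_tuplesD[OF t]
  have "common_kernel (J # As) \<noteq> {0\<^sub>v n} \<longleftrightarrow>
      (\<exists>v\<in>carrier_vec n. v \<noteq> 0\<^sub>v n \<and> J *\<^sub>v v = 0\<^sub>v n \<and> (\<forall>i\<in>{..k}. (As ! i) *\<^sub>v v = 0\<^sub>v n))"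
    unfolding str_tuple_common_kernel_iff[OF t] by (simp add: Ball_def)
  also have "\<dots> \<longleftrightarrow> det (dissipative_mat n J {..k} ((!) As)) = 0"
    using T by (intro det_dissipative_mat_eq_0_iff[symmetric]) auto
  finally show ?thesis by (simp add: singular_matrix_def mp_eval_str_poly_1)
qed

text \<open>A constant vector in the common kernel is annihilated by \<open>P(x)\<close> for all \<open>x\<close>, so \<open>det P\<close> has
  infinitely many zeros. The converse goes through \<open>P(1)\<close>.\<close>

lemma singular_mp_iff:
  assumes t: "(J, As) \<in> str_tuples n k" and "j \<le> k"
  shows "singular_mp (str_poly n k j J As) \<longleftrightarrow> common_kernel (J # As) \<noteq> {0\<^sub>v n}"
proof
  assume "singular_mp (str_poly n k j J As)"
  then have "singular_matrix (mp_eval (str_poly n k j J As) 1)"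
    by (simp add: singular_mp_def singular_matrix_def det_mp_eval)
  then show "common_kernel (J # As) \<noteq> {0\<^sub>v n}" by (simp add: singular_matrix_eval_iff[OF t])
next
  let ?P = "str_poly n k j J As"
  note T = str_tuplesD[OF t]
  assume "common_kernel (J # As) \<noteq> {0\<^sub>v n}"
  then obtain v where v: "v \<in> carrier_vec n" "v \<noteq> 0\<^sub>v n"
    and 0: "J *\<^sub>v v = 0\<^sub>v n" "\<And>i. i \<le> k \<Longrightarrow> (As ! i) *\<^sub>v v = 0\<^sub>v n"
    unfolding str_tuple_common_kernel_iff[OF t] by auto
  have "poly (det ?P) x = 0" for x
  proof -
    have "mp_eval ?P x *\<^sub>v v = 0\<^sub>v n"
    proof (rule eq_vecI)
      fix r assume "r < dim_vec (0\<^sub>v n :: real vec)"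
      then have r: "r < n" by simp
      have c: "mp_eval ?P x \<in> carrier_mat n n" by (simp add: mp_eval_def)
      have Ac: "\<And>i. i \<le> k \<Longrightarrow> As ! i \<in> carrier_mat n n" using T psd_carrier by blast
      have "(mp_eval ?P x *\<^sub>v v) $ r
        = (\<Sum>c<n. ((\<Sum>i\<le>k. (As ! i) $$ (r, c) * x ^ i) - J $$ (r, c) * x ^ j) * v $ c)"
        unfolding mult_mat_vec_index_sum[OF c v(1) r] using r
        by (intro sum.cong refl) (simp add: mp_eval_def str_poly_def poly_monom poly_sum)
      also have "\<dots> = (\<Sum>c<n. (\<Sum>i\<le>k. x ^ i * ((As ! i) $$ (r, c) * v $ c)) - x ^ j * (J $$ (r, c) * v $ c))"
        by (simp add: algebra_simps sum_distrib_left)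
      also have "\<dots> = (\<Sum>c<n. \<Sum>i\<le>k. x ^ i * ((As ! i) $$ (r, c) * v $ c))
          - x ^ j * (\<Sum>c<n. J $$ (r, c) * v $ c)"
        by (simp add: sum_subtractf sum_distrib_left)
      also have "(\<Sum>c<n. \<Sum>i\<le>k. x ^ i * ((As ! i) $$ (r, c) * v $ c))
          = (\<Sum>i\<le>k. x ^ i * (\<Sum>c<n. (As ! i) $$ (r, c) * v $ c))"
        unfolding sum_distrib_left by (rule sum.swap)
      also have "(\<Sum>c<n. J $$ (r, c) * v $ c) = 0"
        using mult_mat_vec_index_sum[OF T(1) v(1) r] 0(1) r by simp
      also have "(\<Sum>i\<le>k. x ^ i * (\<Sum>c<n. (As ! i) $$ (r, c) * v $ c)) = 0"
        using mult_mat_vec_index_sum[OF Ac v(1) r] 0(2) r by simp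
      finally show "(mp_eval ?P x *\<^sub>v v) $ r = 0\<^sub>v n $ r" using r by simp
    qed (simp add: mp_eval_def)
    moreover have "mp_eval ?P x \<in> carrier_mat n n" by (simp add: mp_eval_def)
    ultimately have "det (mp_eval ?P x) = 0"
      using v det_0_iff_vec_prod_zero by blast
    then show ?thesis by (simp add: det_mp_eval)
  qed
  then show "singular_mp ?P" unfolding singular_mp_def using poly_all_0_iff_0 by blast
qed

section \<open>The index of structured polynomials\<close>

lemma dissipative_mat_single:
  assumes "J \<in> carrier_mat n n" "A i \<in> carrier_mat n n"
  shows "dissipative_mat n J {i} A = A i - J"
  using assms by (intro eq_matI) (auto simp: dissipative_mat_def)

text \<open>Let \<open>Y\<^sub>kv = 0\<close> and \<open>Y\<^sub>kw = Y\<^sub>k\<^sub>-\<^sub>1v\<close>. The kernel lemma splits \<open>Y\<^sub>kv = 0\<close> into \<open>A\<^sub>kv = 0\<close> and, for \<open>j = k\<close>,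
  \<open>Jv = 0\<close>. Both matrices are symmetric up to sign, so \<open>v\<^sup>TY\<^sub>kw = 0\<close>, that is \<open>v\<^sup>TY\<^sub>k\<^sub>-\<^sub>1v = 0\<close>, which is
  \<open>v\<^sup>TA\<^sub>k\<^sub>-\<^sub>1v = 0\<close>. For \<open>k = 1\<close> the chain has \<open>Y\<^sub>0v \<noteq> 0\<close>, and only \<open>J\<close> can be responsible for this.\<close>

lemma mp_index_ge_2D:
  assumes t: "(J, As) \<in> str_tuples n k" and k: "k \<ge> 1" and j: "j \<le> k"
    and idx: "mp_index k (str_poly n k j J As) \<ge> 2"
  shows "\<exists>v\<in>carrier_vec n. v \<noteq> 0\<^sub>v n \<and> (As ! k) *\<^sub>v v = 0\<^sub>v n \<and> (As ! (k - 1)) *\<^sub>v v = 0\<^sub>v n \<and>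
    (j = k \<longrightarrow> J *\<^sub>v v = 0\<^sub>v n) \<and> (k = 1 \<longrightarrow> j = 0 \<and> J *\<^sub>v v \<noteq> 0\<^sub>v n)"
proof -
  let ?Y = "mp_coeff (str_poly n k j J As)" and ?J = "\<lambda>i. if i = j then J else 0\<^sub>m n n"
  note T = str_tuplesD[OF t]
  have Ac: "\<And>i. i \<le> k \<Longrightarrow> As ! i \<in> carrier_mat n n" using T psd_carrier by blast
  have Jc: "?J i \<in> carrier_mat n n" "(?J i)\<^sup>T = - ?J i" for i using T by auto
  have Yc: "?Y i \<in> carrier_mat n n" for i by (simp add: mp_coeff_def)
  have Y: "?Y i *\<^sub>v x = (As ! i) *\<^sub>v x - ?J i *\<^sub>v x" if "i \<le> k" "x \<in> carrier_vec n" for i x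
    unfolding mp_coeff_str_poly[OF t that(1)]
    using Jc(1)[of i] Ac[OF that(1)] that(2)
    by (simp only: dissipative_mat_single minus_mult_distrib_mat_vec)
  have "pencil_index (companion_lead n k ?Y) (companion_const n k ?Y) \<ge> 2"
    using idx by (simp add: mp_index_def str_poly_def)
  then obtain z1 z2 where "z1 \<in> carrier_vec (k * n)" "z2 \<in> carrier_vec (k * n)"
    "companion_lead n k ?Y *\<^sub>v z1 = 0\<^sub>v (k * n)"
    "companion_lead n k ?Y *\<^sub>v z2 = companion_const n k ?Y *\<^sub>v z1"
    "companion_const n k ?Y *\<^sub>v z1 \<noteq> 0\<^sub>v (k * n)"
    using pencil_index_ge_2_chain[OF companion_carrier] by blast
  from companion_chainD[OF k Yc this] obtain v w where
    v: "v \<in> carrier_vec n" "v \<noteq> 0\<^sub>v n" and w: "w \<in> carrier_vec n"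
    and 1: "?Y k *\<^sub>v v = 0\<^sub>v n" and 2: "?Y k *\<^sub>v w = ?Y (k - 1) *\<^sub>v v"
    and 3: "k = 1 \<Longrightarrow> ?Y 0 *\<^sub>v v \<noteq> 0\<^sub>v n" by blast
  have kern: "?J k *\<^sub>v v = 0\<^sub>v n" "(As ! k) *\<^sub>v v = 0\<^sub>v n"
    using 1 T(4) unfolding mp_coeff_str_poly[OF t le_refl]
    using dissipative_mat_kernel[OF Jc, of "{k}" "(!) As" v k] v by auto
  have "v \<bullet> ((As ! k) *\<^sub>v w) = 0"
    using scalar_prod_mult_mat_commute[OF Ac[OF le_refl] v(1) w] kern(2) w T(4)[of k]
    by (simp add: psd_def)
  moreover have "v \<bullet> (?J k *\<^sub>v w) = 0"
    using scalar_prod_mult_mat_commute[OF Jc(1)[of k] v(1) w] kern(1) w v Jc[of k]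
    by (auto simp: uminus_mult_mat_vec split: if_splits)
  ultimately have "v \<bullet> (?Y k *\<^sub>v w) = 0"
    unfolding Y[OF le_refl w]
    using v w Ac[of k] Jc(1)[of k] by (simp add: scalar_prod_minus_distrib[of _ n])
  then have "v \<bullet> ((As ! (k - 1)) *\<^sub>v v) - v \<bullet> (?J (k - 1) *\<^sub>v v) = 0"
    unfolding 2 Y[OF diff_le_self v(1)]
    using v Ac[of "k - 1"] Jc(1)[of "k - 1"] by (simp add: scalar_prod_minus_distrib[of _ n])
  then have "v \<bullet> ((As ! (k - 1)) *\<^sub>v v) = 0"
    using skew_quadratic_zero[OF Jc v(1)] by simp
  then have kern': "(As ! (k - 1)) *\<^sub>v v = 0\<^sub>v n"
    using psd_kernelI[OF T(4) v(1)] by simp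
  have "j = 0 \<and> J *\<^sub>v v \<noteq> 0\<^sub>v n" if "k = 1"
  proof -
    have "?Y 0 *\<^sub>v v = 0\<^sub>v n - ?J 0 *\<^sub>v v" using Y[of 0 v] v kern' that by simp
    with 3[OF that] have "?J 0 *\<^sub>v v \<noteq> 0\<^sub>v n" by auto
    then show ?thesis using v by (cases "j = 0") auto
  qed
  then show ?thesis using v kern kern' by (intro bexI[of _ v]) auto
qed

lemma higher_index_polysI:
  assumes t: "(J, As) \<in> str_tuples n k" and k: "k \<ge> 1"
    and Y0: "det (mp_coeff (str_poly n k j J As) 0) \<noteq> 0"
    and v: "v \<in> carrier_vec n" "v \<noteq> 0\<^sub>v n" and w: "w \<in> carrier_vec n"
    and 1: "mp_coeff (str_poly n k j J As) k *\<^sub>v v = 0\<^sub>v n"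
    and 2: "mp_coeff (str_poly n k j J As) k *\<^sub>v w = mp_coeff (str_poly n k j J As) (k - 1) *\<^sub>v v"
  shows "str_poly n k j J As \<in> higher_index_polys n k j"
proof -
  let ?P = "str_poly n k j J As"
  let ?Y = "mp_coeff ?P"
  have Yc: "?Y i \<in> carrier_mat n n" for i by (simp add: mp_coeff_def)
  obtain z1 z2 where "z1 \<in> carrier_vec (k * n)" "z2 \<in> carrier_vec (k * n)" "z1 \<noteq> 0\<^sub>v (k * n)"
    "companion_lead n k ?Y *\<^sub>v z1 = 0\<^sub>v (k * n)"
    "companion_lead n k ?Y *\<^sub>v z2 = companion_const n k ?Y *\<^sub>v z1"
    using companion_chainI[OF k Yc v w 1 2] by blast
  with det_companion_const_nonzero[of k ?Y n, OF k Yc Y0]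
  have "pencil_index (companion_lead n k ?Y) (companion_const n k ?Y) \<ge> 2"
    by (intro pencil_index_ge_2I[of _ "k * n"]) auto
  then have "mp_index k ?P > 1" by (simp add: mp_index_def str_poly_def)
  moreover have "\<not> singular_mp ?P"
    using Y0 by (auto simp: singular_mp_def det_mp_eval simp flip: mp_eval_0)
  ultimately show ?thesis using t by (auto simp: higher_index_polys_def str_polys_def)
qed

section \<open>Approximation by regular polynomials of higher index\<close>

text \<open>Solve with the positive definite matrix \<open>A + e\<bar>v\<bar>\<^sup>2I\<close> instead. The solution \<open>w\<close> is orthogonal to
  \<open>v\<close>, because \<open>u\<close> is and \<open>v\<^sup>TA = 0\<close>; on such vectors both matrices agree.\<close>

lemma psd_plus_gap_solve:
  assumes A: "psd n A" and v: "v \<in> carrier_vec n" "v \<noteq> 0\<^sub>v n" and Av: "A *\<^sub>v v = 0\<^sub>v n"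
    and e: "e > 0" and u: "u \<in> carrier_vec n" "v \<bullet> u = 0"
  shows "\<exists>w\<in>carrier_vec n. (A + e \<cdot>\<^sub>m gap_mat v) *\<^sub>v w = u"
proof -
  define a where "a = e * (v \<bullet> v)"
  have Ac: "A \<in> carrier_mat n n" and At: "A\<^sup>T = A" using A by (auto simp: psd_def)
  have "v \<bullet> v \<noteq> 0" using v real_scalar_prod_self_eq_0_iff by blast
  moreover have "v \<bullet> v \<ge> 0" by (auto simp: scalar_prod_def intro!: sum_nonneg)
  ultimately have a: "a > 0" using e by (simp add: a_def)
  let ?B = "A + a \<cdot>\<^sub>m 1\<^sub>m n"
  have B: "?B \<in> carrier_mat n n" using Ac by simp
  have Bmult: "?B *\<^sub>v x = A *\<^sub>v x + a \<cdot>\<^sub>v x" if "x \<in> carrier_vec n" for x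
    using that Ac by (simp add: add_mult_distrib_mat_vec[of _ n n] smult_mat_mult_vec[of _ n n])
  have "det ?B \<noteq> 0"
  proof
    assume "det ?B = 0"
    then obtain x where x: "x \<in> carrier_vec n" "x \<noteq> 0\<^sub>v n" "?B *\<^sub>v x = 0\<^sub>v n"
      using det_0_iff_vec_prod_zero[OF B] by blast
    have "0 = x \<bullet> (?B *\<^sub>v x)" using x by simp
    also have "\<dots> = x \<bullet> (A *\<^sub>v x) + a * (x \<bullet> x)"
      unfolding Bmult[OF x(1)] using x Ac by (simp add: scalar_prod_add_distrib[of _ n])
    finally have *: "x \<bullet> (A *\<^sub>v x) + a * (x \<bullet> x) = 0" by simp
    have "x \<bullet> (A *\<^sub>v x) \<ge> 0" using A x by (auto simp: psd_def)
    moreover have "x \<bullet> x > 0"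
    proof -
      have "x \<bullet> x \<noteq> 0" using x real_scalar_prod_self_eq_0_iff by blast
      moreover have "x \<bullet> x \<ge> 0" by (auto simp: scalar_prod_def intro!: sum_nonneg)
      ultimately show ?thesis by simp
    qed
    then have "a * (x \<bullet> x) > 0" using a by simp
    ultimately show False using * by simp
  qed
  from det_non_zero_imp_unit[OF B this, of "()"] obtain B' where
    B': "B' \<in> carrier_mat n n" "?B * B' = 1\<^sub>m n"
    by (auto simp: Units_def ring_mat_simps)
  define w where "w = B' *\<^sub>v u"
  have w: "w \<in> carrier_vec n" using B' u by (simp add: w_def)
  have Bw: "?B *\<^sub>v w = u"
    unfolding w_def using assoc_mult_mat_vec[OF B B'(1) u(1)] B'(2) u(1) by simp
  have "0 = v \<bullet> (?B *\<^sub>v w)" using u Bw by simp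
  also have "\<dots> = v \<bullet> (A *\<^sub>v w) + a * (v \<bullet> w)"
    unfolding Bmult[OF w] using v w Ac by (simp add: scalar_prod_add_distrib[of _ n])
  also have "v \<bullet> (A *\<^sub>v w) = 0"
    using scalar_prod_mult_mat_commute[OF Ac v(1) w] Av At w by simp
  finally have vw: "v \<bullet> w = 0" using a by simp
  have G: "gap_mat v \<in> carrier_mat n n" using psd_carrier[OF psd_gap_mat[OF v(1)]] .
  have "gap_mat v *\<^sub>v w = (v \<bullet> v) \<cdot>\<^sub>v w"
    unfolding gap_mat_mult_vec[OF v(1) w] vw using v w by auto
  then have "(A + e \<cdot>\<^sub>m gap_mat v) *\<^sub>v w = A *\<^sub>v w + a \<cdot>\<^sub>v w"
    using Ac G w by (simp add: add_mult_distrib_mat_vec[of _ n n] smult_mat_mult_vec[of _ n n]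
        smult_smult_assoc a_def)
  then have "(A + e \<cdot>\<^sub>m gap_mat v) *\<^sub>v w = u" using Bmult[OF w] Bw by simp
  then show ?thesis using w by blast
qed

lemma exists_skew_nonzero_mult:
  fixes v :: "real vec"
  assumes v: "v \<in> carrier_vec n" "v \<noteq> 0\<^sub>v n" and n: "n \<ge> 2"
  shows "\<exists>J\<in>carrier_mat n n. J\<^sup>T = - J \<and> J *\<^sub>v v \<noteq> 0\<^sub>v n"
proof -
  obtain p where p: "p < n" "v $ p \<noteq> 0" using v by (auto simp: vec_eq_iff)
  define q :: nat where "q = (if p = 0 then 1 else 0)"
  have q: "q < n" "q \<noteq> p" using n by (auto simp: q_def)
  define J :: "real mat" where
    "J = mat n n (\<lambda>(r, c). if r = q \<and> c = p then 1 else if r = p \<and> c = q then - 1 else 0)"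
  have J: "J \<in> carrier_mat n n" by (simp add: J_def)
  have "J\<^sup>T = - J" by (rule eq_matI) (use q in \<open>auto simp: J_def\<close>)
  moreover have "J *\<^sub>v v \<noteq> 0\<^sub>v n"
  proof
    assume "J *\<^sub>v v = 0\<^sub>v n"
    then have "0 = (\<Sum>c<n. J $$ (q, c) * v $ c)"
      using mult_mat_vec_index_sum[OF J v(1) q(1)] q by simp
    also have "\<dots> = (\<Sum>c<n. if c = p then v $ p else 0)"
      using q by (intro sum.cong refl) (auto simp: J_def)
    also have "\<dots> = v $ p" using p by simp
    finally show False using p by simp
  qed
  ultimately show ?thesis using J by blast
qed

lemma skew_index:
  fixes J :: "real mat"
  assumes "J \<in> carrier_mat n n" "J\<^sup>T = - J" "r < n" "c < n"
  shows "J $$ (c, r) = - J $$ (r, c)"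
proof -
  have "J\<^sup>T $$ (r, c) = (- J) $$ (r, c)" using assms by simp
  then show ?thesis using assms(1,3,4) by simp
qed

lemma skew_add_smult:
  fixes J K :: "real mat"
  assumes "J \<in> carrier_mat n n" "J\<^sup>T = - J" "K \<in> carrier_mat n n" "K\<^sup>T = - K"
  shows "(J + e \<cdot>\<^sub>m K)\<^sup>T = - (J + e \<cdot>\<^sub>m K)"
proof (rule eq_matI)
  fix r c assume "r < dim_row (- (J + e \<cdot>\<^sub>m K))" "c < dim_col (- (J + e \<cdot>\<^sub>m K))"
  then have "r < n" "c < n" using assms by auto
  then show "(J + e \<cdot>\<^sub>m K)\<^sup>T $$ (r, c) = (- (J + e \<cdot>\<^sub>m K)) $$ (r, c)"
    using assms skew_index[of J n r c] skew_index[of K n r c] by simp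
qed (use assms in auto)

definition move_along :: "real mat list \<Rightarrow> real \<Rightarrow> real mat list \<Rightarrow> real mat list" where
  "move_along As e Es = map2 (\<lambda>A E. A + e \<cdot>\<^sub>m E) As Es"

lemma move_along_nth:
  "i < length As \<Longrightarrow> i < length Es \<Longrightarrow> move_along As e Es ! i = As ! i + e \<cdot>\<^sub>m Es ! i"
  by (simp add: move_along_def)

lemma str_tuples_move:
  assumes t: "(J, As) \<in> str_tuples n l" and s: "(K, Es) \<in> str_tuples n l" and e: "e \<ge> 0"
  shows "(J + e \<cdot>\<^sub>m K, move_along As e Es) \<in> str_tuples n l"
proof (rule str_tuplesI)
  note T = str_tuplesD[OF t] and S = str_tuplesD[OF s]
  show "(J + e \<cdot>\<^sub>m K)\<^sup>T = - (J + e \<cdot>\<^sub>m K)" using T S by (intro skew_add_smult)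
  show "psd n (move_along As e Es ! i)" if "i \<le> l" for i
    using T S e that by (simp add: move_along_nth psd_add psd_smult)
qed (use str_tuplesD[OF t] str_tuplesD[OF s] in \<open>auto simp: move_along_def\<close>)

lemma psd_add_kernel:
  assumes A: "psd n A" and B: "psd n B" and x: "x \<in> carrier_vec n" and 0: "(A + B) *\<^sub>v x = 0\<^sub>v n"
  shows "B *\<^sub>v x = 0\<^sub>v n"
proof -
  have c: "A \<in> carrier_mat n n" "B \<in> carrier_mat n n" using A B by (simp_all add: psd_carrier)
  have "x \<bullet> ((A + B) *\<^sub>v x) = 0" using 0 x by simp
  then have "x \<bullet> (A *\<^sub>v x) + x \<bullet> (B *\<^sub>v x) = 0"
    using c x by (simp add: add_mult_distrib_mat_vec[of _ n n] scalar_prod_add_distrib[of _ n])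
  moreover have "x \<bullet> (A *\<^sub>v x) \<ge> 0" "x \<bullet> (B *\<^sub>v x) \<ge> 0" using A B x by (auto simp: psd_def)
  ultimately have "x \<bullet> (B *\<^sub>v x) = 0" by linarith
  with B x show ?thesis by (rule psd_kernelI)
qed

lemma smult_vec_eq_0D:
  fixes x :: "'a :: idom vec"
  assumes "a \<cdot>\<^sub>v x = 0\<^sub>v n" "a \<noteq> 0" "x \<in> carrier_vec n"
  shows "x = 0\<^sub>v n"
proof (rule eq_vecI)
  fix i assume "i < dim_vec (0\<^sub>v n :: 'a vec)"
  then have i: "i < n" by simp
  have "(a \<cdot>\<^sub>v x) $ i = 0" using assms(1) i by simp
  then show "x $ i = 0\<^sub>v n $ i" using i assms(2,3) by simp
qed (use assms in simp)

text \<open>Adding multiples of \<open>gap_mat v\<close> to \<open>A\<^sub>k\<close> keeps \<open>A\<^sub>kv = 0\<close> and makes the range of \<open>A\<^sub>k\<close> all of the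
  orthogonal complement of \<open>v\<close>. For \<open>j < k\<close> this range contains \<open>Y\<^sub>k\<^sub>-\<^sub>1v\<close>, which is \<open>0\<close> or \<open>-Jv\<close> and so
  orthogonal to \<open>v\<close>; for
  \<open>j = k\<close> the vector \<open>Y\<^sub>k\<^sub>-\<^sub>1v\<close> is zero anyway. So the chain exists along the whole ray.

  It remains to make \<open>Y\<^sub>0\<close> invertible. For \<open>k \<ge> 2\<close> the matrix \<open>A\<^sub>0\<close> is pushed in the direction \<open>I\<close>, which
  makes it positive definite; if \<open>A\<^sub>0\<close> were \<open>A\<^sub>k\<^sub>-\<^sub>1\<close> this would destroy the chain, but that happens only for
  \<open>k = 1\<close>. In that case \<open>A\<^sub>0\<close> is pushed along \<open>gap_mat v\<close>, so that its kernel becomes the line of \<open>v\<close>, and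
  \<open>J\<close> is moved, if necessary, such that \<open>Jv \<noteq> 0\<close>.\<close>

lemma exists_higher_index_direction:
  assumes t: "(J, As) \<in> str_tuples n k" and k: "k \<ge> 1" and j: "j \<le> k"
    and v: "v \<in> carrier_vec n" "v \<noteq> 0\<^sub>v n"
    and Av: "(As ! k) *\<^sub>v v = 0\<^sub>v n" "(As ! (k - 1)) *\<^sub>v v = 0\<^sub>v n"
    and Jv: "j = k \<Longrightarrow> J *\<^sub>v v = 0\<^sub>v n" and k1: "k = 1 \<Longrightarrow> j = 0 \<and> n \<ge> 2"
  shows "\<exists>K Es. (K, Es) \<in> str_tuples n k \<and>
    (\<forall>e>0. str_poly n k j (J + e \<cdot>\<^sub>m K) (move_along As e Es) \<in> higher_index_polys n k j)"
proof -
  let ?G = "gap_mat v"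
  have G: "psd n ?G" "?G \<in> carrier_mat n n" using psd_gap_mat[OF v(1)] by (simp_all add: psd_carrier)
  note T = str_tuplesD[OF t]
  define E where "E i = (if i = k then ?G else if i = 0 then (if k = 1 then ?G else 1\<^sub>m n) else 0\<^sub>m n n)" for i
  have E: "psd n (E i)" for i using G psd_one psd_zero by (simp add: E_def)
  define Es where "Es = map E [0..<Suc k]"
  obtain K where K: "K \<in> carrier_mat n n" "K\<^sup>T = - K"
    and K1: "k \<noteq> 1 \<Longrightarrow> K = 0\<^sub>m n n" and K2: "k = 1 \<Longrightarrow> e > 0 \<Longrightarrow> J *\<^sub>v v + e \<cdot>\<^sub>v (K *\<^sub>v v) \<noteq> 0\<^sub>v n" for e
  proof (cases "k \<noteq> 1 \<or> J *\<^sub>v v \<noteq> 0\<^sub>v n")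
    case True
    have "J *\<^sub>v v + e \<cdot>\<^sub>v (0\<^sub>m n n *\<^sub>v v) = J *\<^sub>v v" for e
      using T(1) v by (intro eq_vecI) auto
    with True show ?thesis by (intro that[of "0\<^sub>m n n"]) auto
  next
    case False
    then obtain K where K: "K \<in> carrier_mat n n" "K\<^sup>T = - K" "K *\<^sub>v v \<noteq> 0\<^sub>v n"
      using exists_skew_nonzero_mult[OF v] k1 by auto
    have Kv: "K *\<^sub>v v \<in> carrier_vec n" using K(1) v(1) by (rule mult_mat_vec_carrier)
    have "J *\<^sub>v v + e \<cdot>\<^sub>v (K *\<^sub>v v) \<noteq> 0\<^sub>v n" if "e > 0" for e
    proof
      assume "J *\<^sub>v v + e \<cdot>\<^sub>v (K *\<^sub>v v) = 0\<^sub>v n"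
      then have "e \<cdot>\<^sub>v (K *\<^sub>v v) = 0\<^sub>v n" using False Kv by simp
      then show False using smult_vec_eq_0D[OF _ _ Kv] that K(3) by auto
    qed
    with False K show ?thesis by (intro that[of K]) auto
  qed
  have s: "(K, Es) \<in> str_tuples n k"
    by (rule str_tuplesI) (use K E in \<open>auto simp: Es_def simp del: upt_Suc\<close>)
  have "str_poly n k j (J + e \<cdot>\<^sub>m K) (move_along As e Es) \<in> higher_index_polys n k j" if e: "e > 0" for e
  proof -
    define J' where "J' = J + e \<cdot>\<^sub>m K"
    define As' where "As' = move_along As e Es"
    have t': "(J', As') \<in> str_tuples n k"
      unfolding J'_def As'_def using e by (intro str_tuples_move t s) simp
    note T' = str_tuplesD[OF t']
    have As': "As' ! i = As ! i + e \<cdot>\<^sub>m E i" if "i \<le> k" for i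
      unfolding As'_def using that T(3) by (simp add: move_along_nth Es_def del: upt_Suc)
    have Ac: "As ! i \<in> carrier_mat n n" if "i \<le> k" for i using T(4) that psd_carrier by blast
    have Ac': "As' ! i \<in> carrier_mat n n" if "i \<le> k" for i using T'(4) that psd_carrier by blast
    have Ec: "E i \<in> carrier_mat n n" for i using E psd_carrier by blast
    have eE: "psd n (e \<cdot>\<^sub>m E i)" for i using E e by (intro psd_smult) auto
    have As'v: "(As' ! i) *\<^sub>v x = (As ! i) *\<^sub>v x + e \<cdot>\<^sub>v (E i *\<^sub>v x)"
      if "i \<le> k" "x \<in> carrier_vec n" for i x
      unfolding As'[OF that(1)] using Ac[OF that(1)] Ec[of i] that(2)
      by (simp add: add_mult_distrib_mat_vec[of _ n n] smult_mat_mult_vec[of _ n n])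
    have J'v: "J' *\<^sub>v x = J *\<^sub>v x + e \<cdot>\<^sub>v (K *\<^sub>v x)" if "x \<in> carrier_vec n" for x
      unfolding J'_def using T(1) K(1) that
      by (simp add: add_mult_distrib_mat_vec[of _ n n] smult_mat_mult_vec[of _ n n])
    have Gv: "?G *\<^sub>v v = 0\<^sub>v n" using v(1) by (rule gap_mat_self)
    have "e \<cdot>\<^sub>v 0\<^sub>v n = (0\<^sub>v n :: real vec)" by (rule eq_vecI) auto
    then have ker: "(As' ! k) *\<^sub>v v = 0\<^sub>v n" "(As' ! (k - 1)) *\<^sub>v v = 0\<^sub>v n"
      using As'v[OF le_refl v(1)] As'v[OF diff_le_self v(1)] Av Gv k v(1) by (auto simp: E_def)
    let ?P = "str_poly n k j J' As'" and ?J = "\<lambda>i. if i = j then J' else 0\<^sub>m n n"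
    have Jc: "?J i \<in> carrier_mat n n" "(?J i)\<^sup>T = - ?J i" for i using T' by auto
    have Y: "mp_coeff ?P i *\<^sub>v x = (As' ! i) *\<^sub>v x - ?J i *\<^sub>v x" if "i \<le> k" "x \<in> carrier_vec n" for i x
      unfolding mp_coeff_str_poly[OF t' that(1)]
      using Jc(1)[of i] Ac'[OF that(1)] that(2)
      by (simp only: dissipative_mat_single minus_mult_distrib_mat_vec)
    have Jk: "?J k *\<^sub>v v = 0\<^sub>v n"
    proof (cases "j = k")
      case True
      with k1 k have "k \<noteq> 1" by auto
      with True show ?thesis
        using J'v[OF v(1)] Jv K1 \<open>e \<cdot>\<^sub>v 0\<^sub>v n = 0\<^sub>v n\<close> v(1) by simp
    qed (use v in simp)
    have 1: "mp_coeff ?P k *\<^sub>v v = 0\<^sub>v n" unfolding Y[OF le_refl v(1)] ker Jk by auto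
    let ?u = "mp_coeff ?P (k - 1) *\<^sub>v v"
    have "?J (k - 1) *\<^sub>v v \<in> carrier_vec n" by (intro mult_mat_vec_carrier[of _ n n] Jc v)
    then have u: "?u = - (?J (k - 1) *\<^sub>v v)" "?u \<in> carrier_vec n"
      unfolding Y[OF diff_le_self v(1)] ker by (auto intro!: eq_vecI)
    \<comment> \<open>the second chain vector\<close>
    have "\<exists>w\<in>carrier_vec n. mp_coeff ?P k *\<^sub>v w = ?u"
    proof (cases "j = k")
      case True
      with k have "?u = 0\<^sub>v n" using u(1) v(1) by (auto intro!: eq_vecI)
      moreover have "mp_coeff ?P k \<in> carrier_mat n n" by (simp add: mp_coeff_def)
      ultimately show ?thesis by (intro bexI[of _ "0\<^sub>v n"]) auto
    next
      case False
      have "v \<bullet> ?u = 0"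
        unfolding u(1) using skew_quadratic_zero[OF Jc v(1), of "k - 1"]
          T'(1) v(1) by (cases "k - 1 = j") auto
      from psd_plus_gap_solve[OF T(4)[OF le_refl] v Av(1) e u(2) this]
      obtain w where w: "w \<in> carrier_vec n" "(As ! k + e \<cdot>\<^sub>m ?G) *\<^sub>v w = ?u" by blast
      have "(As' ! k) *\<^sub>v w = ?u" using w(2) by (simp add: As' E_def)
      moreover have "?J k *\<^sub>v w = 0\<^sub>v n" using False w by simp
      ultimately have "mp_coeff ?P k *\<^sub>v w = ?u" unfolding Y[OF le_refl w(1)] using u(2) by simp
      then show ?thesis using w by blast
    qed
    then obtain w where w: "w \<in> carrier_vec n" and 2: "mp_coeff ?P k *\<^sub>v w = ?u" by blast
    have "det (mp_coeff ?P 0) \<noteq> 0"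
    proof
      assume "det (mp_coeff ?P 0) = 0"
      then obtain x where x: "x \<in> carrier_vec n" "x \<noteq> 0\<^sub>v n"
        and Jx: "?J 0 *\<^sub>v x = 0\<^sub>v n" and Ax: "(As' ! 0) *\<^sub>v x = 0\<^sub>v n"
        unfolding mp_coeff_str_poly[OF t' le0]
        using det_dissipative_mat_eq_0_iff[OF Jc, of "{0}" "(!) As'" 0] T'(4) by auto
      have "(e \<cdot>\<^sub>m E 0) *\<^sub>v x = 0\<^sub>v n"
        using psd_add_kernel[OF T(4)[OF le0] eE[of 0] x(1)] Ax As'[OF le0] by simp
      then have "e \<cdot>\<^sub>v (E 0 *\<^sub>v x) = 0\<^sub>v n" using Ec x by (simp add: smult_mat_mult_vec[of _ n n])
      moreover have "E 0 *\<^sub>v x \<in> carrier_vec n" using Ec x(1) by (rule mult_mat_vec_carrier)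
      ultimately have E0x: "E 0 *\<^sub>v x = 0\<^sub>v n" using smult_vec_eq_0D e by blast
      show False
      proof (cases "k = 1")
        case False
        then show ?thesis using E0x x k by (simp add: E_def)
      next
        case True
        then have J'x: "J' *\<^sub>v x = 0\<^sub>v n" using Jx k1 by simp
        have J'v0: "J' *\<^sub>v v \<noteq> 0\<^sub>v n" unfolding J'v[OF v(1)] using K2[OF True e] .
        have eq: "(v \<bullet> v) \<cdot>\<^sub>v x - (v \<bullet> x) \<cdot>\<^sub>v v = 0\<^sub>v n"
          using E0x True by (simp add: E_def gap_mat_mult_vec[OF v(1) x(1)])
        have "J' *\<^sub>v ((v \<bullet> v) \<cdot>\<^sub>v x - (v \<bullet> x) \<cdot>\<^sub>v v)
            = (v \<bullet> v) \<cdot>\<^sub>v (J' *\<^sub>v x) - (v \<bullet> x) \<cdot>\<^sub>v (J' *\<^sub>v v)"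
          using T'(1) v x by (simp add: mult_minus_distrib_mat_vec[of _ n n] mult_mat_vec[of _ n n])
        also have "J' *\<^sub>v ((v \<bullet> v) \<cdot>\<^sub>v x - (v \<bullet> x) \<cdot>\<^sub>v v) = 0\<^sub>v n"
          unfolding eq using T'(1) by (rule mult_mat_zero_vec)
        finally have z: "0\<^sub>v n = (v \<bullet> v) \<cdot>\<^sub>v (0\<^sub>v n :: real vec) - (v \<bullet> x) \<cdot>\<^sub>v (J' *\<^sub>v v)"
          unfolding J'x .
        have J'vc: "J' *\<^sub>v v \<in> carrier_vec n" using T'(1) v(1) by (rule mult_mat_vec_carrier)
        have "(v \<bullet> x) \<cdot>\<^sub>v (J' *\<^sub>v v) = 0\<^sub>v n"
        proof (rule eq_vecI)
          fix i assume "i < dim_vec (0\<^sub>v n :: real vec)"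
          then have i: "i < n" by simp
          have "(0\<^sub>v n :: real vec) $ i = ((v \<bullet> v) \<cdot>\<^sub>v (0\<^sub>v n :: real vec) - (v \<bullet> x) \<cdot>\<^sub>v (J' *\<^sub>v v)) $ i"
            using z by simp
          then show "((v \<bullet> x) \<cdot>\<^sub>v (J' *\<^sub>v v)) $ i = 0\<^sub>v n $ i"
            using i T'(1) by (simp del: index_mult_mat_vec)
        qed (use T'(1) in simp)
        then have "v \<bullet> x = 0" using smult_vec_eq_0D[OF _ _ J'vc] J'v0 by blast
        then have "(v \<bullet> v) \<cdot>\<^sub>v x = 0\<^sub>v n" using eq v x by (auto simp: vec_eq_iff)
        moreover have "v \<bullet> v \<noteq> 0" using v real_scalar_prod_self_eq_0_iff by blast
        ultimately show False using smult_vec_eq_0D[OF _ _ x(1)] x(2) by blast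
      qed
    qed
    from higher_index_polysI[OF t' k this v w 1 2] show ?thesis
      unfolding J'_def As'_def .
  qed
  with s show ?thesis by blast
qed

section \<open>The closure of the higher index polynomials\<close>

lemma topspace_coeff_topology [simp]: "topspace (coeff_topology n k) = matpolys n k"
  by (auto simp: coeff_topology_def topspace_pullback_topology)

lemma continuous_map_coeff:
  assumes "i \<le> k" "r < n" "c < n"
  shows "continuous_map (coeff_topology n k) euclideanreal (\<lambda>P. coeff (P $$ (r, c)) i)"
proof -
  let ?I = "{..k} \<times> {..<n} \<times> {..<n}"
  let ?f = "\<lambda>P :: real poly mat. \<lambda>(i, r, c) \<in> ?I. coeff (P $$ (r, c)) i"
  have "continuous_map (product_topology (\<lambda>_. euclideanreal) ?I) euclideanreal (\<lambda>x. x (i, r, c))"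
    using assms by (intro continuous_map_product_projection) auto
  then have "continuous_map (coeff_topology n k) euclideanreal ((\<lambda>x. x (i, r, c)) \<circ> ?f)"
    unfolding coeff_topology_def by (rule continuous_map_pullback)
  then show ?thesis using assms by (simp add: o_def)
qed

lemma continuous_map_into_coeff_topology:
  assumes "\<And>x. x \<in> topspace X \<Longrightarrow> g x \<in> matpolys n k"
    and "\<And>i r c. i \<le> k \<Longrightarrow> r < n \<Longrightarrow> c < n \<Longrightarrow>
      continuous_map X euclideanreal (\<lambda>x. coeff (g x $$ (r, c)) i)"
  shows "continuous_map X (coeff_topology n k) g"
  unfolding coeff_topology_def
proof (rule continuous_map_pullback')
  show "continuous_map X (product_topology (\<lambda>_. euclideanreal) ({..k} \<times> {..<n} \<times> {..<n}))
    ((\<lambda>P. \<lambda>(i, r, c) \<in> {..k} \<times> {..<n} \<times> {..<n}. coeff (P $$ (r, c)) i) \<circ> g)"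
    using assms(2) by (auto simp: continuous_map_componentwise o_def)
qed (use assms(1) in auto)

text \<open>By the Leibniz formula the determinant is a polynomial in the entries.\<close>

lemma continuous_map_det:
  assumes "\<And>r c. r < n \<Longrightarrow> c < n \<Longrightarrow> continuous_map X euclideanreal (\<lambda>x. f x r c)"
  shows "continuous_map X euclideanreal (\<lambda>x. det (mat n n (\<lambda>(r, c). f x r c)))"
proof -
  have "det (mat n n (\<lambda>(r, c). f x r c))
      = (\<Sum>p\<in>{p. p permutes {0..<n}}. signof p * (\<Prod>i = 0..<n. f x i (p i)))" for x
    by (subst det_def'[of _ n]) (auto intro!: sum.cong prod.cong)
  moreover have "continuous_map X euclideanreal
      (\<lambda>x. \<Sum>p\<in>{p. p permutes {0..<n}}. signof p * (\<Prod>i = 0..<n. f x i (p i)))"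
    by (intro continuous_map_sum continuous_map_real_mult continuous_map_prod assms)
      (auto simp: finite_permutations permutes_in_image)
  ultimately show ?thesis by simp
qed

text \<open>The condition that describes the closure, in a form common to \<open>j < k\<close> and \<open>j = k\<close>.\<close>

definition lead_kernel :: "nat \<Rightarrow> nat \<Rightarrow> nat \<Rightarrow> real mat \<Rightarrow> real mat list \<Rightarrow> bool" where
  "lead_kernel n k j J As \<longleftrightarrow> (\<exists>v\<in>carrier_vec n. v \<noteq> 0\<^sub>v n \<and>
     (As ! k) *\<^sub>v v = 0\<^sub>v n \<and> (As ! (k - 1)) *\<^sub>v v = 0\<^sub>v n \<and> (j = k \<longrightarrow> J *\<^sub>v v = 0\<^sub>v n))"

lemma common_kernel_lead_iff:
  assumes t: "(J, As) \<in> str_tuples n k"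
  shows "j \<noteq> k \<Longrightarrow> common_kernel [As ! k, As ! (k - 1)] \<noteq> {0\<^sub>v n} \<longleftrightarrow> lead_kernel n k j J As"
    and "j = k \<Longrightarrow> common_kernel [J, As ! k, As ! (k - 1)] \<noteq> {0\<^sub>v n} \<longleftrightarrow> lead_kernel n k j J As"
proof -
  have c: "J \<in> carrier_mat n n" "As ! k \<in> carrier_mat n n" "As ! (k - 1) \<in> carrier_mat n n"
    using str_tuplesD[OF t] psd_carrier by auto
  show "j \<noteq> k \<Longrightarrow> common_kernel [As ! k, As ! (k - 1)] \<noteq> {0\<^sub>v n} \<longleftrightarrow> lead_kernel n k j J As"
    using c by (subst common_kernel_nontrivial_iff[of _ n]) (auto simp: lead_kernel_def)
  show "j = k \<Longrightarrow> common_kernel [J, As ! k, As ! (k - 1)] \<noteq> {0\<^sub>v n} \<longleftrightarrow> lead_kernel n k j J As"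
    using c by (subst common_kernel_nontrivial_iff[of _ n]) (auto simp: lead_kernel_def)
qed

text \<open>\<open>A\<^sub>k + A\<^sub>k\<^sub>-\<^sub>1\<close> for \<open>j < k\<close>, and \<open>A\<^sub>k + A\<^sub>k\<^sub>-\<^sub>1 - J\<close> for \<open>j = k\<close>, read off from the coefficients of the
  polynomial. In the first case \<open>J\<close> may occur in the coefficient of degree \<open>k - 1\<close>, and taking the
  symmetric part removes it.\<close>

definition lead_sum :: "nat \<Rightarrow> nat \<Rightarrow> nat \<Rightarrow> real poly mat \<Rightarrow> real mat" where
  "lead_sum n k j P = mat n n (\<lambda>(r, c).
     let y = (\<lambda>r c. coeff (P $$ (r, c)) k + coeff (P $$ (r, c)) (k - 1))
     in if j = k then y r c else (y r c + y c r) / 2)"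

lemma det_lead_sum_eq_0_iff:
  assumes t: "(J, As) \<in> str_tuples n k" and k: "k \<ge> 1"
  shows "det (lead_sum n k j (str_poly n k j J As)) = 0 \<longleftrightarrow> lead_kernel n k j J As"
proof -
  note T = str_tuplesD[OF t]
  let ?J = "if j = k then J else 0\<^sub>m n n"
  have sym: "(As ! i) $$ (c, r) = (As ! i) $$ (r, c)" if "i \<le> k" "r < n" "c < n" for i r c
  proof -
    have "(As ! i)\<^sup>T $$ (r, c) = (As ! i) $$ (r, c)" "As ! i \<in> carrier_mat n n"
      using T(4)[OF that(1)] by (simp_all add: psd_def)
    then show ?thesis using that by simp
  qed
  have "lead_sum n k j (str_poly n k j J As) = dissipative_mat n ?J {k, k - 1} ((!) As)"
  proof (rule eq_matI)
    fix r c assume "r < dim_row (dissipative_mat n ?J {k, k - 1} ((!) As))"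
      "c < dim_col (dissipative_mat n ?J {k, k - 1} ((!) As))"
    then have rc: "r < n" "c < n" by (simp_all add: dissipative_mat_def)
    then show "lead_sum n k j (str_poly n k j J As) $$ (r, c)
        = dissipative_mat n ?J {k, k - 1} ((!) As) $$ (r, c)"
      using k skew_index[OF T(1,2) rc] sym[OF _ rc, of k] sym[OF _ rc, of "k - 1"]
      by (auto simp: lead_sum_def dissipative_mat_def coeff_str_poly Let_def)
  qed (auto simp: lead_sum_def dissipative_mat_def)
  moreover have "?J \<in> carrier_mat n n" "?J\<^sup>T = - ?J" using T by auto
  then have "det (dissipative_mat n ?J {k, k - 1} ((!) As)) = 0 \<longleftrightarrow>
    (\<exists>x\<in>carrier_vec n. x \<noteq> 0\<^sub>v n \<and> ?J *\<^sub>v x = 0\<^sub>v n \<and> (\<forall>i\<in>{k, k - 1}. (As ! i) *\<^sub>v x = 0\<^sub>v n))"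
    using T(4) by (intro det_dissipative_mat_eq_0_iff) auto
  ultimately show ?thesis by (auto simp: lead_kernel_def split: if_splits)
qed

lemma continuous_map_det_lead_sum:
  "continuous_map (coeff_topology n k) euclideanreal (\<lambda>P. det (lead_sum n k j P))"
  unfolding lead_sum_def
proof (rule continuous_map_det)
  fix r c :: nat assume "r < n" "c < n"
  then show "continuous_map (coeff_topology n k) euclideanreal (\<lambda>P.
      let y = (\<lambda>r c. coeff (P $$ (r, c)) k + coeff (P $$ (r, c)) (k - 1))
      in if j = k then y r c else (y r c + y c r) / 2)"
    by (cases "j = k") (auto simp: Let_def intro!: continuous_intros continuous_map_coeff)
qed

lemma higher_index_imp_lead_kernel:
  assumes t: "(J, As) \<in> str_tuples n k" and "k \<ge> 1" "j \<le> k"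
    and "mp_index k (str_poly n k j J As) \<ge> 2"
  shows "lead_kernel n k j J As"
  using mp_index_ge_2D[OF assms] unfolding lead_kernel_def by blast

text \<open>The right-hand side is closed, as the zero set of the determinant of \<open>lead_sum\<close>. Each of its points
  is the end of a ray whose other points have higher index.\<close>

lemma str_closure_higher_index_polys:
  assumes k: "k \<ge> 1" and j: "j \<le> k" and k1: "k = 1 \<Longrightarrow> j = 0 \<and> n \<ge> 2"
  shows "str_closure n k j (higher_index_polys n k j) =
    {str_poly n k j J As | J As. (J, As) \<in> str_tuples n k \<and> lead_kernel n k j J As}"
    (is "?L = ?R")
proof (rule equalityI)
  let ?X = "subtopology (coeff_topology n k) (str_polys n k j)"
  let ?D = "\<lambda>P. det (lead_sum n k j P)"
  have sub: "str_polys n k j \<subseteq> matpolys n k"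
    using str_poly_in_matpolys[OF j] by (auto simp: str_polys_def)
  have top: "topspace ?X = str_polys n k j" using sub by auto
  have R: "?R = {P \<in> topspace ?X. ?D P \<in> {0}}"
    unfolding top unfolding str_polys_def singleton_iff using det_lead_sum_eq_0_iff[OF _ k] by blast
  have "closedin ?X ?R"
    unfolding R by (rule closedin_continuous_map_preimage[where Y = euclideanreal])
      (auto intro: continuous_map_from_subtopology continuous_map_det_lead_sum)
  moreover have "higher_index_polys n k j \<subseteq> ?R"
    using higher_index_imp_lead_kernel[OF _ k j] by (fastforce simp: higher_index_polys_def str_polys_def)
  ultimately show "?L \<subseteq> ?R" unfolding str_closure_def by (intro closure_of_minimal)
next
  show "?R \<subseteq> ?L"
  proof
    fix P assume "P \<in> ?R"
    then obtain J As where P: "P = str_poly n k j J As" and t: "(J, As) \<in> str_tuples n k"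
      and "lead_kernel n k j J As" by blast
    then obtain v where "v \<in> carrier_vec n" "v \<noteq> 0\<^sub>v n" "(As ! k) *\<^sub>v v = 0\<^sub>v n"
      "(As ! (k - 1)) *\<^sub>v v = 0\<^sub>v n" "j = k \<Longrightarrow> J *\<^sub>v v = 0\<^sub>v n"
      unfolding lead_kernel_def by blast
    from exists_higher_index_direction[OF t k j this k1] obtain K Es where
      s: "(K, Es) \<in> str_tuples n k" and
      hi: "\<And>e. e > 0 \<Longrightarrow> str_poly n k j (J + e \<cdot>\<^sub>m K) (move_along As e Es) \<in> higher_index_polys n k j"
      by blast
    note T = str_tuplesD[OF t] and S = str_tuplesD[OF s]
    define g where "g e = str_poly n k j (J + e \<cdot>\<^sub>m K) (move_along As e Es)" for e
    have g_coeff: "coeff (g e $$ (r, c)) i = (As ! i) $$ (r, c) + e * (Es ! i) $$ (r, c)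
        - (if i = j then J $$ (r, c) + e * K $$ (r, c) else 0)"
      if "i \<le> k" "r < n" "c < n" for e i r c
    proof -
      have "As ! i \<in> carrier_mat n n" "Es ! i \<in> carrier_mat n n"
        using T(4) S(4) that(1) psd_carrier by blast+
      then show ?thesis
        using that T(1,3) S(1,3) by (simp add: g_def coeff_str_poly move_along_nth)
    qed
    have cont: "continuous_map euclideanreal (coeff_topology n k) g"
    proof (rule continuous_map_into_coeff_topology)
      fix i r c assume irc: "i \<le> k" "r < n" "c < n"
      show "continuous_map euclideanreal euclideanreal (\<lambda>e. coeff (g e $$ (r, c)) i)"
        unfolding g_coeff[OF irc] by (cases "i = j") (auto intro!: continuous_intros)
    qed (use str_poly_in_matpolys[OF j] in \<open>simp add: g_def\<close>)
    have "P = g 0"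
    proof (rule eq_matI)
      fix r c assume "r < dim_row (g 0)" "c < dim_col (g 0)"
      then have rc: "r < n" "c < n" by (simp_all add: g_def)
      show "P $$ (r, c) = g 0 $$ (r, c)"
      proof (rule poly_eqI)
        fix i
        show "coeff (P $$ (r, c)) i = coeff (g 0 $$ (r, c)) i"
        proof (cases "i \<le> k")
          case True
          then show ?thesis using rc by (simp add: g_coeff P coeff_str_poly)
        next
          case False
          with j have "i \<noteq> j" by simp
          with False rc show ?thesis by (simp add: g_def P coeff_str_poly)
        qed
      qed
    qed (simp_all add: g_def P)
    moreover have "(0 :: real) \<in> euclideanreal closure_of {0<..}" by simp
    ultimately have "P \<in> g ` (euclideanreal closure_of {0<..})" by blast
    also have "\<dots> \<subseteq> coeff_topology n k closure_of (g ` {0<..})"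
      by (rule continuous_map_image_closure_subset[OF cont])
    also have "\<dots> \<subseteq> coeff_topology n k closure_of (higher_index_polys n k j)"
      using hi by (intro closure_of_mono) (auto simp: g_def)
    finally have "P \<in> coeff_topology n k closure_of (higher_index_polys n k j)" .
    moreover have "str_polys n k j \<inter> higher_index_polys n k j = higher_index_polys n k j"
      by (auto simp: higher_index_polys_def)
    moreover have "P \<in> str_polys n k j" using P t by (auto simp: str_polys_def)
    ultimately show "P \<in> ?L" by (simp add: str_closure_def closure_of_subtopology)
  qed
qed

section \<open>Distances\<close>

definition frob_sq :: "nat \<Rightarrow> real mat \<Rightarrow> real" where
  "frob_sq n M = (\<Sum>r<n. \<Sum>c<n. (M $$ (r, c))\<^sup>2)"

definition tuple_dist ::
    "nat \<Rightarrow> nat \<Rightarrow> real mat \<Rightarrow> real mat list \<Rightarrow> real mat \<Rightarrow> real mat list \<Rightarrow> real" where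
  "tuple_dist n l J Xs J' Xs' = sqrt (frob_sq n (J' - J) + (\<Sum>i\<le>l. frob_sq n (Xs' ! i - Xs ! i)))"

lemma frob_sq_nonneg: "frob_sq n M \<ge> 0"
  by (auto simp: frob_sq_def intro!: sum_nonneg)

text \<open>The coefficient of degree \<open>j\<close> is the difference of a symmetric and a skew-symmetric matrix, and
  these are orthogonal.\<close>

lemma mp_norm_str_poly_diff:
  assumes t: "(J, As) \<in> str_tuples n k" and t': "(J', As') \<in> str_tuples n k" and j: "j \<le> k"
  shows "mp_norm k (str_poly n k j J' As' - str_poly n k j J As) = tuple_dist n k J As J' As'"
proof -
  let ?D = "str_poly n k j J' As' - str_poly n k j J As"
  note T = str_tuplesD[OF t] and T' = str_tuplesD[OF t']
  have D: "(\<Sum>r<n. \<Sum>c<n. (mp_coeff ?D i $$ (r, c))\<^sup>2)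
      = frob_sq n (As' ! i - As ! i) + (if i = j then frob_sq n (J' - J) else 0)" if i: "i \<le> k" for i
  proof -
    have A: "As ! i \<in> carrier_mat n n" "(As ! i)\<^sup>T = As ! i" "As' ! i \<in> carrier_mat n n" "(As' ! i)\<^sup>T = As' ! i"
      using T(4)[OF i] T'(4)[OF i] by (auto simp: psd_def)
    define S where "S r c = (As' ! i - As ! i) $$ (r, c)" for r c
    define K where "K r c = (if i = j then (J' - J) $$ (r, c) else 0)" for r c
    have S: "S c r = S r c" if "r < n" "c < n" for r c
    proof -
      have "(As ! i)\<^sup>T $$ (r, c) = (As ! i) $$ (r, c)" "(As' ! i)\<^sup>T $$ (r, c) = (As' ! i) $$ (r, c)"
        by (simp_all only: A(2,4))
      then show ?thesis using that A(1,3) by (simp add: S_def)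
    qed
    have K: "K c r = - K r c" if "r < n" "c < n" for r c
      using skew_index[OF T(1,2) that] skew_index[OF T'(1,2) that] that T(1) T'(1) by (simp add: K_def)
    have "mp_coeff ?D i $$ (r, c) = S r c - K r c" if "r < n" "c < n" for r c
    proof -
      have "mp_coeff ?D i $$ (r, c)
          = coeff (str_poly n k j J' As' $$ (r, c)) i - coeff (str_poly n k j J As $$ (r, c)) i"
        using that by (simp add: mp_coeff_def)
      then show ?thesis
        unfolding coeff_str_poly[OF that] using that i A(1,3) T(1) T'(1) by (simp add: S_def K_def)
    qed
    then have "(\<Sum>r<n. \<Sum>c<n. (mp_coeff ?D i $$ (r, c))\<^sup>2) = (\<Sum>r<n. \<Sum>c<n. (S r c - K r c)\<^sup>2)"
      by (intro sum.cong refl) auto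
    also have "\<dots> = (\<Sum>r<n. \<Sum>c<n. (S r c)\<^sup>2) + (\<Sum>r<n. \<Sum>c<n. (K r c)\<^sup>2)"
      using S K by (intro frobenius_symmetric_minus_skew)
    finally show ?thesis by (simp add: S_def K_def frob_sq_def)
  qed
  have sq: "(\<Sum>r<dim_row (mp_coeff ?D i). \<Sum>c<dim_col (mp_coeff ?D i). (mp_coeff ?D i $$ (r, c))\<^sup>2)
      = (\<Sum>r<n. \<Sum>c<n. (mp_coeff ?D i $$ (r, c))\<^sup>2)" for i
    by (simp add: mp_coeff_def)
  have "mp_norm k ?D = sqrt (\<Sum>i\<leftarrow>[0..<Suc k]. \<Sum>r<n. \<Sum>c<n. (mp_coeff ?D i $$ (r, c))\<^sup>2)"
    unfolding mp_norm_def frob_norm_def map_map o_def sq ..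
  also have "(\<Sum>i\<leftarrow>[0..<Suc k]. \<Sum>r<n. \<Sum>c<n. (mp_coeff ?D i $$ (r, c))\<^sup>2)
      = (\<Sum>i\<le>k. \<Sum>r<n. \<Sum>c<n. (mp_coeff ?D i $$ (r, c))\<^sup>2)"
    by (simp only: interv_sum_list_conv_sum_set_nat set_upt atLeast0LessThan lessThan_Suc_atMost)
  also have "(\<Sum>i\<le>k. \<Sum>r<n. \<Sum>c<n. (mp_coeff ?D i $$ (r, c))\<^sup>2)
      = (\<Sum>i\<le>k. frob_sq n (As' ! i - As ! i) + (if i = j then frob_sq n (J' - J) else 0))"
    using D by (intro sum.cong) auto
  also have "\<dots> = frob_sq n (J' - J) + (\<Sum>i\<le>k. frob_sq n (As' ! i - As ! i))"
    using j by (simp add: sum.distrib)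
  finally show ?thesis by (simp add: tuple_dist_def)
qed

text \<open>A structured perturbation of a structured polynomial is the same thing as another tuple of data.\<close>

lemma str_poly_perturbations:
  assumes t: "(J, As) \<in> str_tuples n k" and j: "j \<le> k"
  shows "{ereal (mp_norm k D) | D. D \<in> matpolys n k \<and> str_poly n k j J As + D \<in> str_polys n k j \<and>
        Q (str_poly n k j J As + D)}
    = {ereal (tuple_dist n k J As J' As') | J' As'. (J', As') \<in> str_tuples n k \<and> Q (str_poly n k j J' As')}"
    (is "?L = ?R")
proof (intro equalityI subsetI)
  let ?P = "str_poly n k j J As"
  fix x assume "x \<in> ?L"
  then obtain D J' As' where x: "x = ereal (mp_norm k D)" and D: "D \<in> matpolys n k"
    and t': "(J', As') \<in> str_tuples n k" and eq: "?P + D = str_poly n k j J' As'" and Q: "Q (?P + D)"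
    unfolding str_polys_def by blast
  have "D \<in> carrier_mat n n" using D by (simp add: matpolys_def)
  then have "D = str_poly n k j J' As' - ?P" unfolding eq[symmetric] by (intro eq_matI) auto
  then have "x = ereal (tuple_dist n k J As J' As')"
    unfolding x using mp_norm_str_poly_diff[OF t t' j] by simp
  with t' Q show "x \<in> ?R" unfolding eq by blast
next
  let ?P = "str_poly n k j J As"
  fix x assume "x \<in> ?R"
  then obtain J' As' where x: "x = ereal (tuple_dist n k J As J' As')"
    and t': "(J', As') \<in> str_tuples n k" and Q: "Q (str_poly n k j J' As')" by blast
  let ?D = "str_poly n k j J' As' - ?P"
  have "?P + ?D = str_poly n k j J' As'" by (rule eq_matI) auto
  moreover have "?D \<in> matpolys n k"
    using str_poly_in_matpolys[OF j, of n J As] str_poly_in_matpolys[OF j, of n J' As']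
    by (auto simp: matpolys_def intro!: minus_carrier_mat degree_diff_le)
  moreover have "str_poly n k j J' As' \<in> str_polys n k j" using t' by (auto simp: str_polys_def)
  moreover have "x = ereal (mp_norm k ?D)" unfolding x mp_norm_str_poly_diff[OF t t' j] ..
  ultimately show "x \<in> ?L" using Q by (intro CollectI exI[of _ ?D] conjI) simp_all
qed

lemma d_ck_eq_Inf_tuple_dist:
  assumes J: "J \<in> carrier_mat n n" and Xs: "length Xs = Suc l" "set Xs \<subseteq> carrier_mat n n"
  shows "d_ck n J Xs = Inf {ereal (tuple_dist n l J Xs J' Xs') | J' Xs'.
    (J', Xs') \<in> str_tuples n l \<and> common_kernel (J' # Xs') \<noteq> {0\<^sub>v n}}"
proof -
  have norm: "frob_norm (D # Ds) = sqrt (frob_sq n D + (\<Sum>i\<le>l. frob_sq n (Ds ! i)))"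
    if "D \<in> carrier_mat n n" "length Ds = Suc l" "set Ds \<subseteq> carrier_mat n n" for D Ds
  proof -
    have "(\<Sum>Y\<leftarrow>Ds. \<Sum>r<dim_row Y. \<Sum>c<dim_col Y. (Y $$ (r, c))\<^sup>2) = (\<Sum>Y\<leftarrow>Ds. frob_sq n Y)"
      using that(3) by (intro arg_cong[of _ _ sum_list] map_cong refl) (auto simp: frob_sq_def)
    also have "\<dots> = (\<Sum>i\<le>l. frob_sq n (Ds ! i))"
      using that(2) by (simp add: sum_list_sum_nth atLeast0LessThan lessThan_Suc_atMost)
    finally show ?thesis using that(1) by (simp add: frob_norm_def frob_sq_def)
  qed
  have eq: "{ereal (frob_norm (DJ # DXs)) | DJ DXs.
     DJ \<in> carrier_mat n n \<and> length DXs = length Xs \<and> set DXs \<subseteq> carrier_mat n n \<and>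
     (J + DJ, map2 (+) Xs DXs) \<in> str_tuples n (length Xs - 1) \<and>
     common_kernel ((J + DJ) # map2 (+) Xs DXs) \<noteq> {0\<^sub>v n}} =
    {ereal (tuple_dist n l J Xs J' Xs') | J' Xs'.
    (J', Xs') \<in> str_tuples n l \<and> common_kernel (J' # Xs') \<noteq> {0\<^sub>v n}}" (is "?L = ?R")
  proof (intro equalityI subsetI)
    fix x assume "x \<in> ?L"
    then obtain D Ds where x: "x = ereal (frob_norm (D # Ds))" and D: "D \<in> carrier_mat n n"
      and Ds: "length Ds = Suc l" "set Ds \<subseteq> carrier_mat n n"
      and t: "(J + D, map2 (+) Xs Ds) \<in> str_tuples n l"
      and ck: "common_kernel ((J + D) # map2 (+) Xs Ds) \<noteq> {0\<^sub>v n}"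
      using Xs(1) by auto
    have "J + D - J = D" using J D by (intro eq_matI) auto
    moreover have "map2 (+) Xs Ds ! i - Xs ! i = Ds ! i" if "i \<le> l" for i
    proof -
      have "i < length Xs" "i < length Ds" using that Xs Ds by simp_all
      then have "Xs ! i \<in> carrier_mat n n" "Ds ! i \<in> carrier_mat n n"
        using Xs(2) Ds(2) nth_mem by blast+
      with \<open>i < length Xs\<close> \<open>i < length Ds\<close> show ?thesis by (intro eq_matI) auto
    qed
    ultimately have "frob_norm (D # Ds) = tuple_dist n l J Xs (J + D) (map2 (+) Xs Ds)"
      by (simp add: norm[OF D Ds] tuple_dist_def)
    then show "x \<in> ?R" using x t ck by blast
  next
    fix x assume "x \<in> ?R"
    then obtain J' Xs' where x: "x = ereal (tuple_dist n l J Xs J' Xs')"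
      and t: "(J', Xs') \<in> str_tuples n l" and ck: "common_kernel (J' # Xs') \<noteq> {0\<^sub>v n}" by blast
    note T = str_tuplesD[OF t]
    let ?D = "J' - J" and ?Ds = "map2 (-) Xs' Xs"
    have Xc: "Xs ! i \<in> carrier_mat n n" "Xs' ! i \<in> carrier_mat n n" if "i \<le> l" for i
      using that Xs T psd_carrier nth_mem[of i Xs] by auto
    have D: "?D \<in> carrier_mat n n" using J by (rule minus_carrier_mat)
    have Ds: "length ?Ds = Suc l" using T(3) Xs(1) by simp
    have Ds': "set ?Ds \<subseteq> carrier_mat n n"
      using Xc T(3) Xs(1) by (auto simp: set_zip less_Suc_eq_le intro!: minus_carrier_mat)
    have JJ: "J + ?D = J'" using J T(1) by (intro eq_matI) auto
    have XX: "map2 (+) Xs ?Ds = Xs'"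
    proof (rule nth_equalityI)
      fix i assume "i < length (map2 (+) Xs ?Ds)"
      then have i: "i \<le> l" "i < length Xs" "i < length Xs'" using T(3) Xs(1) by auto
      show "map2 (+) Xs ?Ds ! i = Xs' ! i" using i Xc[OF i(1)] by (auto intro!: eq_matI)
    qed (use T(3) Xs(1) in simp)
    have "frob_norm (?D # ?Ds) = tuple_dist n l J Xs J' Xs'"
      unfolding norm[OF D Ds Ds'] tuple_dist_def using T(3) Xs(1) by simp
    then show "x \<in> ?L"
      unfolding x using D Ds Ds' JJ XX t ck Xs(1)
      by (intro CollectI exI[of _ ?D] exI[of _ ?Ds]) simp
  qed
  show ?thesis unfolding d_ck_def eq ..
qed

lemma d_sing_eq_d_ck:
  assumes t: "(J, As) \<in> str_tuples n k" and j: "j \<le> k"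
  shows "d_sing n k j (str_poly n k j J As) = d_ck n J As"
proof -
  note T = str_tuplesD[OF t]
  have "set As \<subseteq> carrier_mat n n" using T psd_carrier by (auto simp: in_set_conv_nth)
  note ck = d_ck_eq_Inf_tuple_dist[OF T(1,3) this]
  show ?thesis
    unfolding d_sing_def str_poly_perturbations[OF t j] ck
    by (rule arg_cong[of _ _ Inf], rule Collect_cong) (use singular_mp_iff[OF _ j] in blast)
qed

lemma tuple_dist_tendsto:
  assumes t: "(J', As') \<in> str_tuples n k" and s: "(K, Es) \<in> str_tuples n k"
    and u: "(J, As) \<in> str_tuples n k"
  shows "((\<lambda>e. tuple_dist n k J As (J' + e \<cdot>\<^sub>m K) (move_along As' e Es)) \<longlongrightarrow> tuple_dist n k J As J' As')
    (at_right 0)"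
proof -
  note T = str_tuplesD[OF t] and S = str_tuplesD[OF s] and U = str_tuplesD[OF u]
  define h where "h e = sqrt ((\<Sum>r<n. \<Sum>c<n. (J' $$ (r, c) + e * K $$ (r, c) - J $$ (r, c))\<^sup>2)
    + (\<Sum>i\<le>k. \<Sum>r<n. \<Sum>c<n. ((As' ! i) $$ (r, c) + e * (Es ! i) $$ (r, c) - (As ! i) $$ (r, c))\<^sup>2))"
    for e
  have c: "As' ! i \<in> carrier_mat n n" "Es ! i \<in> carrier_mat n n" "As ! i \<in> carrier_mat n n" if "i \<le> k" for i
    using that T S U psd_carrier by auto
  have "tuple_dist n k J As (J' + e \<cdot>\<^sub>m K) (move_along As' e Es) = h e" for e
  proof -
    have "frob_sq n (move_along As' e Es ! i - As ! i)
        = (\<Sum>r<n. \<Sum>c<n. ((As' ! i) $$ (r, c) + e * (Es ! i) $$ (r, c) - (As ! i) $$ (r, c))\<^sup>2)"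
      if "i \<le> k" for i
      using that c[OF that] T(3) S(3) by (simp add: frob_sq_def move_along_nth)
    moreover have "frob_sq n (J' + e \<cdot>\<^sub>m K - J)
        = (\<Sum>r<n. \<Sum>c<n. (J' $$ (r, c) + e * K $$ (r, c) - J $$ (r, c))\<^sup>2)"
      using T(1) S(1) U(1) by (simp add: frob_sq_def)
    ultimately show ?thesis by (simp add: tuple_dist_def h_def)
  qed
  moreover have "tuple_dist n k J As J' As' = h 0"
  proof -
    have "frob_sq n (As' ! i - As ! i)
        = (\<Sum>r<n. \<Sum>c<n. ((As' ! i) $$ (r, c) + 0 * (Es ! i) $$ (r, c) - (As ! i) $$ (r, c))\<^sup>2)"
      if "i \<le> k" for i
      using that c[OF that] by (simp add: frob_sq_def)
    moreover have "frob_sq n (J' - J)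
        = (\<Sum>r<n. \<Sum>c<n. (J' $$ (r, c) + 0 * K $$ (r, c) - J $$ (r, c))\<^sup>2)"
      using T(1) U(1) by (simp add: frob_sq_def)
    ultimately show ?thesis by (simp add: tuple_dist_def h_def)
  qed
  moreover have "(h \<longlongrightarrow> h 0) (at_right 0)"
    unfolding h_def by (intro tendsto_intros)
  ultimately show ?thesis by simp
qed

text \<open>Only \<open>A\<^sub>k\<close>, \<open>A\<^sub>k\<^sub>-\<^sub>1\<close> and, for \<open>j = k\<close>, \<open>J\<close> have to be moved in order to reach a common kernel;
  restricting a perturbation to these matrices does not increase its norm. A perturbation that
  produces a common kernel need not produce higher index itself, but it is a limit of perturbations
  that do.\<close>

lemma d_hi_eq_d_ck:
  assumes t: "(J, As) \<in> str_tuples n k" and k: "k \<ge> 1" and j: "j \<le> k"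
    and k1: "k = 1 \<Longrightarrow> j = 0 \<and> n \<ge> 2"
  shows "d_hi n k j (str_poly n k j J As) =
    d_ck n (if j = k then J else 0\<^sub>m n n) [As ! k, As ! (k - 1)]"
proof -
  note T = str_tuplesD[OF t]
  let ?J = "if j = k then J else 0\<^sub>m n n" and ?Xs = "[As ! k, As ! (k - 1)]"
  have Ac: "As ! i \<in> carrier_mat n n" if "i \<le> k" for i using T(4) that psd_carrier by blast
  have "?J \<in> carrier_mat n n" "length ?Xs = Suc 1" "set ?Xs \<subseteq> carrier_mat n n"
    using T(1) Ac by auto
  note ck = d_ck_eq_Inf_tuple_dist[OF this]
  have hi: "d_hi n k j (str_poly n k j J As) = Inf {ereal (tuple_dist n k J As J' As') | J' As'.
      (J', As') \<in> str_tuples n k \<and> mp_index k (str_poly n k j J' As') \<ge> 2}"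
    unfolding d_hi_def by (rule arg_cong[of _ _ Inf]) (rule str_poly_perturbations[OF t j])
  have two: "{..1 :: nat} = {0, 1}" by auto
  have kk: "k = k - Suc 0 \<longleftrightarrow> False" using k by simp
  show ?thesis
  proof (rule antisym)
    show "d_ck n ?J ?Xs \<le> d_hi n k j (str_poly n k j J As)"
      unfolding hi
    proof (rule Inf_greatest, elim CollectE exE conjE)
      fix x J' As' assume x: "x = ereal (tuple_dist n k J As J' As')"
        and t': "(J', As') \<in> str_tuples n k" and idx: "mp_index k (str_poly n k j J' As') \<ge> 2"
      note T' = str_tuplesD[OF t']
      let ?J' = "if j = k then J' else 0\<^sub>m n n" and ?Xs' = "[As' ! k, As' ! (k - 1)]"
      have s: "(?J', ?Xs') \<in> str_tuples n 1"
        using T' by (auto simp: str_tuples_def)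
      have "lead_kernel n k j J' As'" using higher_index_imp_lead_kernel[OF t' k j idx] .
      then have "common_kernel (?J' # ?Xs') \<noteq> {0\<^sub>v n}"
        using T'(1,4) psd_carrier by (subst common_kernel_nontrivial_iff[of _ n]) (auto simp: lead_kernel_def)
      with s have "d_ck n ?J ?Xs \<le> ereal (tuple_dist n 1 ?J ?Xs ?J' ?Xs')"
        unfolding ck by (intro Inf_lower) blast
      also have "tuple_dist n 1 ?J ?Xs ?J' ?Xs' \<le> tuple_dist n k J As J' As'"
        unfolding tuple_dist_def
      proof (intro real_sqrt_le_mono add_mono)
        show "frob_sq n (?J' - ?J) \<le> frob_sq n (J' - J)"
          by (cases "j = k") (simp_all add: frob_sq_nonneg, simp add: frob_sq_def sum_nonneg)
        have "(\<Sum>i\<le>1. frob_sq n (?Xs' ! i - ?Xs ! i)) = (\<Sum>i\<in>{k, k - 1}. frob_sq n (As' ! i - As ! i))"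
          using k kk by (simp add: two)
        also have "\<dots> \<le> (\<Sum>i\<le>k. frob_sq n (As' ! i - As ! i))"
          by (intro sum_mono2) (auto simp: frob_sq_nonneg)
        finally show "(\<Sum>i\<le>1. frob_sq n (?Xs' ! i - ?Xs ! i)) \<le> (\<Sum>i\<le>k. frob_sq n (As' ! i - As ! i))" .
      qed
      finally show "d_ck n ?J ?Xs \<le> x" using x by simp
    qed
  next
    show "d_hi n k j (str_poly n k j J As) \<le> d_ck n ?J ?Xs"
      unfolding ck
    proof (rule Inf_greatest, elim CollectE exE conjE)
      fix x K Zs assume x: "x = ereal (tuple_dist n 1 ?J ?Xs K Zs)"
        and s: "(K, Zs) \<in> str_tuples n 1" and ker: "common_kernel (K # Zs) \<noteq> {0\<^sub>v n}"
      note S = str_tuplesD[OF s]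
      \<comment> \<open>the data outside the common kernel condition keep their values, at no cost\<close>
      define J' where "J' = (if j = k then K else J)"
      define As' where "As' = As[k := Zs ! 0, k - 1 := Zs ! 1]"
      have nth: "As' ! i = (if i = k - 1 then Zs ! 1 else if i = k then Zs ! 0 else As ! i)" if "i \<le> k" for i
        using that T(3) k by (auto simp: As'_def nth_list_update)
      have t': "(J', As') \<in> str_tuples n k"
      proof (rule str_tuplesI)
        show "psd n (As' ! i)" if "i \<le> k" for i
          using that T(4) S(4) by (simp add: nth)
      qed (use S T in \<open>auto simp: J'_def As'_def\<close>)
      obtain v where "v \<in> carrier_vec n" "v \<noteq> 0\<^sub>v n" "(As' ! k) *\<^sub>v v = 0\<^sub>v n"
        "(As' ! (k - 1)) *\<^sub>v v = 0\<^sub>v n" "j = k \<Longrightarrow> J' *\<^sub>v v = 0\<^sub>v n"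
        using ker k unfolding str_tuple_common_kernel_iff[OF s] by (auto simp: nth J'_def)
      from exists_higher_index_direction[OF t' k j this k1] obtain L Es where
        e: "(L, Es) \<in> str_tuples n k" and
        hip: "\<And>e. e > 0 \<Longrightarrow> str_poly n k j (J' + e \<cdot>\<^sub>m L) (move_along As' e Es) \<in> higher_index_polys n k j"
        by blast
      have "d_hi n k j (str_poly n k j J As) \<le> ereal (tuple_dist n k J As J' As')"
      proof (rule tendsto_lowerbound)
        show "((\<lambda>e. ereal (tuple_dist n k J As (J' + e \<cdot>\<^sub>m L) (move_along As' e Es)))
            \<longlongrightarrow> ereal (tuple_dist n k J As J' As')) (at_right 0)"
          by (intro tendsto_intros tuple_dist_tendsto t' e t)
        have "d_hi n k j (str_poly n k j J As)
            \<le> ereal (tuple_dist n k J As (J' + \<epsilon> \<cdot>\<^sub>m L) (move_along As' \<epsilon> Es))" if "\<epsilon> > 0" for \<epsilon>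
        proof -
          have "(J' + \<epsilon> \<cdot>\<^sub>m L, move_along As' \<epsilon> Es) \<in> str_tuples n k"
            using that by (intro str_tuples_move t' e) simp
          then show ?thesis
            using hip[OF that] unfolding hi
            by (intro Inf_lower) (force simp: higher_index_polys_def)
        qed
        then show "\<forall>\<^sub>F \<epsilon> in at_right 0. d_hi n k j (str_poly n k j J As)
            \<le> ereal (tuple_dist n k J As (J' + \<epsilon> \<cdot>\<^sub>m L) (move_along As' \<epsilon> Es))"
          by (auto simp: eventually_at_filter)
      qed simp
      also have "tuple_dist n k J As J' As' \<le> tuple_dist n 1 ?J ?Xs K Zs"
        unfolding tuple_dist_def
      proof (intro real_sqrt_le_mono add_mono)
        have "frob_sq n (J - J) = 0" using T(1) by (simp add: frob_sq_def)
        then show "frob_sq n (J' - J) \<le> frob_sq n (K - ?J)"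
          by (simp add: J'_def frob_sq_nonneg)
        have "frob_sq n (As' ! i - As ! i) = 0" if "i \<in> {..k} - {k, k - 1}" for i
          using that Ac[of i] by (auto simp: nth frob_sq_def)
        then have "(\<Sum>i\<le>k. frob_sq n (As' ! i - As ! i)) = (\<Sum>i\<in>{k, k - 1}. frob_sq n (As' ! i - As ! i))"
          by (intro sum.mono_neutral_right) auto
        also have "\<dots> = (\<Sum>i\<le>1. frob_sq n (Zs ! i - ?Xs ! i))"
          using k kk by (simp add: two nth)
        finally show "(\<Sum>i\<le>k. frob_sq n (As' ! i - As ! i)) \<le> (\<Sum>i\<le>1. frob_sq n (Zs ! i - ?Xs ! i))"
          by simp
      qed
      finally show "d_hi n k j (str_poly n k j J As) \<le> x" using x by simp
    qed
  qed
qed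

text \<open>Here \<open>k = 1\<close>, and index two needs \<open>j = 0\<close> and \<open>Jv \<noteq> 0\<close>. This fails for \<open>j = k\<close>, and for
  \<open>n = 1\<close>, where \<open>J = 0\<close>.\<close>

lemma mp_index_less_2:
  assumes t: "(J, As) \<in> str_tuples n k" and n: "n \<ge> 1" and k: "k \<ge> 1" and j: "j \<le> k"
    and triv: "max n k = 1 \<or> j = k \<and> k = 1"
  shows "\<not> mp_index k (str_poly n k j J As) \<ge> 2"
proof
  assume "mp_index k (str_poly n k j J As) \<ge> 2"
  from mp_index_ge_2D[OF t k j this] triv k obtain v where v: "v \<in> carrier_vec n"
    and "j = 0" "J *\<^sub>v v \<noteq> 0\<^sub>v n" "k = 1"
    by (auto simp: max_def split: if_splits)
  moreover from this triv n have "n = 1" by (auto simp: max_def split: if_splits)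
  ultimately show False
    using skew_index[OF str_tuplesD(1,2)[OF t], of 0 0] str_tuplesD(1)[OF t]
      mult_mat_vec_index_sum[OF str_tuplesD(1)[OF t] v, of 0]
    by (auto simp: vec_eq_iff simp del: index_mult_mat_vec)
qed

theorem theorem16:
  fixes n k j :: nat
  assumes "n \<ge> 1" and "k \<ge> 1" and "j \<le> k"
  shows
    "(\<forall>J As. (J, As) \<in> str_tuples n k \<longrightarrow>
        (singular_mp (str_poly n k j J As) \<longleftrightarrow> singular_matrix (mp_eval (str_poly n k j J As) 1)) \<and>
        (singular_mp (str_poly n k j J As) \<longleftrightarrow> common_kernel (J # As) \<noteq> {0\<^sub>v n}))
   \<and> (\<forall>J As. (J, As) \<in> str_tuples n k \<longrightarrow>
        d_sing n k j (str_poly n k j J As) = d_ck n J As)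
   \<and> ((max n k > 1 \<and> j < k \<longrightarrow>
          str_closure n k j (higher_index_polys n k j) =
            {str_poly n k j J As | J As. (J, As) \<in> str_tuples n k \<and>
               common_kernel [As ! k, As ! (k - 1)] \<noteq> {0\<^sub>v n}}) \<and>
      (j = k \<and> k > 1 \<longrightarrow>
          str_closure n k j (higher_index_polys n k j) =
            {str_poly n k j J As | J As. (J, As) \<in> str_tuples n k \<and>
               common_kernel [J, As ! k, As ! (k - 1)] \<noteq> {0\<^sub>v n}}) \<and>
      (max n k = 1 \<or> (j = k \<and> k = 1) \<longrightarrow> higher_index_polys n k j = {}))
   \<and> (\<forall>J As. (J, As) \<in> str_tuples n k \<longrightarrow>
        (max n k > 1 \<and> j < k \<longrightarrow>
          d_hi n k j (str_poly n k j J As) = d_ck n (0\<^sub>m n n) [As ! k, As ! (k - 1)]) \<and>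
        (j = k \<and> k > 1 \<longrightarrow>
          d_hi n k j (str_poly n k j J As) = d_ck n J [As ! k, As ! (k - 1)]) \<and>
        (max n k = 1 \<or> (j = k \<and> k = 1) \<longrightarrow>
          d_hi n k j (str_poly n k j J As) = \<infinity>))"
proof (intro conjI allI impI)
  fix J As assume t: "(J, As) \<in> str_tuples n k"
  let ?P = "str_poly n k j J As"
  show ck: "singular_mp ?P \<longleftrightarrow> common_kernel (J # As) \<noteq> {0\<^sub>v n}"
    using singular_mp_iff[OF t assms(3)] .
  then show "singular_mp ?P \<longleftrightarrow> singular_matrix (mp_eval ?P 1)"
    using singular_matrix_eval_iff[OF t] by simp
  show "d_sing n k j ?P = d_ck n J As" using d_sing_eq_d_ck[OF t assms(3)] .
  show "d_hi n k j ?P = d_ck n (0\<^sub>m n n) [As ! k, As ! (k - 1)]" if "max n k > 1 \<and> j < k"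
    using d_hi_eq_d_ck[OF t assms(2,3)] that by auto
  show "d_hi n k j ?P = d_ck n J [As ! k, As ! (k - 1)]" if "j = k \<and> k > 1"
    using d_hi_eq_d_ck[OF t assms(2,3)] that by auto
  show "d_hi n k j ?P = \<infinity>" if "max n k = 1 \<or> (j = k \<and> k = 1)"
  proof -
    have no: "\<not> mp_index k Q \<ge> 2" if "Q \<in> str_polys n k j" for Q
      using mp_index_less_2[OF _ assms \<open>max n k = 1 \<or> (j = k \<and> k = 1)\<close>] that
      by (auto simp: str_polys_def)
    have none: "{ereal (mp_norm k D) | D. D \<in> matpolys n k \<and> ?P + D \<in> str_polys n k j \<and>
        mp_index k (?P + D) \<ge> 2} = {}"
      using no by blast
    show ?thesis unfolding d_hi_def none by (simp add: top_ereal_def)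
  qed
next
  assume h: "max n k > 1 \<and> j < k"
  have cl: "str_closure n k j (higher_index_polys n k j) =
      {str_poly n k j J As | J As. (J, As) \<in> str_tuples n k \<and> lead_kernel n k j J As}"
    by (rule str_closure_higher_index_polys[OF assms(2,3)]) (use h in auto)
  have "common_kernel [As ! k, As ! (k - 1)] \<noteq> {0\<^sub>v n} \<longleftrightarrow> lead_kernel n k j J As"
    if "(J, As) \<in> str_tuples n k" for J As
    using common_kernel_lead_iff(1)[OF that, of j] h by simp
  then show "str_closure n k j (higher_index_polys n k j) =
    {str_poly n k j J As | J As. (J, As) \<in> str_tuples n k \<and>
      common_kernel [As ! k, As ! (k - 1)] \<noteq> {0\<^sub>v n}}"
    unfolding cl by (intro Collect_cong ex_cong1 conj_cong refl) simp
next
  assume h: "j = k \<and> k > 1"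
  have cl: "str_closure n k j (higher_index_polys n k j) =
      {str_poly n k j J As | J As. (J, As) \<in> str_tuples n k \<and> lead_kernel n k j J As}"
    by (rule str_closure_higher_index_polys[OF assms(2,3)]) (use h in auto)
  have "common_kernel [J, As ! k, As ! (k - 1)] \<noteq> {0\<^sub>v n} \<longleftrightarrow> lead_kernel n k j J As"
    if "(J, As) \<in> str_tuples n k" for J As
    using common_kernel_lead_iff(2)[OF that, of j] h by simp
  then show "str_closure n k j (higher_index_polys n k j) =
    {str_poly n k j J As | J As. (J, As) \<in> str_tuples n k \<and>
      common_kernel [J, As ! k, As ! (k - 1)] \<noteq> {0\<^sub>v n}}"
    unfolding cl by (intro Collect_cong ex_cong1 conj_cong refl) simp
next
  assume h: "max n k = 1 \<or> (j = k \<and> k = 1)"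
  show "higher_index_polys n k j = {}"
    using mp_index_less_2[OF _ assms h] by (fastforce simp: higher_index_polys_def str_polys_def)
qed

end
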